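(* Let $\{p_k/q_k\}\subset(0,1)$ be an irrationally tuned sequence of even rational parameters converging to an irrational number, let $\omega_k=p_k+q_k$, and for each $k$ let $B_k$ be a block associated to $p_k/q_k$. Let $N$ be any fixed positive integer. Then there is some $\delta>0$ such that for all sufficiently large $k$: at least $N$ distinct plaid polygons (for $p_k/q_k$) contained in $B_k$ have $x$-diameter at least $\delta\omega_k$, and every point of $B_k$ is within distance $\omega_k/N$ of a plaid polygon of $x$-diameter at least $\delta\omega_k$.
   Context: An even rational parameter is a rational $p/q\in(0,1)$, $p,q$ positive coprime integers, $pq$ even. Put $\omega=p+q$, $P=2p/\omega$, $Q=2q/\omega$. Tune: let $\alpha$ be the unique integer in $(0,\omega/2)$ with $2\alpha p\equiv\pm1\pmod\omega$, and $\tau(p/q)=\alpha/\omega$. A sequence of parameters is irrationally tuned if $\tau(p_k/q_k)$ converges to an irrational number. Line families: $\mathcal H$ = lines $y=n$, $\mathcal V$ = lines $x=n$ ($n\in\mathbb Z$), $\mathcal P$ = lines of slope $-P$ with integer $y$-intercept, $\mathcal Q$ = lines of slope $-Q$ with integer $y$-intercept. Functions mod $2\mathbb Z$, values represented in $(-1,1]$: $F_H=2Py$, $F_V=2Px$, $F_P=Py+P^2x+1$, $F_Q=Py+PQx+1$. A unit segment is an edge of a unit square of the integer grid; horizontal ones lie on $\mathcal H$-lines (set $A=H$), vertical ones on $\mathcal V$-lines ($A=V$). A point $z$ of a unit segment $s$ is a light point of $s$ if for some $B\in\{P,Q\}$, $z$ lies on a line of $\mathcal B$, $F_A(z)F_B(z)>0$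 and $|F_B(z)|<|F_A(z)|$. The light count of $s$ is the number of distinct light points of $s$, a light point that is the midpoint of a horizontal $s$ counted twice; $s$ is good if its light count is $1$. In each unit square draw the segments joining its center to the midpoints of its good edges; plaid polygons are the connected components of the union of all these segments. A block is a square $[0,\omega]^2+\ell$ with $\ell$ in the lattice generated by $(\omega^2,0)$ and $(0,\omega)$. The $x$-diameter of a planar set is the diameter of its projection to the $x$-axis. *)

theory Defs
  imports "HOL-Analysis.Analysis"
begin

definition even_param :: "nat \<Rightarrow> nat \<Rightarrow> bool" where
  "even_param p q \<longleftrightarrow> 0 < p \<and> p < q \<and> coprime p q \<and> even (p * q)"

definition omega :: "nat \<Rightarrow> nat \<Rightarrow> nat" where
  "omega p q = p + q"

definition bigP :: "nat \<Rightarrow> nat \<Rightarrow> real" where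
  "bigP p q = 2 * real p / real (omega p q)"

definition bigQ :: "nat \<Rightarrow> nat \<Rightarrow> real" where
  "bigQ p q = 2 * real q / real (omega p q)"

definition tune_alpha :: "nat \<Rightarrow> nat \<Rightarrow> int" where
  "tune_alpha p q = (THE a::int. 0 < a \<and> 2 * a < int (omega p q) \<and>
     ((2 * a * int p) mod int (omega p q) = 1 mod int (omega p q) \<or>
      (2 * a * int p) mod int (omega p q) = (-1) mod int (omega p q)))"

definition tune :: "nat \<Rightarrow> nat \<Rightarrow> real" where
  "tune p q = real_of_int (tune_alpha p q) / real (omega p q)"

section \<open>Reduction mod 2Z into (-1,1]\<close>

definition red2 :: "real \<Rightarrow> real" where
  "red2 t = t - 2 * real_of_int \<lceil>(t - 1) / 2\<rceil>"

definition F_H :: "nat \<Rightarrow> nat \<Rightarrow> real \<times> real \<Rightarrow> real" where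
  "F_H p q z = red2 (2 * bigP p q * snd z)"

definition F_V :: "nat \<Rightarrow> nat \<Rightarrow> real \<times> real \<Rightarrow> real" where
  "F_V p q z = red2 (2 * bigP p q * fst z)"

definition F_P :: "nat \<Rightarrow> nat \<Rightarrow> real \<times> real \<Rightarrow> real" where
  "F_P p q z = red2 (bigP p q * snd z + (bigP p q)\<^sup>2 * fst z + 1)"

definition F_Q :: "nat \<Rightarrow> nat \<Rightarrow> real \<times> real \<Rightarrow> real" where
  "F_Q p q z = red2 (bigP p q * snd z + bigP p q * bigQ p q * fst z + 1)"

definition on_slope_line :: "real \<Rightarrow> real \<times> real \<Rightarrow> bool" where
  "on_slope_line S z \<longleftrightarrow> snd z + S * fst z \<in> \<int>"

datatype useg = HSeg int int | VSeg int int

fun seg_pts :: "useg \<Rightarrow> (real \<times> real) set" where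
  "seg_pts (HSeg m n) = {(x, real_of_int n) | x. real_of_int m \<le> x \<and> x \<le> real_of_int m + 1}"
| "seg_pts (VSeg m n) = {(real_of_int m, y) | y. real_of_int n \<le> y \<and> y \<le> real_of_int n + 1}"

fun seg_mid :: "useg \<Rightarrow> real \<times> real" where
  "seg_mid (HSeg m n) = (real_of_int m + 1/2, real_of_int n)"
| "seg_mid (VSeg m n) = (real_of_int m, real_of_int n + 1/2)"

fun F_A :: "nat \<Rightarrow> nat \<Rightarrow> useg \<Rightarrow> real \<times> real \<Rightarrow> real" where
  "F_A p q (HSeg m n) z = F_H p q z"
| "F_A p q (VSeg m n) z = F_V p q z"

definition light_point :: "nat \<Rightarrow> nat \<Rightarrow> useg \<Rightarrow> real \<times> real \<Rightarrow> bool" where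
  "light_point p q s z \<longleftrightarrow> z \<in> seg_pts s \<and>
     ((on_slope_line (bigP p q) z \<and> F_A p q s z * F_P p q z > 0 \<and> \<bar>F_P p q z\<bar> < \<bar>F_A p q s z\<bar>) \<or>
      (on_slope_line (bigQ p q) z \<and> F_A p q s z * F_Q p q z > 0 \<and> \<bar>F_Q p q z\<bar> < \<bar>F_A p q s z\<bar>))"

fun is_horizontal :: "useg \<Rightarrow> bool" where
  "is_horizontal (HSeg m n) = True"
| "is_horizontal (VSeg m n) = False"

definition light_count :: "nat \<Rightarrow> nat \<Rightarrow> useg \<Rightarrow> nat" where
  "light_count p q s = card {z. light_point p q s z} +
     (if is_horizontal s \<and> light_point p q s (seg_mid s) then 1 else 0)"

definition good_seg :: "nat \<Rightarrow> nat \<Rightarrow> useg \<Rightarrow> bool" where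
  "good_seg p q s \<longleftrightarrow> light_count p q s = 1"

definition sq_center :: "int \<Rightarrow> int \<Rightarrow> real \<times> real" where
  "sq_center m n = (real_of_int m + 1/2, real_of_int n + 1/2)"

definition sq_edges :: "int \<Rightarrow> int \<Rightarrow> useg set" where
  "sq_edges m n = {HSeg m n, HSeg m (n + 1), VSeg m n, VSeg (m + 1) n}"

definition plaid_union :: "nat \<Rightarrow> nat \<Rightarrow> (real \<times> real) set" where
  "plaid_union p q = \<Union> {closed_segment (sq_center m n) (seg_mid e) | m n e.
      e \<in> sq_edges m n \<and> good_seg p q e}"

definition plaid_polygons :: "nat \<Rightarrow> nat \<Rightarrow> (real \<times> real) set set" where
  "plaid_polygons p q = {connected_component_set (plaid_union p q) z | z. z \<in> plaid_union p q}"

definition is_block :: "nat \<Rightarrow> nat \<Rightarrow> (real \<times> real) set \<Rightarrow> bool" where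
  "is_block p q B \<longleftrightarrow> (\<exists>a b :: int.
     B = {(x, y). real_of_int a * real (omega p q)^2 \<le> x \<and> x \<le> real_of_int a * real (omega p q)^2 + real (omega p q)
              \<and> real_of_int b * real (omega p q) \<le> y \<and> y \<le> real_of_int b * real (omega p q) + real (omega p q)})"

definition x_diameter :: "(real \<times> real) set \<Rightarrow> real" where
  "x_diameter S = diameter (fst ` S)"

end

theory Submission
  imports Defs
begin

text \<open>
  Write f(j) for (Pj+1)/2 rounded down. A slanting line with intercept j meets the grid line y = n
  (or x = n) in a light point iff f(j) + f(2n-j) + f(2n) is odd. Around a unit square these terms
  cancel modulo 2, so every square has an even number of good edges, and a polygon crosses each grid
  line of a block an even number of times.

  The grid line whose coordinate is r times the numerator of the tune has capacity 2r. At scale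
  omega its light points sit on multiples kt (mod 1) of the tune with |k| < r, so for bounded r they
  stay a definite fraction of omega apart unless a P-point and a Q-point coincide in the limit. As
  Q > P, the Q-points outnumber the P-points over every interval once r is large, so isolated light
  points are dense; a polygon through one crosses its line again far away, hence is large.

  For distinctness, cut the block by the lines of capacity at most 2R. There is one more cell than
  there are crossings and each crossing lies on two cells, so some cell has no crossing on its
  boundary and traps a polygon. Shrinking the cells gives polygons at arbitrarily many scales.
\<close>

section \<open>Multiples of an irrational number modulo one\<close>

text \<open>Coincidences of P-points with Q-points cannot be ruled out one by one: in the limit they
  are solutions of k't + i' = L(kt + i), and irrationality of t and L does not exclude such
  solutions. Only a count over a whole interval shows that some Q-point has no partner. This is why
  the index of the line must be large, with a bound that depends on the interval.

  All constants are fixed in the limit, where only t and L occur. On lines of bounded index the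
  competitors of a light point are finitely many pairs (k, i), so finitely many nonzero limits yield
  one separation constant, valid for all large omega and in every block.

  Isolated light points alone do not give distinct polygons, since one polygon may pass through many
  of them. A polygon trapped in a small cell has x-diameter below the threshold reached by the
  earlier ones, hence is new; and since large polygons are dense at every mesh, the trapped one
  still has x-diameter at least a fixed fraction of omega.\<close>

lemma dense_multiples:
  fixes t a b :: real and c K :: int
  assumes "t \<notin> \<rat>" "a < b"
  obtains k h :: int where "K \<le> k" "even (k - c)" "a < k * t + h" "k * t + h < b"
proof -
  \<comment> \<open>Kronecker is applied to 2t, so that k moves in steps of 2 and keeps the parity
    of c. The starting value c + 2|K - c| has this parity and is at least K.\<close>
  define s where "s = 2 * t"
  have s: "s \<notin> \<rat>"
  proof
    assume "s \<in> \<rat>"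
    then have "s / 2 \<in> \<rat>" by (intro Rats_divide) auto
    then show False using assms(1) by (simp add: s_def)
  qed
  define x where "x = (a + b) / 2 - (c + 2 * \<bar>K - c\<bar>) * t"
  define \<beta> where "\<beta> = frac x"
  obtain n :: nat where n: "\<bar>frac (real n * s) - \<beta>\<bar> < (b - a) / 2"
    using Kronecker_approx_1_explicit[OF s, of \<beta> "(b - a) / 2"] assms(2)
    by (auto simp: \<beta>_def frac_ge_0 less_imp_le frac_lt_1)
  define k where "k = 2 * int n + c + 2 * \<bar>K - c\<bar>"
  define h where "h = \<lfloor>x\<rfloor> - \<lfloor>real n * s\<rfloor>"
  have "k * t + h - (a + b) / 2 = frac (real n * s) - \<beta>"
    by (simp add: k_def h_def x_def \<beta>_def frac_def s_def algebra_simps)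
  then have "\<bar>k * t + h - (a + b) / 2\<bar> < (b - a) / 2" using n by simp
  then have "k * t + h - (a + b) / 2 < (b - a) / 2" "- (k * t + h - (a + b) / 2) < (b - a) / 2"
    by (simp_all only: abs_less_iff)
  then have "a < k * t + h" "k * t + h < b" by (simp_all add: field_simps)
  moreover have "K \<le> k" unfolding k_def by (cases "K \<le> c") simp_all
  moreover have "even (k - c)" by (simp add: k_def)
  ultimately show thesis using that by blast
qed

lemma irrational_combination_eq_iff:
  fixes t :: real and k k' i i' :: int
  assumes "t \<notin> \<rat>"
  shows "k * t + i = k' * t + i' \<longleftrightarrow> k = k' \<and> i = i'"
proof
  assume eq: "k * t + i = k' * t + i'"
  have "k = k'"
  proof (rule ccontr)
    assume "k \<noteq> k'"
    then have "t = (i' - i) / (k - k')" using eq by (simp add: field_simps)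
    then show False using assms by (metis Rats_divide Rats_of_int of_int_diff)
  qed
  then show "k = k' \<and> i = i'" using eq by simp
qed simp

lemma finite_lattice_strip:
  fixes t a b :: real and r :: int
  shows "finite {(k, i). \<bar>k\<bar> < r \<and> R k \<and> a < of_int k * t + of_int i \<and> of_int k * t + of_int i < b}"
proof (rule finite_subset)
  show "{(k, i). \<bar>k\<bar> < r \<and> R k \<and> a < of_int k * t + of_int i \<and> of_int k * t + of_int i < b}
     \<subseteq> (SIGMA k:{- r..r}. {\<lfloor>a - of_int k * t\<rfloor>..\<lceil>b - of_int k * t\<rceil>})"
    by (auto simp: floor_le_iff le_ceiling_iff)
qed auto

text \<open>Density yields a fresh hit beyond any index, and induction collects n of them. The
  parity class is fixed because light points on a line of index r belong to k with k + r
  odd.\<close>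

lemma many_hits:
  fixes t a b :: real and c :: int
  assumes "t \<notin> \<rat>" "a < b"
  shows "\<exists>r0. \<forall>r\<ge>r0. n \<le> card {(k, i). \<bar>k\<bar> < r \<and> even (k - c) \<and> a < of_int k * t + of_int i \<and> of_int k * t + of_int i < b}"
proof (induction n)
  case (Suc n)
  then obtain r0 where r0: "\<And>r. r0 \<le> r \<Longrightarrow> n \<le> card {(k, i). \<bar>k\<bar> < r \<and> even (k - c) \<and> a < of_int k * t + of_int i \<and> of_int k * t + of_int i < b}"
    by blast
  obtain k h :: int where k: "max 0 r0 \<le> k" "even (k - c)" "a < k * t + h" "k * t + h < b"
    using dense_multiples[OF assms] .
  let ?S = "\<lambda>r. {(k, i). \<bar>k\<bar> < r \<and> even (k - c) \<and> a < of_int k * t + of_int i \<and> of_int k * t + of_int i < b}"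
  have "Suc n \<le> card (?S r)" if "k + 1 \<le> r" for r
  proof -
    \<comment> \<open>The new pair is not in \<open>?S k\<close>, as the bound on the index is
      strict; so the count really grows.\<close>
    have "insert (k, h) (?S k) \<subseteq> ?S r" using k that by auto
    then have "card (insert (k, h) (?S k)) \<le> card (?S r)"
      using finite_lattice_strip by (rule card_mono[rotated])
    moreover have "card (insert (k, h) (?S k)) = Suc (card (?S k))"
      using finite_lattice_strip by (intro card_insert_disjoint) auto
    ultimately show ?thesis using r0[of k] k(1) by simp
  qed
  then show ?case by blast
qed simp

text \<open>Multiplication by L < 1 shrinks the interval from a to b. If it mapped the lattice points
  over this interval to lattice points, they could not be more numerous than those over the
  shrunken interval; but a translate of the latter interval by a lattice point leaves room for
  arbitrarily many more.\<close>

lemma unmatched_lattice_point: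
  fixes t L a b :: real
  assumes t: "t \<notin> \<rat>" and L: "0 < L" "L < 1" and ab: "a < b" "b - a \<le> 1"
  shows "\<exists>r0. \<forall>r\<ge>r0. \<exists>k i. \<bar>k\<bar> < r \<and> odd (k + r) \<and> a < of_int k * t + of_int i \<and> of_int k * t + of_int i < b \<and>
     (\<forall>k' i'. \<bar>k'\<bar> < r \<and> odd (k' + r) \<longrightarrow> of_int k' * t + of_int i' \<noteq> L * (of_int k * t + of_int i))"
proof -
  \<comment> \<open>The shrunken interval has length L (b - a), so inside (a, m) it has slack (1 -
    L)(b - a) / 2. The interval (m, b), of that same length, stays free for additional
    points.\<close>
  define m where "m = a + (b - a) * (1 + L) / 2"
  have "(b - a) * (1 + L) < (b - a) * 2" using ab L by (intro mult_strict_left_mono) auto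
  then have m: "m < b" by (simp add: m_def field_simps)
  have "0 < (b - a) * (1 + L) / 2" using ab L by simp
  then have am: "a < m" by (simp add: m_def)
  have "a - L * a < a - L * a + (b - a) * (1 - L) / 2" using ab L by simp
  \<comment> \<open>An even j keeps the parity of k + r, and j >= 0 means that translation can push
    an index out of range only at the upper end r.\<close>
  then obtain j c :: int where j: "0 \<le> j" "even (j - 0)" "a - L * a < j * t + c" "j * t + c < a - L * a + (b - a) * (1 - L) / 2"
    using dense_multiples[OF t, of "a - L * a" "a - L * a + (b - a) * (1 - L) / 2" 0 0] by auto
  have sh: "a < L * a + (j * t + c)" "L * b + (j * t + c) < m" using j by (simp_all add: m_def field_simps)
  define S where "S r lo hi = {(k, i). \<bar>k\<bar> < r \<and> odd (k + r) \<and> lo < of_int k * t + of_int i \<and> of_int k * t + of_int i < hi}" for r lo hi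
  have fin: "finite (S r lo hi)" for r lo hi unfolding S_def by (rule finite_lattice_strip)
  \<comment> \<open>j + 1 additional points outweigh the at most j points that the translation
    loses.\<close>
  have "\<exists>r0. \<forall>r\<ge>r0. nat j + 1 \<le> card (S r m b)"
  proof -
    obtain r1 r2 where r1: "\<And>r. r \<ge> r1 \<Longrightarrow> nat j + 1 \<le> card {(k, i). \<bar>k\<bar> < r \<and> even (k - 1) \<and> m < of_int k * t + of_int i \<and> of_int k * t + of_int i < b}"
      and r2: "\<And>r. r \<ge> r2 \<Longrightarrow> nat j + 1 \<le> card {(k, i). \<bar>k\<bar> < r \<and> even (k - 0) \<and> m < of_int k * t + of_int i \<and> of_int k * t + of_int i < b}"
      using many_hits[OF t m, of "nat j + 1" 1] many_hits[OF t m, of "nat j + 1" 0] by blast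
    have "nat j + 1 \<le> card (S r m b)" if "r \<ge> max r1 r2" for r
    proof (cases "even r")
      case True
      then have "S r m b = {(k, i). \<bar>k\<bar> < r \<and> even (k - 1) \<and> m < of_int k * t + of_int i \<and> of_int k * t + of_int i < b}"
        by (auto simp: S_def)
      then show ?thesis using r1[of r] that by simp
    next
      case False
      then have "S r m b = {(k, i). \<bar>k\<bar> < r \<and> even (k - 0) \<and> m < of_int k * t + of_int i \<and> of_int k * t + of_int i < b}"
        by (auto simp: S_def)
      then show ?thesis using r2[of r] that by simp
    qed
    then show ?thesis by blast
  qed
  then obtain r0 where r0: "\<And>r. r \<ge> r0 \<Longrightarrow> nat j + 1 \<le> card (S r m b)" by blast
  have "\<exists>k i. (k, i) \<in> S r a b \<and> (\<forall>k' i'. \<bar>k'\<bar> < r \<and> odd (k' + r) \<longrightarrow> of_int k' * t + of_int i' \<noteq> L * (of_int k * t + of_int i))"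
    if r: "r \<ge> r0" for r
  proof (rule ccontr)
    assume neg: "\<not> ?thesis"
    let ?v = "\<lambda>z. of_int (fst z) * t + of_int (snd z)"
    have "\<exists>z'. z' \<in> S r (L * a) (L * b) \<and> ?v z' = L * ?v z" if z: "z \<in> S r a b" for z
    proof -
      obtain k' i' where k': "\<bar>k'\<bar> < r" "odd (k' + r)" "of_int k' * t + of_int i' = L * ?v z"
        using neg z by (metis prod.collapse)
      have "a < ?v z" "?v z < b" using z by (auto simp: S_def)
      then have "L * a < L * ?v z" "L * ?v z < L * b" using L by simp_all
      then have "(k', i') \<in> S r (L * a) (L * b)" using k' by (simp add: S_def)
      then show ?thesis using k'(3) by (intro exI[of _ "(k', i')"]) simp
    qed
    then obtain \<phi> where \<phi>: "\<And>z. z \<in> S r a b \<Longrightarrow> \<phi> z \<in> S r (L * a) (L * b) \<and> ?v (\<phi> z) = L * ?v z" by metis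
    have "inj_on \<phi> (S r a b)"
    proof (rule inj_onI)
      fix y z assume "y \<in> S r a b" "z \<in> S r a b" "\<phi> y = \<phi> z"
      then have "L * ?v y = L * ?v z" using \<phi> by metis
      then have "?v y = ?v z" using L by simp
      then show "y = z" using irrational_combination_eq_iff[OF t] by (simp add: prod_eq_iff)
    qed
    then have le: "card (S r a b) \<le> card (S r (L * a) (L * b))" using \<phi> fin by (intro card_inj_on_le[of \<phi>]) auto
    define B0 where "B0 = {z \<in> S r (L * a) (L * b). fst z < r - j}"
    define sh where "sh z = (fst z + j, snd z + c)" for z :: "int \<times> int"
    have vsh: "?v (sh z) = ?v z + (j * t + c)" for z by (simp add: sh_def algebra_simps)
    have "sh ` B0 \<subseteq> S r a m"
    proof
      fix z assume "z \<in> sh ` B0"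
      then obtain y where y: "y \<in> B0" "z = sh y" by blast
      have "a < ?v z" "?v z < m" using y \<open>a < L * a + (j * t + c)\<close> \<open>L * b + (j * t + c) < m\<close>
        unfolding y(2) vsh by (auto simp: B0_def S_def)
      moreover have "\<bar>fst z\<bar> < r" "odd (fst z + r)" using y j(1,2) by (auto simp: B0_def S_def sh_def)
      ultimately show "z \<in> S r a m" by (auto simp: S_def)
    qed
    then have "card B0 \<le> card (S r a m)" using fin
      by (intro card_inj_on_le[of sh]) (auto simp: inj_on_def sh_def prod_eq_iff)
    moreover have "card (S r a m \<union> S r m b) = card (S r a m) + card (S r m b)"
      by (intro card_Un_disjoint fin) (auto simp: S_def)
    moreover have "card (S r a m \<union> S r m b) \<le> card (S r a b)"
      using am m by (intro card_mono fin) (auto simp: S_def)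
    moreover have "card (S r (L * a) (L * b)) \<le> card B0 + nat j"
    proof -
      \<comment> \<open>Over an open interval of length at most 1 the index k determines i, so each
        of the j endangered indices costs at most one point.\<close>
      have "card (S r (L * a) (L * b) - B0) \<le> card {r - j..<r}"
      proof (rule card_inj_on_le[of fst])
        show "inj_on fst (S r (L * a) (L * b) - B0)"
        proof (rule inj_onI)
          fix y z assume y: "y \<in> S r (L * a) (L * b) - B0" and z: "z \<in> S r (L * a) (L * b) - B0" and "fst y = fst z"
          have "L * b - L * a \<le> 1" using ab L mult_mono[of L 1 "b - a" 1] by (simp add: algebra_simps)
          moreover have "L * a < ?v y" "?v y < L * b" "L * a < ?v z" "?v z < L * b" using y z by (auto simp: S_def)
          ultimately have "\<bar>of_int (snd y) - of_int (snd z)\<bar> < (1 :: real)" using \<open>fst y = fst z\<close> by simp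
          then have "snd y = snd z" by linarith
          then show "y = z" using \<open>fst y = fst z\<close> by (simp add: prod_eq_iff)
        qed
      qed (auto simp: S_def B0_def)
      moreover have "card (S r (L * a) (L * b)) = card B0 + card (S r (L * a) (L * b) - B0)"
      proof -
        have sub: "B0 \<subseteq> S r (L * a) (L * b)" by (auto simp: B0_def)
        show ?thesis
          using card_Diff_subset[OF finite_subset[OF sub fin] sub] card_mono[OF fin sub] by simp
      qed
      ultimately show ?thesis by simp
    qed
    ultimately show False using le r0[OF r] by linarith
  qed
  then show ?thesis unfolding S_def by blast
qed

text \<open>Each |g x| eventually exceeds half the absolute value of its limit, and finiteness of I
  gives a common constant and threshold. All separation constants at scale omega come from
  here.\<close>

lemma finite_family_bounded_away:
  fixes g :: "'a \<Rightarrow> nat \<Rightarrow> real"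
  assumes "finite I" "\<And>x. x \<in> I \<Longrightarrow> g x \<longlonglongrightarrow> l x" "\<And>x. x \<in> I \<Longrightarrow> l x \<noteq> 0"
  shows "\<exists>\<delta>>0. \<forall>\<^sub>F n in sequentially. \<forall>x\<in>I. \<delta> \<le> \<bar>g x n\<bar>"
  using assms
proof (induction I rule: finite_induct)
  case empty
  show ?case by (intro exI[of _ 1]) simp
next
  case (insert x I)
  then obtain \<delta> where \<delta>: "\<delta> > 0" "\<forall>\<^sub>F n in sequentially. \<forall>x\<in>I. \<delta> \<le> \<bar>g x n\<bar>" by auto
  have "(\<lambda>n. \<bar>g x n\<bar>) \<longlonglongrightarrow> \<bar>l x\<bar>" using insert.prems(1) by (intro tendsto_rabs) simp
  moreover have "\<bar>l x\<bar> / 2 < \<bar>l x\<bar>" using insert.prems(2)[of x] by simp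
  ultimately have "\<forall>\<^sub>F n in sequentially. \<bar>l x\<bar> / 2 < \<bar>g x n\<bar>" by (rule order_tendstoD)
  with \<delta>(2) have "\<forall>\<^sub>F n in sequentially. \<forall>y\<in>insert x I. min \<delta> (\<bar>l x\<bar> / 2) \<le> \<bar>g y n\<bar>"
    by eventually_elim auto
  then show ?case using \<delta>(1) insert.prems(2)[of x] by (intro exI[of _ "min \<delta> (\<bar>l x\<bar> / 2)"]) simp
qed

section \<open>Plaid polygons as connected sets\<close>

text \<open>Green's theorem modulo 2: in the sum over all unit squares of the rectangle every
  interior edge is counted twice.\<close>

lemma even_boundary_sum:
  fixes h v :: "int \<Rightarrow> int \<Rightarrow> nat"
  assumes "\<And>m n. a \<le> m \<Longrightarrow> m < b \<Longrightarrow> c \<le> n \<Longrightarrow> n < d \<Longrightarrow> even (h m n + h m (n + 1) + v m n + v (m + 1) n)"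
    and "a \<le> b" "c \<le> d"
  shows "even ((\<Sum>m\<in>{a..<b}. h m c) + (\<Sum>m\<in>{a..<b}. h m d) + (\<Sum>n\<in>{c..<d}. v a n) + (\<Sum>n\<in>{c..<d}. v b n))"
proof -
  have row: "even ((\<Sum>m\<in>{a..<b}. h m n) + (\<Sum>m\<in>{a..<b}. h m (n + 1)) + v a n + v b n)"
    if "c \<le> n" "n < d" for n
    using \<open>a \<le> b\<close> assms(1)[OF _ _ that]
  proof (induction b rule: int_ge_induct)
    case (step i)
    have "{a..<i + 1} = insert i {a..<i}" using step.hyps by auto
    then have "(\<Sum>m\<in>{a..<i + 1}. g m) = g i + (\<Sum>m\<in>{a..<i}. g m)" for g :: "int \<Rightarrow> nat" by simp
    then show ?case using step.IH step.prems(1)[of i] step.prems(1) step.hyps by (auto simp: even_add)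
  qed simp
  show ?thesis using \<open>c \<le> d\<close> row
  proof (induction d rule: int_ge_induct)
    case (step i)
    have "{c..<i + 1} = insert i {c..<i}" using step.hyps by auto
    then have "(\<Sum>m\<in>{c..<i + 1}. g m) = g i + (\<Sum>m\<in>{c..<i}. g m)" for g :: "int \<Rightarrow> nat" by simp
    then show ?case using step.IH step.prems(1)[of i] step.prems(1) step.hyps by (auto simp: even_add)
  qed simp
qed

definition good_in_square :: "nat \<Rightarrow> nat \<Rightarrow> int \<Rightarrow> int \<Rightarrow> useg \<Rightarrow> bool" where
  "good_in_square p q m n e \<longleftrightarrow> e \<in> sq_edges m n \<and> good_seg p q e"

lemma plaid_union_iff:
  "z \<in> plaid_union p q \<longleftrightarrow> (\<exists>m n e. good_in_square p q m n e \<and> z \<in> closed_segment (sq_center m n) (seg_mid e))"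
  by (auto simp: plaid_union_def good_in_square_def)

lemma closed_segment_Pair_same:
  fixes x y c d :: real
  shows "closed_segment (c, x) (c, y) = {c} \<times> closed_segment x y"
    and "closed_segment (x, d) (y, d) = closed_segment x y \<times> {d}"
  using closed_segment_same_fst[of "(c, x)" "(c, y)"] closed_segment_same_snd[of "(x, d)" "(y, d)"] by simp_all

text \<open>The center of a square has half-integral coordinates, so a segment from it to an edge
  midpoint reaches an integer line only at its outer end. Hence polygons meet grid lines only in
  midpoints of good edges.\<close>

lemma half_segment:
  assumes "e \<in> sq_edges m n" "(x, y) \<in> closed_segment (sq_center m n) (seg_mid e)"
  shows "x = of_int c \<Longrightarrow> (x, y) = seg_mid e \<and> e = VSeg c n"
    and "y = of_int c \<Longrightarrow> (x, y) = seg_mid e \<and> e = HSeg m c"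
proof -
  have "(x = of_int c \<longrightarrow> (x, y) = seg_mid e \<and> e = VSeg c n) \<and>
     (y = of_int c \<longrightarrow> (x, y) = seg_mid e \<and> e = HSeg m c)"
  proof -
    have half: "of_int i + 1 / 2 \<noteq> (of_int c :: real)" for i
    proof
      assume "of_int i + 1 / 2 = (of_int c :: real)"
      then have "of_int (2 * i + 1) = (of_int (2 * c) :: real)" by simp
      then have "2 * i + 1 = 2 * c" by (simp only: of_int_eq_iff)
      then show False by presburger
    qed
    have lo: "t = c" if "of_int t \<le> (of_int c :: real)" "of_int c \<le> of_int t + (1 / 2 :: real)" for t
      using that by linarith
    have hi: "t + 1 = c" "of_int c = (of_int t + 1 :: real)" if "of_int t + 1 / 2 \<le> (of_int c :: real)" "of_int c \<le> of_int t + (1 :: real)" for t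
    proof -
      show "t + 1 = c" using that by linarith
      then show "of_int c = (of_int t + 1 :: real)" by auto
    qed
    consider "e = HSeg m n" | "e = HSeg m (n + 1)" | "e = VSeg m n" | "e = VSeg (m + 1) n"
      using assms(1) by (auto simp: sq_edges_def)
    then show ?thesis
    proof cases
      case 1
      with assms(2) show ?thesis using half[of m] lo[of n]
        by (auto simp: sq_center_def closed_segment_Pair_same closed_segment_eq_real_ivl)
    next
      case 2
      with assms(2) show ?thesis using half[of m] hi[of n]
        by (auto simp: sq_center_def closed_segment_Pair_same closed_segment_eq_real_ivl)
    next
      case 3
      with assms(2) show ?thesis using half[of n] lo[of m]
        by (auto simp: sq_center_def closed_segment_Pair_same closed_segment_eq_real_ivl)
    next
      case 4
      with assms(2) show ?thesis using half[of n] hi[of m]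
        by (auto simp: sq_center_def closed_segment_Pair_same closed_segment_eq_real_ivl)
    qed
  qed
  then show "x = of_int c \<Longrightarrow> (x, y) = seg_mid e \<and> e = VSeg c n"
    and "y = of_int c \<Longrightarrow> (x, y) = seg_mid e \<and> e = HSeg m c" by auto
qed

lemma plaid_union_on_line:
  assumes "(x, y) \<in> plaid_union p q"
  shows "x = of_int c \<Longrightarrow> \<exists>n. good_seg p q (VSeg c n) \<and> y = of_int n + 1 / 2"
    and "y = of_int c \<Longrightarrow> \<exists>m. good_seg p q (HSeg m c) \<and> x = of_int m + 1 / 2"
proof -
  obtain m n e where e: "e \<in> sq_edges m n" "good_seg p q e" "(x, y) \<in> closed_segment (sq_center m n) (seg_mid e)"
    using assms by (auto simp: plaid_union_iff good_in_square_def)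
  show "\<exists>n. good_seg p q (VSeg c n) \<and> y = of_int n + 1 / 2" if "x = of_int c"
    using half_segment(1)[OF e(1,3) that] e(2) by auto
  show "\<exists>m. good_seg p q (HSeg m c) \<and> x = of_int m + 1 / 2" if "y = of_int c"
    using half_segment(2)[OF e(1,3) that] e(2) by auto
qed

text \<open>S could meet the boundary of the rectangle only in midpoints of good edges, and the
  boundary has none.\<close>

lemma plaid_polygon_in_blank_rectangle:
  assumes S: "S \<in> plaid_polygons p q"
    and H: "\<And>m. a \<le> m \<Longrightarrow> m < b \<Longrightarrow> \<not> good_seg p q (HSeg m c) \<and> \<not> good_seg p q (HSeg m d)"
    and V: "\<And>n. c \<le> n \<Longrightarrow> n < d \<Longrightarrow> \<not> good_seg p q (VSeg a n) \<and> \<not> good_seg p q (VSeg b n)"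
    and z: "(x, y) \<in> S" "of_int a \<le> x" "x \<le> of_int b" "of_int c \<le> y" "y \<le> of_int d"
  shows "S \<subseteq> {of_int a<..<of_int b} \<times> {of_int c<..<of_int d}"
proof -
  let ?O = "{real_of_int a<..<of_int b} \<times> {real_of_int c<..<of_int d}"
  let ?C = "{real_of_int a..of_int b} \<times> {real_of_int c..of_int d}"
  have SU: "S \<subseteq> plaid_union p q" and conS: "connected S"
    using S connected_component_subset by (auto simp: plaid_polygons_def)
  have "(u, v) \<in> ?O" if "(u, v) \<in> S" "(u, v) \<in> ?C" for u v
  proof -
    have U: "(u, v) \<in> plaid_union p q" using that SU by auto
    have "u \<noteq> of_int i" if "i = a \<or> i = b" for i
    proof
      assume "u = of_int i"
      then obtain n where n: "good_seg p q (VSeg i n)" "v = of_int n + 1 / 2"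
        using plaid_union_on_line(1)[OF U] by blast
      then have "c \<le> n" "n < d" using \<open>(u, v) \<in> ?C\<close> by auto
      then show False using V n that by auto
    qed
    moreover have "v \<noteq> of_int i" if "i = c \<or> i = d" for i
    proof
      assume "v = of_int i"
      then obtain n where n: "good_seg p q (HSeg n i)" "u = of_int n + 1 / 2"
        using plaid_union_on_line(2)[OF U] by blast
      then have "a \<le> n" "n < b" using \<open>(u, v) \<in> ?C\<close> by auto
      then show False using H n that by auto
    qed
    ultimately show ?thesis using \<open>(u, v) \<in> ?C\<close> by (auto simp: order_less_le)
  qed
  \<comment> \<open>S is covered by two disjoint open sets, the open rectangle and the complement of
    the closed one; connectedness leaves only one of them.\<close>
  then have OC: "S \<subseteq> ?O \<union> - ?C" by auto
  have "open ?O" by (intro open_Times) auto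
  moreover have "open (- ?C)" by (intro open_Compl closed_Times) auto
  moreover have "?O \<inter> - ?C = {}" by auto
  ultimately have "?O \<inter> S = {} \<or> - ?C \<inter> S = {}"
    using conS OC unfolding connected_def by blast
  moreover have "(x, y) \<in> ?C" using z by auto
  ultimately show ?thesis using OC z(1) by blast
qed

lemma good_seg_in_polygon:
  assumes "good_seg p q e"
  obtains S where "S \<in> plaid_polygons p q" "seg_mid e \<in> S"
proof -
  obtain m n where "e \<in> sq_edges m n" by (cases e) (auto simp: sq_edges_def)
  then have "seg_mid e \<in> plaid_union p q"
    using assms by (auto simp: plaid_union_iff good_in_square_def)
  then have "connected_component_set (plaid_union p q) (seg_mid e) \<in> plaid_polygons p q"
    unfolding plaid_polygons_def by blast
  moreover have "seg_mid e \<in> connected_component_set (plaid_union p q) (seg_mid e)"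
    using \<open>seg_mid e \<in> plaid_union p q\<close> by (simp add: connected_component_refl)
  ultimately show ?thesis by (rule that)
qed

text \<open>Both half-segments end at the center. So a polygon contains either all midpoints of good
  edges of a square or none, which transfers the parity of good edges from the whole plaid union to
  a single polygon.\<close>

lemma polygon_square_connected:
  assumes S: "S \<in> plaid_polygons p q" and e: "good_in_square p q m n e" and e': "good_in_square p q m n e'"
    and "seg_mid e \<in> S"
  shows "seg_mid e' \<in> S"
proof -
  let ?T = "closed_segment (sq_center m n) (seg_mid e) \<union> closed_segment (sq_center m n) (seg_mid e')"
  have "connected ?T" by (intro connected_Un) auto
  moreover have "?T \<subseteq> plaid_union p q" using e e' unfolding subset_iff plaid_union_iff by blast
  moreover obtain z where z: "S = connected_component_set (plaid_union p q) z"
    using S by (auto simp: plaid_polygons_def)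
  ultimately have "connected_component (plaid_union p q) (seg_mid e) (seg_mid e')"
    unfolding connected_component_def by (intro exI[of _ ?T]) auto
  then show ?thesis using assms(4) z by (auto intro: connected_component_trans)
qed

lemma sum_consecutive_intervals:
  fixes X :: "nat \<Rightarrow> int" and g :: "int \<Rightarrow> nat"
  assumes "\<And>i. i < M \<Longrightarrow> X i \<le> X (Suc i)"
  shows "(\<Sum>i<M. \<Sum>m\<in>{X i..<X (Suc i)}. g m) = (\<Sum>m\<in>{X 0..<X M}. g m)"
  using assms
proof (induction M)
  case (Suc M)
  have "X 0 \<le> X i" if "i \<le> M" for i using that
  proof (induction i)
    case (Suc i)
    then show ?case using Suc.prems \<open>\<And>i. i < Suc M \<Longrightarrow> X i \<le> X (Suc i)\<close>[of i] by simp
  qed simp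
  then have "X 0 \<le> X M" "X M \<le> X (Suc M)" using Suc.prems[of M] by auto
  then have "{X 0..<X (Suc M)} = {X 0..<X M} \<union> {X M..<X (Suc M)}" by auto
  then have "(\<Sum>m\<in>{X 0..<X (Suc M)}. g m) = (\<Sum>m\<in>{X 0..<X M}. g m) + (\<Sum>m\<in>{X M..<X (Suc M)}. g m)"
    by (simp add: sum.union_disjoint)
  then show ?case using Suc.IH Suc.prems by simp
qed simp

lemma x_diameter_ge:
  assumes "bounded S" "z \<in> S" "z' \<in> S"
  shows "\<bar>fst z - fst z'\<bar> \<le> x_diameter S"
proof -
  have "bounded (fst ` S)" using assms(1) by (rule bounded_fst)
  then have "dist (fst z) (fst z') \<le> diameter (fst ` S)" using assms by (intro diameter_bounded_bound) auto
  then show ?thesis by (simp add: x_diameter_def dist_real_def)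
qed

lemma x_diameter_le:
  fixes a b :: real
  assumes "S \<subseteq> {a<..<b} \<times> T" "a \<le> b"
  shows "x_diameter S \<le> b - a"
  unfolding x_diameter_def
proof (rule diameter_le)
  fix x y assume "x \<in> fst ` S" "y \<in> fst ` S"
  then have "x \<in> {a<..<b}" "y \<in> {a<..<b}" using assms(1) by auto
  then show "norm (x - y) \<le> b - a" by auto
qed (use assms in auto)

section \<open>Light points\<close>

locale even_parameter =
  fixes p q :: nat
  assumes even_param: "even_param p q"
begin

abbreviation "P \<equiv> bigP p q"
abbreviation "Q \<equiv> bigQ p q"

definition w :: int where "w = int p + int q"

text \<open>The integer form of \<open>red2\<close>: the representative of a modulo 2w in (-w, w].
  Reducing w - a instead of a puts the closed end at w.\<close>

definition cent :: "int \<Rightarrow> int" where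
  "cent a = w - (w - a) mod (2 * w)"

text \<open>Up to the factor w, cent (4pn) is the capacity of the grid line with coordinate n and
  cent (2pj + w) is the common value of F_P or F_Q along a slanting line with intercept j. So lit n j
  says that this slanting line meets that grid line in a light point.\<close>

definition lit :: "int \<Rightarrow> int \<Rightarrow> bool" where
  "lit n j \<longleftrightarrow> cent (4 * int p * n) * cent (2 * int p * j + w) > 0 \<and>
     \<bar>cent (2 * int p * j + w)\<bar> < \<bar>cent (4 * int p * n)\<bar>"

text \<open>The rounding f(j) of (P j + 1) / 2, with the denominator w cleared.\<close>

definition pround :: "int \<Rightarrow> int" where
  "pround j = (2 * int p * j + w) div (2 * w)"

lemma p_pos: "0 < p" and p_less: "p < q" and coprime_pq: "coprime p q"
  using even_param by (auto simp: even_param_def)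

lemma w_pos: "w \<ge> 3" and two_p_less: "2 * int p < w" and q_eq: "int q = w - int p"
  using p_pos p_less by (auto simp: w_def)

text \<open>Coprimality and an even product force p and q to have opposite parity. Oddness of w
  excludes the ties below: masses are odd, capacities even.\<close>

lemma odd_w: "odd w"
proof -
  have "even p \<or> even q" using even_param by (auto simp: even_param_def)
  moreover have "\<not> (even p \<and> even q)"
    using coprime_pq coprime_common_divisor_nat[of p q 2] by auto
  ultimately show ?thesis by (auto simp: w_def)
qed

lemma coprime_p_w: "coprime (int p) w"
  using coprime_pq by (simp add: w_def coprime_iff_gcd_eq_1 flip: of_nat_add)

lemma coprime_2p_w: "coprime (2 * int p) w"
  using coprime_p_w odd_w by (simp add: coprime_mult_left_iff)

lemma dvd_2p_iff: "w dvd 2 * int p * a \<longleftrightarrow> w dvd a"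
  using coprime_2p_w by (simp add: coprime_dvd_mult_right_iff coprime_commute)

lemma real_omega: "real (omega p q) = real_of_int w"
  by (simp add: omega_def w_def)

lemma P_eq: "P = 2 * real p / w" and Q_eq: "Q = 2 * real q / w" 
  by (simp_all add: bigP_def bigQ_def real_omega)

lemma PQ: "Q = 2 - P"
  using w_pos by (simp add: P_eq Q_eq field_simps) (simp add: w_def)

lemma cent_eq: "cent a = a + 2 * w * ((w - a) div (2 * w))"
  using mult_div_mod_eq[of "2*w" "w-a"] unfolding cent_def by linarith

lemma cent_cong: "2 * w dvd a - cent a"
  by (simp add: cent_eq)

lemma cent_bounds: "- w < cent a" "cent a \<le> w"
  using pos_mod_bound[of "2*w" "w-a"] pos_mod_sign[of "2*w" "w-a"] w_pos
  by (auto simp: cent_def)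

lemma cent_eq_iff: "cent a = cent b \<longleftrightarrow> 2 * w dvd a - b"
  by (auto simp: cent_def mod_eq_dvd_iff dvd_diff_commute)

lemma cent_unique:
  assumes "2 * w dvd a - b" "- w < b" "b \<le> w"
  shows "cent a = b"
proof -
  have "cent a = cent b" using assms(1) by (simp add: cent_eq_iff)
  also have "\<dots> = b" using assms(2,3) by (simp add: cent_def)
  finally show ?thesis .
qed

lemma red2_cent: "red2 (real_of_int a / w) = cent a / w"
proof -
  have "\<lceil>(real_of_int a / w - 1) / 2\<rceil> = - ((w - a) div (2 * w))"
  proof -
    have "(real_of_int a / w - 1) / 2 = - (real_of_int (w - a) / real_of_int (2 * w))"
      using w_pos by (simp add: field_simps)
    then show ?thesis by (simp only: ceiling_minus floor_divide_of_int_eq)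
  qed
  then have "red2 (real_of_int a / w) = real_of_int a / w + 2 * real_of_int ((w - a) div (2 * w))"
    by (simp add: red2_def)
  also have "\<dots> = real_of_int (a + 2 * w * ((w - a) div (2 * w))) / w"
    using w_pos by (simp add: field_simps)
  also have "a + 2 * w * ((w - a) div (2 * w)) = cent a"
    by (simp add: cent_eq)
  finally show ?thesis .
qed

lemma lit_real:
  "lit n j \<longleftrightarrow> red2 (2 * P * n) * red2 (P * j + 1) > 0 \<and> \<bar>red2 (P * j + 1)\<bar> < \<bar>red2 (2 * P * n)\<bar>"
proof -
  have "2 * P * n = real_of_int (4 * int p * n) / w" by (simp add: P_eq)
  moreover have "P * j + 1 = real_of_int (2 * int p * j + w) / w"
    using w_pos by (simp add: P_eq field_simps)
  ultimately have eqs: "red2 (2 * P * n) = cent (4 * int p * n) / w"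
     "red2 (P * j + 1) = cent (2 * int p * j + w) / w"
    using red2_cent[of "4 * int p * n"] red2_cent[of "2 * int p * j + w"] by (simp_all only:)
  define c d where "c = cent (4 * int p * n)" and "d = cent (2 * int p * j + w)"
  have w0: "real_of_int w > 0" using w_pos by simp
  have "0 < real_of_int c / w * (d / w) \<longleftrightarrow> 0 < real_of_int (c * d)"
    using w0 by (simp add: zero_less_divide_iff)
  moreover have "\<bar>d / real_of_int w\<bar> < \<bar>c / real_of_int w\<bar> \<longleftrightarrow> real_of_int \<bar>d\<bar> < \<bar>c\<bar>"
    using w0 by (simp add: abs_divide divide_less_cancel)
  ultimately show ?thesis
    unfolding lit_def eqs c_def[symmetric] d_def[symmetric] by (simp only: of_int_less_iff of_int_0_less_iff)
qed

lemma light_H: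
  "light_point p q (HSeg m n) (x, y) \<longleftrightarrow> y = n \<and> m \<le> x \<and> x \<le> m + 1 \<and>
     ((\<exists>j. n + P * x = of_int j \<and> lit n j) \<or> (\<exists>j. n + Q * x = of_int j \<and> lit n j))"
proof (cases "y = n")
  case True
  have 1: "P * y + P\<^sup>2 * x + 1 = P * (n + P * x) + 1" 
     and 2: "P * y + P * Q * x + 1 = P * (n + Q * x) + 1"
    using True by (simp_all add: algebra_simps power2_eq_square)
  show ?thesis
    using True unfolding light_point_def F_P_def F_Q_def fst_conv snd_conv 1 2
    by (auto simp: F_H_def on_slope_line_def lit_real Ints_def)
qed (auto simp: light_point_def)

lemma light_V:
  "light_point p q (VSeg m n) (x, y) \<longleftrightarrow> x = m \<and> n \<le> y \<and> y \<le> n + 1 \<and>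
     ((\<exists>j. y + P * m = of_int j \<and> lit m j) \<or> (\<exists>j. y + Q * m = of_int j \<and> lit m j))"
proof (cases "x = m")
  case True
  have 1: "P * y + P\<^sup>2 * x + 1 = P * (y + P * m) + 1" 
     and 2: "P * y + P * Q * x + 1 = P * (y + Q * m) + 1"
    using True by (simp_all add: algebra_simps power2_eq_square)
  show ?thesis
    using True unfolding light_point_def F_P_def F_Q_def fst_conv snd_conv 1 2
    by (auto simp: F_V_def on_slope_line_def lit_real Ints_def)
qed (auto simp: light_point_def)

lemma lit_alt: "lit n j \<longleftrightarrow> (0 < cent (2 * int p * j + w) \<and> cent (2 * int p * j + w) < cent (4 * int p * n)) \<or>
   (cent (2 * int p * j + w) < 0 \<and> cent (4 * int p * n) < cent (2 * int p * j + w))"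
  unfolding lit_def by (auto simp: zero_less_mult_iff)

lemma small_div: "- m < x \<Longrightarrow> x < m \<Longrightarrow> x div m = - of_bool (x < 0)" for x m :: int
proof (cases "x < 0")
  case True
  assume "- m < x" "x < m"
  then have "(x + m) div m = 0" using True by (intro div_pos_pos_trivial) auto
  moreover have "(x + m) div m = x div m + 1" using True \<open>- m < x\<close> by (intro div_add_self2) auto
  ultimately have "x div m = - 1" by linarith
  then show ?thesis using True by simp
qed (simp add: div_pos_pos_trivial)

lemma even_cent_iff: "even (cent a) \<longleftrightarrow> even a"
  by (simp add: cent_eq)

text \<open>With capacity c and mass m reduced to (-w, w], each of the three roundings is an integer
  correction of the reduction up to the signs of m and c - m, and these two signs decide lightness.\<close>

lemma lit_parity: "even (of_bool (lit n j) + pround j + pround (2 * n - j) + pround (2 * n))"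
proof -
  define c where "c = cent (4 * int p * n)"
  define m where "m = cent (2 * int p * j + w)"
  define u where "u = - ((w - 4 * int p * n) div (2 * w))"
  define v where "v = - ((w - (2 * int p * j + w)) div (2 * w))"
  have c: "4 * int p * n = c + 2 * w * u" by (simp add: c_def u_def cent_eq)
  have m: "2 * int p * j + w = m + 2 * w * v" by (simp add: m_def v_def cent_eq)
  have cm: "even c" "odd m" using odd_w by (simp_all add: c_def m_def even_cent_iff)
  have bnd: "- w < c" "c \<le> w" "- w < m" "m \<le> w" using cent_bounds by (simp_all add: c_def m_def)
  \<comment> \<open>c is even and w is odd, so a capacity never attains the closed end w; this makes
    (c + w) div (2 w) vanish.\<close>
  have "c \<noteq> w" using cm odd_w by auto
  then have c2: "c < w" using bnd by simp
  have "pround j = v + m div (2 * w)"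
    using w_pos by (simp add: pround_def m)
  also have "m div (2 * w) = - of_bool (m < 0)"
    using bnd w_pos by (intro small_div) auto
  finally have 1: "pround j = v - of_bool (m < 0)" by simp
  have "2 * int p * (2 * n - j) + w = (c - m) + 2 * w * (1 + u - v)"
    using c m by (simp add: algebra_simps)
  then have "pround (2 * n - j) = (1 + u - v) + (c - m) div (2 * w)"
    using w_pos by (simp add: pround_def)
  also have "(c - m) div (2 * w) = - of_bool (c < m)"
    using bnd w_pos small_div[of "2 * w" "c - m"] by simp
  finally have 2: "pround (2 * n - j) = 1 + u - v - of_bool (c < m)" by simp
  have eq: "2 * int p * (2 * n) + w = (c + w) + 2 * w * u" using c by (simp add: algebra_simps)
  have "pround (2 * n) = u + (c + w) div (2 * w)"
    unfolding pround_def eq using w_pos by (subst div_mult_self2) auto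
  also have "(c + w) div (2 * w) = 0" using bnd c2 by (simp add: div_pos_pos_trivial)
  finally have 3: "pround (2 * n) = u" by simp
  have "m \<noteq> 0" "m \<noteq> c" using cm by auto
  \<comment> \<open>The three roundings add up to 1 + 2u - [m < 0] - [c < m], and these two
    indicators agree exactly when the point is light.\<close>
  then show ?thesis
    unfolding 1 2 3 lit_alt c_def[symmetric] m_def[symmetric] by (auto simp: of_bool_def)
qed

text \<open>2pj + w is odd, hence never a multiple of 2w: rounding to the nearest integer meets no
  tie and is an odd function.\<close>

lemma pround_minus: "pround (- j) = - pround j"
proof -
  have eq: "2 * int p * (- j) + w = - (2 * int p * j + w) + 2 * w * 1" by simp
  have "pround (- j) = 1 + (- (2 * int p * j + w)) div (2 * w)"
    unfolding pround_def eq using w_pos by (subst div_mult_self2) auto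
  moreover have nd: "\<not> 2 * w dvd 2 * int p * j + w"
  proof
    assume "2 * w dvd 2 * int p * j + w"
    then have "2 dvd 2 * int p * j + w" by (rule dvd_mult_left)
    then show False using odd_w by simp
  qed
  moreover have "2 * w \<noteq> 0" using w_pos by simp
  from zdiv_zminus1_eq_if[OF this, of "2 * int p * j + w"]
  have "- (2 * int p * j + w) div (2 * w) = - ((2 * int p * j + w) div (2 * w)) - 1"
    using nd by (simp only: mod_eq_0_iff_dvd if_False)
  ultimately show ?thesis unfolding pround_def by linarith
qed

text \<open>The parity formula is symmetric in j and 2n - j.\<close>

lemma lit_sym: "lit n (2 * n - j) = lit n j"
proof -
  have "2 * n - (2 * n - j) = j" by simp
  with lit_parity[of n j] lit_parity[of n "2 * n - j"] show ?thesis
    by (cases "lit n j"; cases "lit n (2 * n - j)") (simp_all only: of_bool_def if_True if_False even_add odd_one simp_thms even_zero, blast+)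
qed

lemma lit_cong:
  assumes "w dvd n - n'" "w dvd j - j'"
  shows "lit n j = lit n' j'"
proof -
  obtain a b where "n = n' + w * a" "j = j' + w * b"
    using assms by (metis dvd_def diff_add_cancel add.commute)
  then have "cent (4 * int p * n) = cent (4 * int p * n')" 
    "cent (2 * int p * j + w) = cent (2 * int p * j' + w)"
    by (auto simp: cent_eq_iff algebra_simps)
  then show ?thesis by (simp add: lit_def)
qed

text \<open>Such lines have capacity 0. The sides of all blocks lie on them, which is why no polygon
  leaves its block.\<close>

lemma lit_zero: assumes "w dvd n" shows "\<not> lit n j"
proof -
  have "cent (4 * int p * n) = cent 0" using assms by (auto simp: cent_eq_iff elim!: dvdE)
  also have "\<dots> = 0" using w_pos by (intro cent_unique) auto
  finally show ?thesis by (simp add: lit_def)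
qed

section \<open>Counting light points on a unit edge\<close>

lemma w_real_pos: "0 < real_of_int w" using w_pos by simp

lemma P_line_iff:
  "real_of_int n + P * x = real_of_int j \<longleftrightarrow> x = real_of_int (w * (j - n)) / (2 * real p)"
  using w_real_pos p_pos by (simp add: P_eq field_simps)

lemma Q_line_iff:
  "real_of_int n + Q * x = real_of_int j \<longleftrightarrow> x = real_of_int (w * (j - n)) / (2 * real q)"
  using w_real_pos p_pos p_less by (simp add: Q_eq field_simps)

text \<open>The index d is the intercept minus n. The inequalities place the abscissa
  \<open>d / P\<close> in (m, m + 1], and in \<open>SQ\<close> the abscissa \<open>d / Q\<close> in
  [m, m + 1).\<close>

definition SP :: "int \<Rightarrow> int \<Rightarrow> int set" where
  "SP m n = {d. 2 * int p * m < w * d \<and> w * d \<le> 2 * int p * (m + 1) \<and> lit n (n + d)}"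

definition SQ :: "int \<Rightarrow> int \<Rightarrow> int set" where
  "SQ m n = {d. 2 * int q * m \<le> w * d \<and> w * d < 2 * int q * (m + 1) \<and> lit n (n + d)}"

lemma pq_dvd:
  assumes "d * int q = d' * int p"
  obtains e where "d = int p * e" "d' = int q * e"
proof -
  have "int p dvd d * int q" using assms by simp
  then have "int p dvd d" using coprime_pq by (simp add: coprime_dvd_mult_left_iff)
  then obtain e where e: "d = int p * e" by (rule dvdE)
  then have "d' = int q * e" using assms p_pos by (simp add: mult.commute)
  with e that show ?thesis by blast
qed

text \<open>The P-line with d = pe and the Q-line with d = qe meet y = n in the same point x = we /
  2. As n - pe is congruent to n + qe modulo w = p + q, the reflection \<open>lit_sym\<close> makes
  both light there or neither.\<close>

lemma lit_pe_qe: "lit n (n + int p * e) = lit n (n + int q * e)"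
proof -
  have "lit n (n + int p * e) = lit n (2 * n - (n + int p * e))" by (simp only: lit_sym)
  also have "\<dots> = lit n (n + int q * e)"
  proof (rule lit_cong)
    have "2 * n - (n + int p * e) - (n + int q * e) = w * (- e)" by (simp add: w_def algebra_simps)
    then show "w dvd 2 * n - (n + int p * e) - (n + int q * e)" by (simp only: dvd_triv_left)
  qed simp
  finally show ?thesis .
qed

text \<open>The half-open windows in SP and SQ count a light point in a corner once, although both a
  P-line and a Q-line pass through it.\<close>

lemma light_set_H:
  assumes "0 \<le> m" "m < w"
  shows "{z. light_point p q (HSeg m n) z} =
    (\<lambda>d. (w * d / (2 * real p), real_of_int n)) ` SP m n \<union> (\<lambda>d. (w * d / (2 * real q), real_of_int n)) ` SQ m n"
  (is "?L = ?A \<union> ?B")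
proof -
  have xP: "of_int m \<le> real_of_int (w * d) / (2 * real p) \<longleftrightarrow> 2 * int p * m \<le> w * d"
     "real_of_int (w * d) / (2 * real p) \<le> of_int m + 1 \<longleftrightarrow> w * d \<le> 2 * int p * (m + 1)" for d
  proof -
    have "of_int m \<le> real_of_int (w * d) / (2 * real p) \<longleftrightarrow> real_of_int (2 * int p * m) \<le> real_of_int (w * d)"
      using p_pos by (simp add: field_simps)
    then show "of_int m \<le> real_of_int (w * d) / (2 * real p) \<longleftrightarrow> 2 * int p * m \<le> w * d"
      by (simp only: of_int_le_iff)
    have "real_of_int (w * d) / (2 * real p) \<le> of_int m + 1 \<longleftrightarrow> real_of_int (w * d) \<le> real_of_int (2 * int p * (m + 1))"
      using p_pos by (simp add: field_simps)
    then show "real_of_int (w * d) / (2 * real p) \<le> of_int m + 1 \<longleftrightarrow> w * d \<le> 2 * int p * (m + 1)"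
      by (simp only: of_int_le_iff)
  qed
  have xQ: "of_int m \<le> real_of_int (w * d) / (2 * real q) \<longleftrightarrow> 2 * int q * m \<le> w * d"
     "real_of_int (w * d) / (2 * real q) \<le> of_int m + 1 \<longleftrightarrow> w * d \<le> 2 * int q * (m + 1)" for d
  proof -
    have "of_int m \<le> real_of_int (w * d) / (2 * real q) \<longleftrightarrow> real_of_int (2 * int q * m) \<le> real_of_int (w * d)"
      using p_pos p_less by (simp add: field_simps)
    then show "of_int m \<le> real_of_int (w * d) / (2 * real q) \<longleftrightarrow> 2 * int q * m \<le> w * d"
      by (simp only: of_int_le_iff)
    have "real_of_int (w * d) / (2 * real q) \<le> of_int m + 1 \<longleftrightarrow> real_of_int (w * d) \<le> real_of_int (2 * int q * (m + 1))"
      using p_pos p_less by (simp add: field_simps)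
    then show "real_of_int (w * d) / (2 * real q) \<le> of_int m + 1 \<longleftrightarrow> w * d \<le> 2 * int q * (m + 1)"
      by (simp only: of_int_le_iff)
  qed
  have "?L = (\<lambda>d. (w * d / (2 * real p), real_of_int n)) ` {d. 2 * int p * m \<le> w * d \<and> w * d \<le> 2 * int p * (m + 1) \<and> lit n (n + d)}
     \<union> (\<lambda>d. (w * d / (2 * real q), real_of_int n)) ` {d. 2 * int q * m \<le> w * d \<and> w * d \<le> 2 * int q * (m + 1) \<and> lit n (n + d)}"
    (is "_ = ?A' \<union> ?B'")
  proof (rule set_eqI, clarify)
    fix x y :: real
    have shift: "(\<exists>j. R (j - n) \<and> lit n j) \<longleftrightarrow> (\<exists>d. R d \<and> lit n (n + d))" for R
    proof
      assume "\<exists>j. R (j - n) \<and> lit n j"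
      then obtain j where "R (j - n)" "lit n (n + (j - n))" by auto
      then show "\<exists>d. R d \<and> lit n (n + d)" by blast
    next
      assume "\<exists>d. R d \<and> lit n (n + d)"
      then obtain d where "R (n + d - n)" "lit n (n + d)" by auto
      then show "\<exists>j. R (j - n) \<and> lit n j" by blast
    qed
    have 1: "(\<exists>j. x = real_of_int (w * (j - n)) / (2 * real p) \<and> lit n j) \<longleftrightarrow> (\<exists>d. x = real_of_int (w * d) / (2 * real p) \<and> lit n (n + d))"
      by (rule shift[of "\<lambda>d. x = real_of_int (w * d) / (2 * real p)"])
    have 2: "(\<exists>j. x = real_of_int (w * (j - n)) / (2 * real q) \<and> lit n j) \<longleftrightarrow> (\<exists>d. x = real_of_int (w * d) / (2 * real q) \<and> lit n (n + d))"
      by (rule shift[of "\<lambda>d. x = real_of_int (w * d) / (2 * real q)"])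
    have 3: "(x, y) \<in> ?A' \<longleftrightarrow> y = of_int n \<and> of_int m \<le> x \<and> x \<le> of_int m + 1 \<and>
        (\<exists>d. x = real_of_int (w * d) / (2 * real p) \<and> lit n (n + d))"
      unfolding image_iff Bex_def mem_Collect_eq prod.inject xP[symmetric] by blast
    have 4: "(x, y) \<in> ?B' \<longleftrightarrow> y = of_int n \<and> of_int m \<le> x \<and> x \<le> of_int m + 1 \<and>
        (\<exists>d. x = real_of_int (w * d) / (2 * real q) \<and> lit n (n + d))"
      unfolding image_iff Bex_def mem_Collect_eq prod.inject xQ[symmetric] by blast
    show "(x, y) \<in> ?L \<longleftrightarrow> (x, y) \<in> ?A' \<union> ?B'"
      unfolding Un_iff 3 4 mem_Collect_eq light_H P_line_iff Q_line_iff 1 2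
        of_int_add of_int_1 by blast
  qed
  also have "\<dots> = ?A \<union> ?B"
  proof
    show "?A \<union> ?B \<subseteq> ?A' \<union> ?B'" unfolding SP_def SQ_def by fastforce
    \<comment> \<open>A P-line passes through a left end only for m = 0, where the Q-line with d = 0
      passes too. A Q-line passes through a right end only for m + 1 = w, where the P-line with d =
      2p passes too. So half-open windows lose no point.\<close>
    have end0: "m = 0 \<and> d = 0" if "w * d = 2 * int p * m" for d
    proof -
      have "w dvd 2 * int p * m" unfolding that[symmetric] by simp
      then have "w dvd m" by (simp only: dvd_2p_iff)
      then have "m = 0" using assms zdvd_not_zless[of m w] by fastforce
      then show ?thesis using that w_pos by simp
    qed
    have end1: "m + 1 = w \<and> d = 2 * int q" if "w * d = 2 * int q * (m + 1)" for d
    proof -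
      have "2 * int p * (m + 1) = w * (2 * (m + 1) - d)"
        using that by (simp add: w_def algebra_simps)
      then have "w dvd 2 * int p * (m + 1)" by simp
      then have "w dvd m + 1" by (simp only: dvd_2p_iff)
      then have "m + 1 = w" using assms zdvd_imp_le[of w "m + 1"] by simp
      then show ?thesis using that w_pos by simp
    qed
    show "?A' \<union> ?B' \<subseteq> ?A \<union> ?B"
    proof
      fix z assume "z \<in> ?A' \<union> ?B'"
      then show "z \<in> ?A \<union> ?B"
      proof
        assume "z \<in> ?A'"
        then obtain d where d: "z = (w * d / (2 * real p), real_of_int n)" "2 * int p * m \<le> w * d" "w * d \<le> 2 * int p * (m + 1)" "lit n (n + d)"
          by auto
        show ?thesis
        proof (cases "w * d = 2 * int p * m")
          case True
          then have "m = 0" "d = 0" using end0 by auto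
          then have "0 \<in> SQ m n" using d p_pos p_less by (simp add: SQ_def)
          then show ?thesis using d \<open>d = 0\<close> by force
        next
          case False
          then show ?thesis using d by (auto simp: SP_def)
        qed
      next
        assume "z \<in> ?B'"
        then obtain d where d: "z = (w * d / (2 * real q), real_of_int n)" "2 * int q * m \<le> w * d" "w * d \<le> 2 * int q * (m + 1)" "lit n (n + d)"
          by auto
        show ?thesis
        proof (cases "w * d = 2 * int q * (m + 1)")
          case True
          then have e: "m + 1 = w" "d = 2 * int q" using end1 by auto
          then have "lit n (n + 2 * int p)" using d lit_pe_qe[of n 2] by (simp add: algebra_simps)
          then have "2 * int p \<in> SP m n" using e p_pos w_pos by (auto simp: SP_def algebra_simps)
          moreover have "z = (w * (2 * int p) / (2 * real p), real_of_int n)"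
            using d e p_pos p_less by simp
          ultimately show ?thesis by blast
        next
          case False
          then show ?thesis using d by (auto simp: SQ_def)
        qed
      qed
    qed
  qed
  finally show ?thesis .
qed

text \<open>The integer part of P m. As P < 1 it grows by 0 or 1 per column, and Q = 2 - P expresses
  the Q-windows through it as well.\<close>

definition pfloor :: "int \<Rightarrow> int" where "pfloor m = 2 * int p * m div w"

lemma le_pfloor_iff: "d \<le> pfloor m \<longleftrightarrow> w * d \<le> 2 * int p * m"
proof -
  have 1: "2 * int p * m = w * pfloor m + (2 * int p * m) mod w" by (simp add: pfloor_def)
  have 2: "0 \<le> (2 * int p * m) mod w" "(2 * int p * m) mod w < w" using w_pos by auto
  show ?thesis
  proof
    assume "d \<le> pfloor m"
    then have "w * d \<le> w * pfloor m" using w_pos by simp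
    then show "w * d \<le> 2 * int p * m" using 1 2 by linarith
  next
    assume le: "w * d \<le> 2 * int p * m"
    show "d \<le> pfloor m"
    proof (rule ccontr)
      assume "\<not> d \<le> pfloor m"
      then have "w * (pfloor m + 1) \<le> w * d" using w_pos by simp
      then have "w * pfloor m + w \<le> w * d" by (simp add: distrib_left)
      then show False using 1 2 le by linarith
    qed
  qed
qed

lemma pfloor_less_iff: "pfloor m < d \<longleftrightarrow> 2 * int p * m < w * d"
  using le_pfloor_iff[of d m] by linarith

lemma pfloor_step: "pfloor (m + 1) = pfloor m \<or> pfloor (m + 1) = pfloor m + 1"
proof -
  have "pfloor m \<le> pfloor (m + 1)" using le_pfloor_iff[of "pfloor m" m] le_pfloor_iff[of "pfloor m" "m + 1"] by (simp add: algebra_simps)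
  moreover have "pfloor (m + 1) < pfloor m + 2"
    using pfloor_less_iff[of "m + 1" "pfloor m + 2"] pfloor_less_iff[of m "pfloor m + 1"] two_p_less by (simp add: algebra_simps)
  ultimately show ?thesis by linarith
qed

lemma SP_eq: "SP m n = {d \<in> {pfloor m + 1..pfloor (m + 1)}. lit n (n + d)}"
proof -
  have "pfloor m + 1 \<le> d \<longleftrightarrow> 2 * int p * m < w * d" for d using pfloor_less_iff[of m d] by linarith
  then show ?thesis by (auto simp: SP_def le_pfloor_iff)
qed

lemma SQ_eq: "SQ m n = {d \<in> {2 * m - pfloor m..2 * m + 1 - pfloor (m + 1)}. lit n (n + d)}"
proof -
  have "2 * m - pfloor m \<le> d \<longleftrightarrow> 2 * int q * m \<le> w * d" for d
    using le_pfloor_iff[of "2 * m - d" m] by (simp add: q_eq algebra_simps)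
  moreover have "d \<le> 2 * m + 1 - pfloor (m + 1) \<longleftrightarrow> w * d < 2 * int q * (m + 1)" for d
    using pfloor_less_iff[of "m + 1" "2 * m + 2 - d"] by (simp add: q_eq algebra_simps) linarith
  ultimately show ?thesis by (auto simp: SQ_def)
qed

lemma finite_SP: "finite (SP m n)" and finite_SQ: "finite (SQ m n)"
  by (simp_all only: SP_eq SQ_eq finite_Collect_conjI finite_atLeastAtMost_int Collect_mem_eq disj_imp simp_thms)

text \<open>With half-open windows a P-point and a Q-point of an edge coincide only at its midpoint,
  and a light midpoint is light for both families. Counting it twice therefore turns the number of
  points into a number of lines.\<close>

lemma light_count_H:
  assumes "0 \<le> m" "m < w"
  shows "light_count p q (HSeg m n) = card (SP m n) + card (SQ m n)"
proof -
  let ?A = "(\<lambda>d. (w * d / (2 * real p), real_of_int n)) ` SP m n"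
  let ?B = "(\<lambda>d. (w * d / (2 * real q), real_of_int n)) ` SQ m n"
  let ?M = "seg_mid (HSeg m n)"
  have cA: "card ?A = card (SP m n)" using p_pos w_pos by (intro card_image inj_onI) auto
  have cB: "card ?B = card (SQ m n)" using p_pos p_less w_pos by (intro card_image inj_onI) auto
  have sub: "?A \<inter> ?B \<subseteq> {?M}"
  proof
    fix z assume "z \<in> ?A \<inter> ?B"
    then obtain d d' where z: "z = (w * d / (2 * real p), real_of_int n)" "d \<in> SP m n"
       "w * d / (2 * real p) = w * d' / (2 * real q)" "d' \<in> SQ m n" by auto
    have "real_of_int (d * int q) = real_of_int (d' * int p)"
      using z(3) w_pos p_pos p_less by (simp add: field_simps)
    then have "d * int q = d' * int p" by (simp only: of_int_eq_iff)
    then obtain e where e: "d = int p * e" "d' = int q * e" by (rule pq_dvd)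
    \<comment> \<open>The common point is x = we / 2, and the open ends of the two windows leave
      only we = 2m + 1.\<close>
    have "int p * (2 * m) < int p * (w * e)" using z(2) e by (simp add: SP_def algebra_simps)
    then have lo: "2 * m + 1 \<le> w * e" using p_pos by simp
    have "int q * (w * e) < int q * (2 * (m + 1))" using z(4) e by (simp add: SQ_def algebra_simps)
    then have "w * e \<le> 2 * m + 1" using p_pos p_less by simp
    with lo have "w * e = 2 * m + 1" by (rule antisym[rotated])
    then have "real_of_int w * real_of_int e = 2 * real_of_int m + 1" by (metis of_int_mult of_int_add of_int_1 of_int_numeral)
    then have "w * d / (2 * real p) = m + 1/2" using p_pos by (simp add: e field_simps)
    then show "z \<in> {?M}" using z(1) by simp
  qed
  have "?M \<in> ?A \<inter> ?B" if "light_point p q (HSeg m n) ?M"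
  proof -
    have dv: "w dvd 2 * m + 1" if "real_of_int w * real_of_int d = real_of_int s * (2 * real_of_int m + 1)" "coprime s w" for d s
    proof -
      have "real_of_int (w * d) = real_of_int (s * (2 * m + 1))" using that(1) by simp
      then have "w * d = s * (2 * m + 1)" by (simp only: of_int_eq_iff)
      then have "w dvd s * (2 * m + 1)" by (metis dvd_triv_left)
      then show ?thesis using that(2) by (simp add: coprime_dvd_mult_right_iff coprime_commute)
    qed
    have "coprime (int q) (int q + int p)"
      using coprime_pq by (simp add: coprime_iff_gcd_eq_1 gcd.commute flip: of_nat_add)
    then have copq: "coprime (int q) w" by (simp add: w_def add.commute)
    have M: "(\<exists>j. real_of_int m + 1/2 = real_of_int (w * (j - n)) / (2 * real p) \<and> lit n j) \<or>
       (\<exists>j. real_of_int m + 1/2 = real_of_int (w * (j - n)) / (2 * real q) \<and> lit n j)"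
      using that unfolding seg_mid.simps light_H P_line_iff Q_line_iff by blast
    have "\<exists>e. w * e = 2 * m + 1 \<and> lit n (n + int p * e)"
      using M
    proof
      assume "\<exists>j. real_of_int m + 1/2 = real_of_int (w * (j - n)) / (2 * real p) \<and> lit n j"
      then obtain j where j: "real_of_int m + 1/2 = real_of_int (w * (j - n)) / (2 * real p)" "lit n j" by blast
      then have eq: "real_of_int w * real_of_int (j - n) = real_of_int (int p) * (2 * real_of_int m + 1)"
        using p_pos by (simp add: field_simps)
      then have "w dvd 2 * m + 1" using dv coprime_p_w by blast
      then obtain e where e: "2 * m + 1 = w * e" by (rule dvdE)
      then have "2 * real_of_int m + 1 = w * e" by (metis of_int_mult of_int_add of_int_1 of_int_numeral)
      then have "real_of_int (j - n) = real_of_int (int p * e)" using eq w_pos by simp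
      then have "j = n + int p * e" by linarith
      then show ?thesis using e j(2) by auto
    next
      assume "\<exists>j. real_of_int m + 1/2 = real_of_int (w * (j - n)) / (2 * real q) \<and> lit n j"
      then obtain j where j: "real_of_int m + 1/2 = real_of_int (w * (j - n)) / (2 * real q)" "lit n j" by blast
      then have eq: "real_of_int w * real_of_int (j - n) = real_of_int (int q) * (2 * real_of_int m + 1)"
        using p_pos p_less by (simp add: field_simps)
      then have "w dvd 2 * m + 1" using dv copq by blast
      then obtain e where e: "2 * m + 1 = w * e" by (rule dvdE)
      then have "2 * real_of_int m + 1 = w * e" by (metis of_int_mult of_int_add of_int_1 of_int_numeral)
      then have "real_of_int (j - n) = real_of_int (int q * e)" using eq w_pos by simp
      then have "j = n + int q * e" by linarith
      then show ?thesis using e j(2) lit_pe_qe by auto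
    qed
    then obtain e where e: "w * e = 2 * m + 1" "lit n (n + int p * e)" by blast
    have er: "real_of_int w * real_of_int e = 2 * real_of_int m + 1" using e(1) by (metis of_int_mult of_int_add of_int_1 of_int_numeral)
    have "w * (int p * e) = int p * (2 * m + 1)" "w * (int q * e) = int q * (2 * m + 1)"
      using e(1) by (simp_all add: mult.left_commute)
    then have "int p * e \<in> SP m n" "int q * e \<in> SQ m n" using p_pos p_less e(2) lit_pe_qe[of n e]
      by (auto simp: SP_def SQ_def algebra_simps)
    moreover have "?M = (real_of_int (w * (int p * e)) / (2 * real p), real_of_int n)"
       "?M = (real_of_int (w * (int q * e)) / (2 * real q), real_of_int n)"
      using er p_pos p_less by (simp_all add: field_simps)
    ultimately show ?thesis by (intro IntI image_eqI)
  qed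
  moreover have "light_point p q (HSeg m n) ?M" if "?M \<in> ?A"
    using that light_set_H[OF assms, of n] by (metis (mono_tags, lifting) UnI1 mem_Collect_eq)
  ultimately have "card (?A \<inter> ?B) = (if light_point p q (HSeg m n) ?M then 1 else 0)"
    using sub by (auto simp: subset_singleton_iff)
  then show ?thesis
    using card_Un_Int[of ?A ?B] finite_SP finite_SQ cA cB
    by (simp add: light_count_def light_set_H[OF assms] del: seg_mid.simps)
qed

text \<open>Unless w divides m, the edge meets one P-line and one Q-line, at heights n + 1 - th and
  n + th with th the fractional part of P m. These differ, since th = 1/2 would make the even number
  4pm an odd multiple of the odd w.\<close>

lemma light_count_V:
  shows "light_count p q (VSeg m n) = of_bool (lit m (n + pfloor m + 1)) + of_bool (lit m (n + 2 * m - pfloor m))"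
proof (cases "w dvd m")
  case True
  then have "\<not> light_point p q (VSeg m n) z" for z using lit_zero by (cases z) (auto simp: light_V)
  then have empty: "{z. light_point p q (VSeg m n) z} = {}" by blast
  show ?thesis unfolding light_count_def empty using True by (simp add: lit_zero)
next
  case False
  have nd: "w * d \<noteq> 2 * int p * m" for d
    using False dvd_2p_iff[of m] by (metis dvd_triv_left)
  define th where "th = P * m - pfloor m"
  have le: "pfloor m \<le> P * m \<longleftrightarrow> real_of_int (w * pfloor m) \<le> real_of_int (2 * int p * m)"
    using w_pos by (simp add: P_eq field_simps)
  have neq: "pfloor m = P * m \<longleftrightarrow> real_of_int (w * pfloor m) = real_of_int (2 * int p * m)"
    using w_pos by (simp add: P_eq field_simps)
  have ge: "pfloor m + 1 \<le> P * m \<longleftrightarrow> real_of_int (w * (pfloor m + 1)) \<le> real_of_int (2 * int p * m)"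
    using w_pos by (simp add: P_eq field_simps)
  have th: "0 < th" "th < 1"
    using le neq ge nd[of "pfloor m"] le_pfloor_iff[of "pfloor m" m] le_pfloor_iff[of "pfloor m + 1" m]
    unfolding of_int_le_iff of_int_eq_iff th_def by auto
  have neq2: "2 * th \<noteq> 1"
  proof
    assume "2 * th = 1"
    then have "real_of_int (4 * int p * m) = real_of_int (w * (2 * pfloor m + 1))"
      using w_pos by (simp add: th_def P_eq field_simps)
    then have "4 * int p * m = w * (2 * pfloor m + 1)" by (simp only: of_int_eq_iff)
    moreover have "odd (w * (2 * pfloor m + 1))" using odd_w by simp
    ultimately show False by (metis even_mult_iff even_numeral)
  qed
  let ?z1 = "(real_of_int m, n + 1 - th)" and ?z2 = "(real_of_int m, n + th)"
  have Qm: "Q * m = 2 * m - P * m" by (simp add: PQ algebra_simps)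
  have j1: "(n \<le> y \<and> y \<le> n + 1 \<and> (\<exists>j. y + P * m = of_int j \<and> lit m j)) \<longleftrightarrow> y = n + 1 - th \<and> lit m (n + pfloor m + 1)" for y :: real
  proof
    assume L: "n \<le> y \<and> y \<le> n + 1 \<and> (\<exists>j. y + P * m = of_int j \<and> lit m j)"
    then obtain j where j: "y + P * m = of_int j" "lit m j" by blast
    then have "j - n - pfloor m = y - n + th" by (simp add: th_def)
    then have "0 < j - n - pfloor m" "j - n - pfloor m < 2" using L th by linarith+
    then have "j = n + pfloor m + 1" by linarith
    then show "y = n + 1 - th \<and> lit m (n + pfloor m + 1)" using j by (simp add: th_def)
  next
    assume "y = n + 1 - th \<and> lit m (n + pfloor m + 1)"
    moreover from this have "y + P * m = of_int (n + pfloor m + 1)" by (simp add: th_def)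
    ultimately show "n \<le> y \<and> y \<le> n + 1 \<and> (\<exists>j. y + P * m = of_int j \<and> lit m j)" using th by (intro conjI exI[of _ "n + pfloor m + 1"]) auto
  qed
  have j2: "(n \<le> y \<and> y \<le> n + 1 \<and> (\<exists>j. y + Q * m = of_int j \<and> lit m j)) \<longleftrightarrow> y = n + th \<and> lit m (n + 2 * m - pfloor m)" for y :: real
  proof
    assume L: "n \<le> y \<and> y \<le> n + 1 \<and> (\<exists>j. y + Q * m = of_int j \<and> lit m j)"
    then obtain j where j: "y + Q * m = of_int j" "lit m j" by blast
    then have "j - n - 2 * m + pfloor m = y - n - th" by (simp add: th_def Qm)
    then have "-1 < j - n - 2 * m + pfloor m" "j - n - 2 * m + pfloor m < 1" using L th by linarith+
    then have "j = n + 2 * m - pfloor m" by linarith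
    then show "y = n + th \<and> lit m (n + 2 * m - pfloor m)" using j by (simp add: th_def Qm)
  next
    assume "y = n + th \<and> lit m (n + 2 * m - pfloor m)"
    moreover from this have "y + Q * m = of_int (n + 2 * m - pfloor m)" by (simp add: th_def Qm)
    ultimately show "n \<le> y \<and> y \<le> n + 1 \<and> (\<exists>j. y + Q * m = of_int j \<and> lit m j)" using th by (intro conjI exI[of _ "n + 2 * m - pfloor m"]) auto
  qed
  have "{z. light_point p q (VSeg m n) z} =
    (if lit m (n + pfloor m + 1) then {?z1} else {}) \<union> (if lit m (n + 2 * m - pfloor m) then {?z2} else {})"
  proof (rule set_eqI, clarify)
    fix x y :: real
    show "(x, y) \<in> {z. light_point p q (VSeg m n) z} \<longleftrightarrow> (x, y) \<in> (if lit m (n + pfloor m + 1) then {?z1} else {}) \<union> (if lit m (n + 2 * m - pfloor m) then {?z2} else {})"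
      unfolding mem_Collect_eq light_V using j1[of y] j2[of y] by (auto simp del: of_int_add)
  qed
  moreover have "?z1 \<noteq> ?z2" using neq2 by auto
  ultimately show ?thesis by (simp add: light_count_def)
qed

section \<open>Good edges\<close>

abbreviation good :: "useg \<Rightarrow> bool" where "good \<equiv> good_seg p q"

lemma card_filter_interval:
  "(b::int) = c \<Longrightarrow> card {d \<in> {b..c}. R d} = of_bool (R b)"
  "c = b + 1 \<Longrightarrow> card {d \<in> {b..c}. R d} = of_bool (R b) + of_bool (R c)"
  "c < b \<Longrightarrow> card {d \<in> {b..c}. R d} = 0"
proof -
  show "card {d \<in> {b..c}. R d} = of_bool (R b)" if "b = c"
  proof -
    have "{d \<in> {b..c}. R d} = (if R b then {b} else {})" using that by auto
    then show ?thesis by simp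
  qed
  show "card {d \<in> {b..c}. R d} = of_bool (R b) + of_bool (R c)" if "c = b + 1"
  proof -
    have "{b..c} = {b, c}" using that by auto
    then have "{d \<in> {b..c}. R d} = (if R b then {b} else {}) \<union> (if R c then {c} else {})" by auto
    then show ?thesis using that by simp
  qed
  show "card {d \<in> {b..c}. R d} = 0" if "c < b" using that by simp
qed

lemma finite_interval: "finite {j \<in> {b..<c::int}. R j}"
  by (rule finite_subset[of _ "{b..<c}"]) auto

text \<open>If the integer part of P m does not jump, the windows contain two Q-lines, otherwise one
  line of each family. With exactly two candidates per edge, good means odd light count.\<close>

lemma light_count_H_cases:
  assumes "0 \<le> m" "m < w"
  shows "pfloor (m + 1) = pfloor m \<Longrightarrow> light_count p q (HSeg m n) =
      of_bool (lit n (n + 2 * m - pfloor m)) + of_bool (lit n (n + 2 * m - pfloor m + 1))"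
    and "pfloor (m + 1) = pfloor m + 1 \<Longrightarrow> light_count p q (HSeg m n) =
      of_bool (lit n (n + pfloor m + 1)) + of_bool (lit n (n + 2 * m - pfloor m))"
proof -
  show "light_count p q (HSeg m n) = of_bool (lit n (n + 2 * m - pfloor m)) + of_bool (lit n (n + 2 * m - pfloor m + 1))"
    if "pfloor (m + 1) = pfloor m"
  proof -
    have "card (SQ m n) = of_bool (lit n (n + (2 * m - pfloor m))) + of_bool (lit n (n + (2 * m + 1 - pfloor (m + 1))))"
      unfolding SQ_eq by (rule card_filter_interval(2)) (simp add: that)
    moreover have "card (SP m n) = 0"
      unfolding SP_eq by (rule card_filter_interval(3)) (simp add: that)
    ultimately show ?thesis unfolding light_count_H[OF assms] that by (simp add: algebra_simps)
  qed
  show "light_count p q (HSeg m n) = of_bool (lit n (n + pfloor m + 1)) + of_bool (lit n (n + 2 * m - pfloor m))"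
    if "pfloor (m + 1) = pfloor m + 1"
  proof -
    have "card (SQ m n) = of_bool (lit n (n + (2 * m - pfloor m)))"
      unfolding SQ_eq by (rule card_filter_interval(1)) (simp add: that)
    moreover have "card (SP m n) = of_bool (lit n (n + (pfloor m + 1)))"
      unfolding SP_eq by (rule card_filter_interval(1)) (simp add: that)
    ultimately show ?thesis unfolding light_count_H[OF assms] by (simp add: algebra_simps)
  qed
qed

lemma light_count_le_2:
  "0 \<le> m \<Longrightarrow> m < w \<Longrightarrow> light_count p q (HSeg m n) \<le> 2"
  "light_count p q (VSeg m n) \<le> 2"
  using light_count_H_cases[of m n] pfloor_step[of m] by (auto simp: light_count_V of_bool_def)

lemma lit_parity': "even (of_bool (lit n j)) = even (pround j + pround (2 * n - j) + pround (2 * n))"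
  using lit_parity[of n j] by auto

text \<open>By the parity formula the eight candidate lines give eight triples of roundings. The
  term with 2n (or 2m) occurs twice for each edge, and the sixteen other arguments agree in pairs,
  some only up to sign, where \<open>pround_minus\<close> helps.\<close>

lemma light_count_square_even:
  assumes "0 \<le> m" "m < w"
  shows "even (light_count p q (HSeg m n) + light_count p q (HSeg m (n + 1)) +
    light_count p q (VSeg m n) + light_count p q (VSeg (m + 1) n))"
proof -
  have fm: "even (pround i) = even (pround j)" if "i = - j" for i j using that by (simp add: pround_minus)
  have ob: "even (of_bool b :: nat) \<longleftrightarrow> even (of_bool b :: int)" for b by simp
  from pfloor_step[of m] show ?thesis
  proof
    assume e: "pfloor (m + 1) = pfloor m"
    have n1: "even (pround (2 * m - (n + pfloor m + 1))) = even (pround (n + 1 - 2 * m + pfloor m))"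
      by (rule fm) simp
    have n2: "even (pround (2 * m + 1 - n - pfloor m)) = even (pround (n - 2 * m + pfloor m - 1))"
      by (rule fm) simp
    show ?thesis
      unfolding light_count_H_cases(1)[OF assms e] light_count_V e even_add ob lit_parity'
      using n1 n2 by (simp add: algebra_simps) argo
  next
    assume e: "pfloor (m + 1) = pfloor m + 1"
    have n1: "even (pround (2 * m - (n + pfloor m + 1))) = even (pround (n + 1 - 2 * m + pfloor m))"
      by (rule fm) simp
    have n2: "even (pround (2 * m - n - pfloor m)) = even (pround (n - 2 * m + pfloor m))"
      by (rule fm) simp
    have n3: "even (pround (n - pfloor m)) = even (pround (pfloor m - n))"
      by (rule fm) simp
    have n4: "even (pround (n - pfloor m - 1)) = even (pround (pfloor m + 1 - n))"
      by (rule fm) simp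
    show ?thesis
      unfolding light_count_H_cases(2)[OF assms e] light_count_V e even_add ob lit_parity'
      using n1 n2 n3 n4 by (simp add: algebra_simps) argo
  qed
qed

lemma good_square_even:
  assumes "0 \<le> m" "m < w"
  shows "even (of_bool (good (HSeg m n)) + of_bool (good (HSeg m (n + 1))) +
    of_bool (good (VSeg m n)) + of_bool (good (VSeg (m + 1) n)) :: nat)"
proof -
  have *: "even (of_bool (good s) :: nat) = even (light_count p q s)" if "light_count p q s \<le> 2" for s
    using that by (auto simp: good_seg_def of_bool_def le_Suc_eq numeral_2_eq_2)
  show ?thesis
    using light_count_square_even[OF assms, of n]
    unfolding even_add *[OF light_count_le_2(1)[OF assms]] *[OF light_count_le_2(2)] .
qed

section \<open>Number of good edges on a line of given capacity\<close>

lemma card_lit_window: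
  assumes "\<bar>cent (4 * int p * n)\<bar> = 2 * int r"
  shows "card {j \<in> {b..<b + w}. lit n j} \<le> r"
proof -
  define s where "s = sgn (cent (4 * int p * n))"
  \<comment> \<open>A light mass is odd, has the sign of the capacity and absolute value below 2r,
    so \<open>g\<close> takes at most r values on light lines; and the mass determines j modulo
    w.\<close>
  define g where "g j = nat ((\<bar>cent (2 * int p * j + w)\<bar> - 1) div 2)" for j
  have od: "odd (cent (2 * int p * j + w))" for j using odd_w by (simp add: even_cent_iff)
  have "inj_on g {j \<in> {b..<b + w}. lit n j}"
  proof (rule inj_onI)
    fix i j assume i: "i \<in> {j \<in> {b..<b + w}. lit n j}" and j: "j \<in> {j \<in> {b..<b + w}. lit n j}" and "g i = g j"
    then have gg: "nat ((\<bar>cent (2 * int p * i + w)\<bar> - 1) div 2) = nat ((\<bar>cent (2 * int p * j + w)\<bar> - 1) div 2)" by (simp add: g_def)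
    have "cent (2 * int p * i + w) \<noteq> 0" "cent (2 * int p * j + w) \<noteq> 0"
      using od[of i] od[of j] by (metis even_zero)+
    then have pos: "\<bar>cent (2 * int p * i + w)\<bar> \<ge> 1" "\<bar>cent (2 * int p * j + w)\<bar> \<ge> 1" by linarith+
    have "\<bar>cent (2 * int p * i + w)\<bar> = \<bar>cent (2 * int p * j + w)\<bar>"
      using gg pos od[of i] od[of j] by (auto elim!: oddE simp: abs_if split: if_splits)
    then have "cent (2 * int p * i + w) = cent (2 * int p * j + w)"
      using i j by (auto simp: lit_alt)
    then have "2 * w dvd (2 * int p * i + w) - (2 * int p * j + w)" by (simp only: cent_eq_iff)
    then have "w dvd 2 * int p * (i - j)" by (metis add_diff_cancel_right dvd_mult_right right_diff_distrib)
    then have "w dvd i - j" by (simp only: dvd_2p_iff)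
    then have "w dvd \<bar>i - j\<bar>" by simp
    moreover have "\<bar>i - j\<bar> < w" using i j by auto
    ultimately show "i = j" using zdvd_not_zless[of "\<bar>i - j\<bar>" w] by fastforce
  qed
  moreover have "g ` {j \<in> {b..<b + w}. lit n j} \<subseteq> {..<r}"
  proof (rule image_subsetI)
    fix j assume "j \<in> {j \<in> {b..<b + w}. lit n j}"
    then have "lit n j" by simp
    then have "\<bar>cent (2 * int p * j + w)\<bar> < 2 * int r" using assms by (simp add: lit_def)
    then show "g j \<in> {..<r}" using od[of j] by (auto simp: g_def)
  qed
  ultimately show ?thesis using card_inj_on_le[of g _ "{..<r}"] by simp
qed

lemma good_count_le_light: "of_bool (good s) \<le> light_count p q s"
  by (simp add: good_seg_def of_bool_def)

text \<open>P-points have intercepts n + 1 to n + 2p. Q-points are reflected by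
  \<open>lit_sym\<close> to intercepts n + 1 - 2q to n. The two ranges are adjacent and have total
  length 2w, two windows with at most r light lines each.\<close>

lemma good_count_H:
  assumes "\<bar>cent (4 * int p * n)\<bar> = 2 * int r"
  shows "(\<Sum>m\<in>{0..<w}. of_bool (good (HSeg m n))) \<le> 2 * r"
proof -
  have "(\<Sum>m\<in>{0..<w}. of_bool (good (HSeg m n))) \<le> (\<Sum>m\<in>{0..<w}. card (SP m n) + card (SQ m n))"
    using good_count_le_light by (intro sum_mono) (simp add: light_count_H[symmetric])
  also have "\<dots> = card (\<Union>m\<in>{0..<w}. SP m n) + card (\<Union>m\<in>{0..<w}. SQ m n)"
  proof -
    have "card (\<Union>m\<in>{0..<w}. SP m n) = (\<Sum>m\<in>{0..<w}. card (SP m n))"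
    proof (intro card_UN_disjoint ballI impI)
      fix i j :: int assume "i \<noteq> j"
      have "i = j" if "d \<in> SP i n" "d \<in> SP j n" for d
      proof -
        have "2 * int p * i < 2 * int p * (j + 1)" "2 * int p * j < 2 * int p * (i + 1)"
          using that unfolding SP_def by auto
        then show ?thesis using p_pos by simp
      qed
      then show "SP i n \<inter> SP j n = {}" using \<open>i \<noteq> j\<close> by auto
    qed (simp_all add: finite_SP)
    moreover have "card (\<Union>m\<in>{0..<w}. SQ m n) = (\<Sum>m\<in>{0..<w}. card (SQ m n))"
    proof (intro card_UN_disjoint ballI impI)
      fix i j :: int assume "i \<noteq> j"
      have "i = j" if "d \<in> SQ i n" "d \<in> SQ j n" for d
      proof -
        have "2 * int q * i < 2 * int q * (j + 1)" "2 * int q * j < 2 * int q * (i + 1)"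
          using that unfolding SQ_def by auto
        then show ?thesis using p_pos p_less by simp
      qed
      then show "SQ i n \<inter> SQ j n = {}" using \<open>i \<noteq> j\<close> by auto
    qed (simp_all add: finite_SQ)
    ultimately show ?thesis by (simp add: sum.distrib)
  qed
  also have "card (\<Union>m\<in>{0..<w}. SP m n) \<le> card {j \<in> {n + 1..<n + 1 + 2 * int p}. lit n j}"
  proof (rule card_inj_on_le)
    show "inj_on (\<lambda>d. n + d) (\<Union>m\<in>{0..<w}. SP m n)" by (simp add: inj_on_def)
    show "(\<lambda>d. n + d) ` (\<Union>m\<in>{0..<w}. SP m n) \<subseteq> {j \<in> {n + 1..<n + 1 + 2 * int p}. lit n j}"
    proof (clarify)
      fix m d assume m: "m \<in> {0..<w}" and d: "d \<in> SP m n"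
      have "0 \<le> 2 * int p * m" using m by simp
      moreover have "2 * int p * m < w * d" using d unfolding SP_def by blast
      ultimately have "0 < w * d" by (rule le_less_trans)
      then have "0 < d" using w_pos by (simp add: zero_less_mult_iff)
      have "2 * int p * (m + 1) \<le> 2 * int p * w" using m by (intro mult_left_mono) auto
      moreover have "w * d \<le> 2 * int p * (m + 1)" using d unfolding SP_def by blast
      ultimately have "w * d \<le> 2 * int p * w" by (rule order_trans[rotated])
      then have "w * d \<le> w * (2 * int p)" by (simp only: mult.commute)
      then have "d \<le> 2 * int p" using w_pos by simp
      with \<open>0 < d\<close> show "n + d \<in> {n + 1..<n + 1 + 2 * int p} \<and> lit n (n + d)" using d by (simp add: SP_def)
    qed
    show "finite {j \<in> {n + 1..<n + 1 + 2 * int p}. lit n j}" by (rule finite_interval)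
  qed
  also have "card (\<Union>m\<in>{0..<w}. SQ m n) \<le> card {j \<in> {n + 1 - 2 * int q..<n + 1}. lit n j}"
  proof (rule card_inj_on_le)
    show "inj_on (\<lambda>d. n - d) (\<Union>m\<in>{0..<w}. SQ m n)" by (simp add: inj_on_def)
    show "(\<lambda>d. n - d) ` (\<Union>m\<in>{0..<w}. SQ m n) \<subseteq> {j \<in> {n + 1 - 2 * int q..<n + 1}. lit n j}"
    proof (clarify)
      fix m d assume m: "m \<in> {0..<w}" and d: "d \<in> SQ m n"
      have "0 \<le> 2 * int q * m" using m by simp
      moreover have "2 * int q * m \<le> w * d" using d unfolding SQ_def by blast
      ultimately have "0 \<le> w * d" by (rule order_trans)
      then have "0 \<le> d" using w_pos by (simp add: zero_le_mult_iff)
      have "2 * int q * (m + 1) \<le> 2 * int q * w" using m by (intro mult_left_mono) auto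
      moreover have "w * d < 2 * int q * (m + 1)" using d unfolding SQ_def by blast
      ultimately have "w * d < 2 * int q * w" by (rule less_le_trans[rotated])
      then have "w * d < w * (2 * int q)" by (simp only: mult.commute)
      then have "d < 2 * int q" using w_pos by simp
      moreover have "lit n (n - d)" using d lit_sym[of n "n + d"] by (simp add: SQ_def)
      ultimately show "n - d \<in> {n + 1 - 2 * int q..<n + 1} \<and> lit n (n - d)" using \<open>0 \<le> d\<close> by simp
    qed
    show "finite {j \<in> {n + 1 - 2 * int q..<n + 1}. lit n j}" by (rule finite_interval)
  qed
  also have "card {j \<in> {n + 1..<n + 1 + 2 * int p}. lit n j} + card {j \<in> {n + 1 - 2 * int q..<n + 1}. lit n j}
    = card ({j \<in> {n + 1..<n + 1 + 2 * int p}. lit n j} \<union> {j \<in> {n + 1 - 2 * int q..<n + 1}. lit n j})"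
    by (intro card_Un_disjoint[symmetric] finite_interval) auto
  also have "\<dots> \<le> card ({j \<in> {n + 1 - 2 * int q..<n + 1 - 2 * int q + w}. lit n j} \<union>
       {j \<in> {n + 1 - 2 * int q + w..<n + 1 - 2 * int q + w + w}. lit n j})"
    by (intro card_mono finite_UnI finite_interval) (auto simp: w_def)
  also have "\<dots> \<le> card {j \<in> {n + 1 - 2 * int q..<n + 1 - 2 * int q + w}. lit n j} +
       card {j \<in> {n + 1 - 2 * int q + w..<n + 1 - 2 * int q + w + w}. lit n j}"
    by (rule card_Un_le)
  also have "\<dots> \<le> r + r" by (intro add_mono card_lit_window assms)
  finally show ?thesis by simp
qed

text \<open>Going up a column, each of the two candidate intercepts of an edge increases by 1 per
  step and so sweeps one window of length w.\<close>

lemma good_count_V: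
  assumes "\<bar>cent (4 * int p * m)\<bar> = 2 * int r"
  shows "(\<Sum>n\<in>{0..<w}. of_bool (good (VSeg m n))) \<le> 2 * r"
proof -
  have win: "(\<Sum>n\<in>{0..<w}. of_bool (lit m (n + c))) \<le> r" for c
  proof -
    have "(\<Sum>n\<in>{0..<w}. of_bool (lit m (n + c))) = card {n \<in> {0..<w}. lit m (n + c)}"
      by (simp add: sum.If_cases of_bool_def Int_def conj_commute)
    also have "\<dots> \<le> card {j \<in> {c..<c + w}. lit m j}"
    proof (rule card_inj_on_le[of "\<lambda>n. n + c"])
      show "finite {j \<in> {c..<c + w}. lit m j}" by (rule finite_interval)
    qed (auto simp: inj_on_def)
    finally show ?thesis using card_lit_window[OF assms, of c] by linarith
  qed
  have "(\<Sum>n\<in>{0..<w}. of_bool (good (VSeg m n))) \<le> (\<Sum>n\<in>{0..<w}. light_count p q (VSeg m n))"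
    by (intro sum_mono good_count_le_light)
  also have "\<dots> = (\<Sum>n\<in>{0..<w}. of_bool (lit m (n + (pfloor m + 1)))) + (\<Sum>n\<in>{0..<w}. of_bool (lit m (n + (2 * m - pfloor m))))"
    by (simp add: light_count_V sum.distrib add.assoc add_diff_eq)
  also have "\<dots> \<le> r + r" by (intro add_mono win)
  finally show ?thesis by simp
qed

section \<open>Lines of low capacity\<close>

definition \<alpha> :: int where "\<alpha> = tune_alpha p q"

lemma int_omega: "int (omega p q) = w" by (simp add: omega_def w_def)

text \<open>Bezout gives an inverse u of 2p modulo w. As w is odd, exactly one of u and w - u lies
  below w / 2, so the definite description in \<open>tune_alpha\<close> denotes.\<close>

lemma alpha_props:
  "0 < \<alpha>" "2 * \<alpha> < w" "w dvd 2 * int p * \<alpha> - 1 \<or> w dvd 2 * int p * \<alpha> + 1"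
proof -
  have modiff: "(2 * a * int p) mod w = 1 mod w \<or> (2 * a * int p) mod w = (-1) mod w \<longleftrightarrow>
     w dvd 2 * int p * a - 1 \<or> w dvd 2 * int p * a + 1" for a
    by (simp add: mod_eq_dvd_iff mult.assoc mult.commute[of a])
  let ?R = "\<lambda>a. 0 < a \<and> 2 * a < w \<and> (w dvd 2 * int p * a - 1 \<or> w dvd 2 * int p * a + 1)"
  have "\<exists>!a. ?R a"
  proof (rule ex_ex1I)
    obtain u v where uv: "u * (2 * int p) + v * w = gcd (2 * int p) w" using bezout_int by blast
    then have "u * (2 * int p) + v * w = 1" using coprime_2p_w by simp
    moreover have "u = w * (u div w) + u mod w" by simp
    ultimately have "2 * int p * (u mod w) - 1 = w * (- v - 2 * int p * (u div w))"
      by (smt (verit, best) distrib_left mult.assoc mult.commute right_diff_distrib mult_minus_right)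
    then have d: "w dvd 2 * int p * (u mod w) - 1" by simp
    have b: "0 \<le> u mod w" "u mod w < w" using w_pos by auto
    have "u mod w \<noteq> 0"
    proof
      assume "u mod w = 0"
      then have "w dvd 1" using d by simp
      then show False using w_pos by simp
    qed
    then have b0: "0 < u mod w" using b by simp
    have "2 * (u mod w) \<noteq> w" using odd_w by (metis even_mult_iff even_numeral)
    then consider "2 * (u mod w) < w" | "w < 2 * (u mod w)" unfolding neq_iff by blast
    then show "\<exists>a. ?R a"
    proof cases
      case 1
      then show ?thesis using b0 d by blast
    next
      case 2
      have "2 * int p * (w - u mod w) + 1 = w * (2 * int p) - (2 * int p * (u mod w) - 1)"
        by (simp add: algebra_simps)
      then have "w dvd 2 * int p * (w - u mod w) + 1" using d by (simp only: dvd_diff dvd_triv_left)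
      then show ?thesis using 2 b by (intro exI[of _ "w - u mod w"]) simp
    qed
  next
    fix a b assume a: "?R a" and b: "?R b"
    have "w dvd 2 * int p * (a - b) \<or> w dvd 2 * int p * (a + b)"
    proof -
      have "2 * int p * (a - b) = (2 * int p * a - 1) - (2 * int p * b - 1)"
        "2 * int p * (a - b) = (2 * int p * a + 1) - (2 * int p * b + 1)"
        "2 * int p * (a + b) = (2 * int p * a - 1) + (2 * int p * b + 1)"
        "2 * int p * (a + b) = (2 * int p * a + 1) + (2 * int p * b - 1)"
        by (simp_all add: algebra_simps)
      then show ?thesis using a b by (metis dvd_add dvd_diff)
    qed
    then have "w dvd a - b \<or> w dvd a + b" by (simp only: dvd_2p_iff)
    then show "a = b"
    proof
      assume "w dvd a - b"
      then have "w dvd \<bar>a - b\<bar>" by simp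
      moreover have "\<bar>a - b\<bar> < w" using a b by auto
      ultimately show ?thesis using zdvd_not_zless[of "\<bar>a - b\<bar>" w] by fastforce
    next
      assume "w dvd a + b"
      then show ?thesis using a b zdvd_not_zless[of "a + b" w] by auto
    qed
  qed
  then have "?R (THE a. ?R a)" by (rule theI')
  moreover have "\<alpha> = (THE a. ?R a)"
    unfolding \<alpha>_def tune_alpha_def int_omega modiff ..
  ultimately have "?R \<alpha>" by (simp only:)
  then show "0 < \<alpha>" "2 * \<alpha> < w" "w dvd 2 * int p * \<alpha> - 1 \<or> w dvd 2 * int p * \<alpha> + 1" by auto
qed

lemma alpha_sign:
  obtains e where "e = 1 \<or> e = - 1" "\<bar>e\<bar> = 1" "e * e = 1" "w dvd 2 * int p * \<alpha> - e"
  using alpha_props(3) by (metis abs_1 abs_minus_cancel diff_minus_eq_add minus_mult_minus mult_1)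

text \<open>Since 2p \<alpha> is e modulo w, 2pn is er modulo w, and doubling gives 4pn modulo
  2w.\<close>

lemma cent_low:
  assumes "w dvd n - r * \<alpha>" "2 * \<bar>r\<bar> < w" "w dvd 2 * int p * \<alpha> - e" "\<bar>e\<bar> = 1"
  shows "cent (4 * int p * n) = 2 * (e * r)"
proof (rule cent_unique)
  have "2 * int p * n - e * r = 2 * int p * (n - r * \<alpha>) + r * (2 * int p * \<alpha> - e)"
    by (simp add: algebra_simps)
  then have "w dvd 2 * int p * n - e * r" using assms(1,3) by simp
  then have "2 * w dvd 2 * (2 * int p * n - e * r)" by (rule mult_dvd_mono[OF dvd_refl])
  then show "2 * w dvd 4 * int p * n - 2 * (e * r)" by (simp add: algebra_simps)
  have "\<bar>e * r\<bar> = \<bar>r\<bar>" using assms(4) by (simp add: abs_mult)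
  then show "- w < 2 * (e * r)" "2 * (e * r) \<le> w" using assms(2) by linarith+
qed

lemma abs_cent_low:
  assumes "w dvd n - r * \<alpha>" "2 * \<bar>r\<bar> < w"
  shows "\<bar>cent (4 * int p * n)\<bar> = 2 * \<bar>r\<bar>"
proof -
  obtain e where e: "\<bar>e\<bar> = 1" "w dvd 2 * int p * \<alpha> - e" by (rule alpha_sign)
  show ?thesis using cent_low[OF assms e(2,1)] e(1) by (simp add: abs_mult)
qed

lemma dvd_alpha_iff: "w dvd k * \<alpha> \<longleftrightarrow> w dvd k"
proof
  obtain e where e: "e * e = 1" "w dvd 2 * int p * \<alpha> - e" by (rule alpha_sign)
  assume "w dvd k * \<alpha>"
  then have "w dvd 2 * int p * (k * \<alpha>) - k * (2 * int p * \<alpha> - e)" using e by (intro dvd_diff) auto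
  then have "w dvd k * e" by (simp add: algebra_simps)
  then have "w dvd k * e * e" by (rule dvd_mult2)
  then show "w dvd k" using e(1) by (simp add: mult.assoc)
qed simp

text \<open>With e as in \<open>alpha_sign\<close>, the mass of intercept n + d is written as e(k +
  r). It is odd, and lightness says 0 < k + r < 2r. Dividing its congruence by 2p leaves d = k
  \<alpha> modulo w.\<close>

lemma lit_low_iff:
  assumes n: "w dvd n - r * \<alpha>" and r: "0 < r" "2 * r < w"
  shows "lit n (n + d) \<longleftrightarrow> (\<exists>k. \<bar>k\<bar> < r \<and> odd (k + r) \<and> w dvd d - k * \<alpha>)"
proof -
  obtain e where e: "e = 1 \<or> e = - 1" "\<bar>e\<bar> = 1" "e * e = 1" "w dvd 2 * int p * \<alpha> - e" by (rule alpha_sign)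
  have c: "cent (4 * int p * n) = 2 * (e * r)" using cent_low[OF n _ e(4,2)] r by simp
  have cong: "w dvd 2 * int p * d - k * e \<longleftrightarrow> w dvd d - k * \<alpha>" for k
  proof -
    have "2 * int p * d - k * e = 2 * int p * (d - k * \<alpha>) + k * (2 * int p * \<alpha> - e)"
      by (simp add: algebra_simps)
    then have "w dvd 2 * int p * d - k * e \<longleftrightarrow> w dvd 2 * int p * (d - k * \<alpha>)"
      using e(4) by (metis dvd_add_left_iff dvd_mult)
    then show ?thesis by (simp only: dvd_2p_iff)
  qed
  have n2: "w dvd 2 * int p * n - e * r"
  proof -
    have "2 * int p * n - e * r = 2 * int p * (n - r * \<alpha>) + r * (2 * int p * \<alpha> - e)"
      by (simp add: algebra_simps)
    then show ?thesis using n e(4) by simp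
  qed
  let ?s = "cent (2 * int p * (n + d) + w)"
  have odd_s: "odd ?s" using odd_w by (simp add: even_cent_iff)
  have s_cong: "w dvd 2 * int p * (n + d) - ?s"
  proof -
    have "w dvd 2 * int p * (n + d) + w - ?s" using cent_cong by (rule dvd_trans[rotated]) simp
    then show ?thesis by (metis add_diff_eq diff_add_eq dvd_add_right_iff dvd_refl add.commute)
  qed
  show ?thesis
  proof
    assume "lit n (n + d)"
    then have b: "0 < e * ?s" "e * ?s < 2 * r" using e(1) r unfolding lit_alt c by auto
    define k where "k = e * ?s - r"
    have "odd (k + r)" using odd_s e(1) by (auto simp: k_def)
    moreover have "\<bar>k\<bar> < r" using b by (auto simp: k_def)
    moreover have "2 * int p * d - k * e = (2 * int p * (n + d) - ?s) - (2 * int p * n - e * r)"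
      using e(1) by (auto simp: k_def algebra_simps)
    then have "w dvd 2 * int p * d - k * e" using s_cong n2 by simp
    ultimately show "\<exists>k. \<bar>k\<bar> < r \<and> odd (k + r) \<and> w dvd d - k * \<alpha>" using cong by blast
  next
    assume "\<exists>k. \<bar>k\<bar> < r \<and> odd (k + r) \<and> w dvd d - k * \<alpha>"
    then obtain k where k: "\<bar>k\<bar> < r" "odd (k + r)" "w dvd d - k * \<alpha>" by blast
    have "?s = e * (k + r)"
    proof (rule cent_unique)
      have "2 * int p * (n + d) + w - e * (k + r) = (2 * int p * d - k * e) + (2 * int p * n - e * r) + w"
        by (simp add: algebra_simps)
      moreover have "w dvd 2 * int p * d - k * e" using cong k(3) by blast
      ultimately have "w dvd 2 * int p * (n + d) + w - e * (k + r)" using n2 by (simp only: dvd_add dvd_refl)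
      moreover have "2 dvd 2 * int p * (n + d) + w - e * (k + r)" using k(2) e(1) odd_w by auto
      moreover have "coprime 2 w" using odd_w by simp
      ultimately show "2 * w dvd 2 * int p * (n + d) + w - e * (k + r)" by (simp only: divides_mult)
      show "- w < e * (k + r)" "e * (k + r) \<le> w" using e(1) k(1) r by auto
    qed
    then show "lit n (n + d)" unfolding lit_alt c using e(1) k(1) r by auto
  qed
qed

section \<open>Invariance under the block lattice\<close>

lemma lit_ex_shift:
  fixes X Y :: real
  assumes "w dvd n' - n" "w dvd c" "Y = X + of_int c"
  shows "(\<exists>j. Y = of_int j \<and> lit n' j) \<longleftrightarrow> (\<exists>j. X = of_int j \<and> lit n j)"
proof
  assume "\<exists>j. Y = of_int j \<and> lit n' j"
  then obtain j where "Y = of_int j" "lit n' j" by blast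
  then have "X = of_int (j - c)" "lit n (j - c)"
    using assms lit_cong[of n' n j "j - c"] by auto
  then show "\<exists>j. X = of_int j \<and> lit n j" by blast
next
  assume "\<exists>j. X = of_int j \<and> lit n j"
  then obtain j where "X = of_int j" "lit n j" by blast
  then have "Y = of_int (j + c)" "lit n' (j + c)"
    using assms lit_cong[of n' n "j + c" j] by auto
  then show "\<exists>j. Y = of_int j \<and> lit n' j" by blast
qed

fun shift_seg :: "int \<Rightarrow> int \<Rightarrow> useg \<Rightarrow> useg" where
  "shift_seg c d (HSeg m n) = HSeg (m + c) (n + d)"
| "shift_seg c d (VSeg m n) = VSeg (m + c) (n + d)"

text \<open>Moving the abscissa by w^2 changes P x and Q x by 2pw and 2qw, so intercepts are
  preserved modulo w as \<open>lit_cong\<close> requires. A move by w would change them by 2p and 2q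
  only; hence the horizontal period w^2.\<close>

lemma light_point_shift:
  fixes x y :: real
  shows "light_point p q (shift_seg (i * w\<^sup>2) (k * w) s) (x + i * w\<^sup>2, y + k * w) = light_point p q s (x, y)"
proof -
  have Pw: "P * (x + i * w\<^sup>2) = P * x + of_int (2 * int p * i * w)"
    and Qw: "Q * (x + i * w\<^sup>2) = Q * x + of_int (2 * int q * i * w)" for x :: real
    using w_pos by (simp_all add: P_eq Q_eq field_simps power2_eq_square)
  show ?thesis
  proof (cases s)
    case (HSeg m n)
    have 1: "(\<exists>j. of_int (n + k * w) + P * (x + i * w\<^sup>2) = of_int j \<and> lit (n + k * w) j) \<longleftrightarrow> (\<exists>j. n + P * x = of_int j \<and> lit n j)"
      by (rule lit_ex_shift[of _ _ "k * w + 2 * int p * i * w"]) (unfold Pw, auto)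
    have 2: "(\<exists>j. of_int (n + k * w) + Q * (x + i * w\<^sup>2) = of_int j \<and> lit (n + k * w) j) \<longleftrightarrow> (\<exists>j. n + Q * x = of_int j \<and> lit n j)"
      by (rule lit_ex_shift[of _ _ "k * w + 2 * int q * i * w"]) (unfold Qw, auto)
    show ?thesis unfolding HSeg shift_seg.simps light_H 1 2 by auto
  next
    case (VSeg m n)
    have 1: "(\<exists>j. (y + k * w) + P * of_int (m + i * w\<^sup>2) = of_int j \<and> lit (m + i * w\<^sup>2) j) \<longleftrightarrow> (\<exists>j. y + P * m = of_int j \<and> lit m j)"
      by (rule lit_ex_shift[of _ _ "k * w + 2 * int p * i * w"])
        (unfold of_int_add of_int_mult of_int_power Pw[unfolded of_int_mult of_int_power], auto simp: power2_eq_square)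
    have 2: "(\<exists>j. (y + k * w) + Q * of_int (m + i * w\<^sup>2) = of_int j \<and> lit (m + i * w\<^sup>2) j) \<longleftrightarrow> (\<exists>j. y + Q * m = of_int j \<and> lit m j)"
      by (rule lit_ex_shift[of _ _ "k * w + 2 * int q * i * w"])
        (unfold of_int_add of_int_mult of_int_power Qw[unfolded of_int_mult of_int_power], auto simp: power2_eq_square)
    show ?thesis unfolding VSeg shift_seg.simps light_V 1 2 by auto
  qed
qed

lemma seg_mid_shift: "seg_mid (shift_seg c d s) = seg_mid s + (of_int c, of_int d)"
  by (cases s) auto

lemma good_shift: "good (shift_seg (i * w\<^sup>2) (k * w) s) = good s"
proof -
  let ?v = "(real_of_int (i * w\<^sup>2), real_of_int (k * w))"
  have lp: "light_point p q (shift_seg (i * w\<^sup>2) (k * w) s) (z + ?v) = light_point p q s z" for z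
    using light_point_shift[of i k s "fst z" "snd z"] by (simp add: prod_eq_iff plus_prod_def)
  have "{z. light_point p q (shift_seg (i * w\<^sup>2) (k * w) s) z} = (\<lambda>z. z + ?v) ` {z. light_point p q s z}"
  proof
    show "{z. light_point p q (shift_seg (i * w\<^sup>2) (k * w) s) z} \<subseteq> (\<lambda>z. z + ?v) ` {z. light_point p q s z}"
    proof
      fix z assume "z \<in> {z. light_point p q (shift_seg (i * w\<^sup>2) (k * w) s) z}"
      then have "light_point p q s (z - ?v)" using lp[of "z - ?v"] by simp
      then show "z \<in> (\<lambda>z. z + ?v) ` {z. light_point p q s z}" by (intro image_eqI[of _ _ "z - ?v"]) auto
    qed
  qed (auto simp only: lp mem_Collect_eq)
  moreover have "card ((\<lambda>z. z + ?v) ` {z. light_point p q s z}) = card {z. light_point p q s z}"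
    by (intro card_image) (simp add: inj_on_def)
  moreover have "is_horizontal (shift_seg c d s) = is_horizontal s" for c d by (cases s) auto
  ultimately show ?thesis
    unfolding good_seg_def light_count_def seg_mid_shift lp by simp
qed

lemma not_good_if_dvd:
  "w dvd n \<Longrightarrow> \<not> good (HSeg m n)" "w dvd n \<Longrightarrow> \<not> good (VSeg n m)"
proof -
  assume "w dvd n"
  then have "\<not> light_point p q (HSeg m n) z" "\<not> light_point p q (VSeg n m) z" for z
    using lit_zero by (cases z; auto simp: light_H light_V)+
  then have none: "{z. light_point p q (HSeg m n) z} = {}" "{z. light_point p q (VSeg n m) z} = {}"
     and mid: "\<not> light_point p q (HSeg m n) (seg_mid (HSeg m n))" by blast+
  then show "\<not> good (HSeg m n)" "\<not> good (VSeg n m)"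
    unfolding good_seg_def light_count_def none using mid by simp_all
qed

lemma polygon_subset_block:
  assumes "S \<in> plaid_polygons p q" "(x, y) \<in> S"
    "of_int (i * w\<^sup>2) \<le> x" "x \<le> of_int (i * w\<^sup>2 + w)" "of_int (k * w) \<le> y" "y \<le> of_int (k * w + w)"
  shows "S \<subseteq> {of_int (i * w\<^sup>2)<..<of_int (i * w\<^sup>2 + w)} \<times> {of_int (k * w)<..<of_int (k * w + w)}"
  using assms(3-6)
  by (intro plaid_polygon_in_blank_rectangle[OF assms(1) _ _ assms(2)]) (simp_all add: not_good_if_dvd power2_eq_square)

text \<open>Add up, over all squares of the block above the line, the parities of the number of good
  edges lying on S: only the edges on the line survive.\<close>

lemma second_crossing:
  assumes S: "S \<in> plaid_polygons p q"
    and m: "0 \<le> m" "m < w" and n: "0 \<le> n" "n < w"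
    and g: "good (HSeg m n)" and mid: "seg_mid (HSeg (m + i * w\<^sup>2) (n + k * w)) \<in> S"
  obtains m' where "0 \<le> m'" "m' < w" "m' \<noteq> m" "good (HSeg m' n)"
    "seg_mid (HSeg (m' + i * w\<^sup>2) (n + k * w)) \<in> S"
proof -
  \<comment> \<open>The edges whose translates lie on S. Translating back makes the parity of good
    edges, known for columns 0 <= m < w, available.\<close>
  define c where "c s \<longleftrightarrow> good s \<and> seg_mid (shift_seg (i * w\<^sup>2) (k * w) s) \<in> S" for s
  have sq: "even (of_bool (c (HSeg a b)) + of_bool (c (HSeg a (b + 1))) + of_bool (c (VSeg a b)) + of_bool (c (VSeg (a + 1) b)) :: nat)"
    if a: "0 \<le> a" "a < w" for a b
  proof (cases "\<exists>e\<in>sq_edges a b. c e")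
    case True
    then obtain e where e: "e \<in> sq_edges a b" "c e" by blast
    have sh: "good_in_square p q (a + i * w\<^sup>2) (b + k * w) (shift_seg (i * w\<^sup>2) (k * w) e)" if "e \<in> sq_edges a b" "good e" for e
      using that by (auto simp: good_in_square_def good_shift) (auto simp: sq_edges_def)
    have "c e' \<longleftrightarrow> good e'" if "e' \<in> sq_edges a b" for e'
      using polygon_square_connected[OF S sh[of e] sh[of e']] e that by (auto simp: c_def)
    then show ?thesis using good_square_even[OF a, of b] by (simp add: sq_edges_def)
  next
    case False
    then show ?thesis by (simp add: sq_edges_def)
  qed
  \<comment> \<open>The other three sides of [0, w] x [n, w] lie on lines of capacity 0.\<close>
  have zero: "\<not> c (HSeg a w)" "\<not> c (VSeg 0 b)" "\<not> c (VSeg w b)" for a b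
    by (simp_all add: c_def not_good_if_dvd)
  have "even ((\<Sum>a\<in>{0..<w}. of_bool (c (HSeg a n)) :: nat) + (\<Sum>a\<in>{0..<w}. of_bool (c (HSeg a w)))
      + (\<Sum>b\<in>{n..<w}. of_bool (c (VSeg 0 b))) + (\<Sum>b\<in>{n..<w}. of_bool (c (VSeg w b))))"
    by (rule even_boundary_sum[of 0 w n w "\<lambda>a b. of_bool (c (HSeg a b))" "\<lambda>a b. of_bool (c (VSeg a b))"])
      (use sq n w_pos in auto)
  then have ev: "even (\<Sum>a\<in>{0..<w}. of_bool (c (HSeg a n)) :: nat)" by (simp add: zero)
  have "c (HSeg m n)" using g mid by (simp add: c_def)
  have "\<exists>m'\<in>{0..<w} - {m}. c (HSeg m' n)"
  proof (rule ccontr)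
    assume "\<not> ?thesis"
    then have "(\<Sum>a\<in>{0..<w} - {m}. of_bool (c (HSeg a n)) :: nat) = 0" by auto
    then have "(\<Sum>a\<in>{0..<w}. of_bool (c (HSeg a n)) :: nat) = 1"
      using \<open>c (HSeg m n)\<close> m by (subst sum.remove[of _ m]) auto
    then show False using ev by simp
  qed
  then obtain m' where m': "m' \<in> {0..<w}" "m' \<noteq> m" "c (HSeg m' n)" by blast
  then show thesis by (intro that[of m']) (auto simp: c_def)
qed

section \<open>Polygons through isolated light points\<close>

lemma SQ_position:
  assumes "d \<in> SQ m n"
  shows "of_int m \<le> d / Q" "d / Q < of_int m + 1"
proof -
  have "real_of_int (2 * int q * m) \<le> real_of_int (w * d)" "real_of_int (w * d) < real_of_int (2 * int q * (m + 1))"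
    using assms unfolding SQ_def of_int_le_iff of_int_less_iff by auto
  then show "of_int m \<le> d / Q" "d / Q < of_int m + 1" using p_pos p_less w_pos by (simp_all add: Q_eq field_simps)
qed

lemma SP_position:
  assumes "d \<in> SP m n"
  shows "of_int m < d / P" "d / P \<le> of_int m + 1"
proof -
  have "real_of_int (2 * int p * m) < real_of_int (w * d)" "real_of_int (w * d) \<le> real_of_int (2 * int p * (m + 1))"
    using assms unfolding SP_def of_int_le_iff of_int_less_iff by auto
  then show "of_int m < d / P" "d / P \<le> of_int m + 1" using p_pos w_pos by (simp_all add: P_eq field_simps)
qed

lemma SQ_bounds:
  assumes "d \<in> SQ m n" "0 \<le> m" "m < w"
  shows "0 \<le> d" "d < 2 * int q"
proof -
  have *: "2 * int q * m \<le> w * d" "w * d < 2 * int q * (m + 1)" using assms(1) unfolding SQ_def by auto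
  have "0 \<le> 2 * int q * m" using assms(2) by simp
  then have "0 \<le> w * d" using *(1) by (rule order_trans)
  then show "0 \<le> d" using w_pos by (simp add: zero_le_mult_iff)
  have "2 * int q * (m + 1) \<le> 2 * int q * w" using assms(3) by (intro mult_left_mono) auto
  then have "w * d < w * (2 * int q)" using *(2) by (simp only: mult.commute[of w])
  then show "d < 2 * int q" using w_pos by simp
qed

lemma SP_bounds:
  assumes "d \<in> SP m n" "0 \<le> m" "m < w"
  shows "0 < d" "d \<le> 2 * int p"
proof -
  have *: "2 * int p * m < w * d" "w * d \<le> 2 * int p * (m + 1)" using assms(1) unfolding SP_def by auto
  have "0 \<le> 2 * int p * m" using assms(2) by simp
  then have "0 < w * d" using *(1) by (rule le_less_trans)
  then show "0 < d" using w_pos by (simp add: zero_less_mult_iff)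
  have "2 * int p * (m + 1) \<le> 2 * int p * w" using assms(3) by (intro mult_left_mono) auto
  then have "w * d \<le> w * (2 * int p)" using *(2) by (simp only: mult.commute[of w])
  then show "d \<le> 2 * int p" using w_pos by simp
qed

text \<open>Isolation by more than 1 makes the edge containing the light point good. The second
  crossing lies on an edge with another light point, at distance at least h; passing from light
  points to the midpoints of their edges costs at most 1.\<close>

lemma polygon_at_isolated_light:
  assumes n: "0 \<le> n" "n < w" and d: "0 \<le> d" "d < 2 * int q" "lit n (n + d)" and h: "1 < h"
    and isoQ: "\<And>d'. d' \<noteq> d \<Longrightarrow> 0 \<le> d' \<Longrightarrow> d' < 2 * int q \<Longrightarrow> lit n (n + d') \<Longrightarrow> h \<le> \<bar>d' / Q - d / Q\<bar>"
    and isoP: "\<And>d'. 0 < d' \<Longrightarrow> d' \<le> 2 * int p \<Longrightarrow> lit n (n + d') \<Longrightarrow> h \<le> \<bar>d' / P - d / Q\<bar>"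
  obtains S z where "S \<in> plaid_polygons p q" "z \<in> S"
    "S \<subseteq> {of_int (i * w\<^sup>2)<..<of_int (i * w\<^sup>2 + w)} \<times> {of_int (k * w)<..<of_int (k * w + w)}"
    "h - 1 \<le> x_diameter S" "\<bar>fst z - (of_int (i * w\<^sup>2) + d / Q)\<bar> \<le> 1" "snd z = of_int (k * w + n)"
proof -
  define m where "m = w * d div (2 * int q)"
  have m: "0 \<le> m" "m < w" "d \<in> SQ m n"
  proof -
    have q0: "0 < 2 * int q" using p_pos p_less by simp
    show "0 \<le> m" using d w_pos q0 by (simp add: m_def pos_imp_zdiv_nonneg_iff)
    have "w * d = 2 * int q * m + w * d mod (2 * int q)" by (simp add: m_def)
    moreover have "0 \<le> w * d mod (2 * int q)" "w * d mod (2 * int q) < 2 * int q" using q0 by auto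
    ultimately have "2 * int q * m \<le> w * d" "w * d < 2 * int q * m + 2 * int q" by linarith+
    then show "d \<in> SQ m n" using d(3) by (simp add: SQ_def distrib_left)
    have "w * d < w * (2 * int q)" using d w_pos by simp
    with \<open>2 * int q * m \<le> w * d\<close> have "2 * int q * m < 2 * int q * w" by (simp only: mult.commute[of w])
    then show "m < w" using q0 by simp
  qed
  have "SQ m n = {d}"
  proof -
    have "d' = d" if "d' \<in> SQ m n" for d'
    proof (rule ccontr)
      assume "d' \<noteq> d"
      then have "h \<le> \<bar>d' / Q - d / Q\<bar>" using isoQ SQ_bounds[OF that m(1,2)] that by (simp add: SQ_def)
      then show False using SQ_position[OF that] SQ_position[OF m(3)] h by linarith
    qed
    then show ?thesis using m(3) by blast
  qed
  moreover have "SP m n = {}"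
  proof -
    have False if "d' \<in> SP m n" for d'
    proof -
      have "h \<le> \<bar>d' / P - d / Q\<bar>" using isoP SP_bounds[OF that m(1,2)] that by (simp add: SP_def)
      then show False using SP_position[OF that] SQ_position[OF m(3)] h by linarith
    qed
    then show ?thesis by blast
  qed
  ultimately have g: "good (HSeg m n)" by (simp add: good_seg_def light_count_H[OF m(1,2)])
  define z where "z = seg_mid (HSeg (m + i * w\<^sup>2) (n + k * w))"
  have "good (HSeg (m + i * w\<^sup>2) (n + k * w))" using g good_shift[of i k "HSeg m n"] by simp
  then obtain S where S: "S \<in> plaid_polygons p q" "z \<in> S" unfolding z_def by (rule good_seg_in_polygon)
  have sub: "S \<subseteq> {of_int (i * w\<^sup>2)<..<of_int (i * w\<^sup>2 + w)} \<times> {of_int (k * w)<..<of_int (k * w + w)}"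
  proof (rule polygon_subset_block[OF S(1)])
    show "(fst z, snd z) \<in> S" using S(2) by simp
    have "real_of_int m + 1 \<le> w" using m(2) by linarith
    then show "of_int (i * w\<^sup>2) \<le> fst z" "fst z \<le> of_int (i * w\<^sup>2 + w)" using m(1) by (simp_all add: z_def)
    show "of_int (k * w) \<le> snd z" "snd z \<le> of_int (k * w + w)" using n by (simp_all add: z_def)
  qed
  obtain m' where m': "0 \<le> m'" "m' < w" "m' \<noteq> m" "good (HSeg m' n)" "seg_mid (HSeg (m' + i * w\<^sup>2) (n + k * w)) \<in> S"
    using second_crossing[OF S(1) m(1,2) n g] S(2) unfolding z_def by blast
  have "h - 1 \<le> \<bar>real_of_int m - real_of_int m'\<bar>"
  proof -
    have "card (SP m' n) + card (SQ m' n) = 1"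
      using m'(4) by (simp add: good_seg_def light_count_H[OF m'(1,2)])
    then have "SP m' n \<noteq> {} \<or> SQ m' n \<noteq> {}" by auto
    then consider d' where "d' \<in> SP m' n" | d' where "d' \<in> SQ m' n" by blast
    then show ?thesis
    proof cases
      case 1
      have "h \<le> \<bar>d' / P - d / Q\<bar>" using isoP SP_bounds[OF 1 m'(1,2)] 1 by (simp add: SP_def)
      then show ?thesis using SP_position[OF 1] SQ_position[OF m(3)] by linarith
    next
      case 2
      have "d' \<noteq> d"
      proof
        assume "d' = d"
        then have "of_int m < of_int m' + (1 :: real)" "of_int m' < of_int m + (1 :: real)"
          using SQ_position[OF 2[unfolded \<open>d' = d\<close>]] SQ_position[OF m(3)] by linarith+
        then show False using m'(3) by linarith
      qed
      then have "h \<le> \<bar>d' / Q - d / Q\<bar>" using isoQ SQ_bounds[OF 2 m'(1,2)] 2 by (simp add: SQ_def)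
      then show ?thesis using SQ_position[OF 2] SQ_position[OF m(3)] by linarith
    qed
  qed
  moreover have "bounded S"
    using sub by (rule bounded_subset[rotated]) (intro bounded_Times, simp_all)
  from x_diameter_ge[OF this S(2) m'(5)] have "\<bar>real_of_int m - real_of_int m'\<bar> \<le> x_diameter S"
    by (simp add: z_def)
  ultimately have "h - 1 \<le> x_diameter S" by linarith
  moreover have "\<bar>fst z - (of_int (i * w\<^sup>2) + d / Q)\<bar> \<le> 1"
    using SQ_position[OF m(3)] by (simp add: z_def)
  moreover have "snd z = of_int (k * w + n)" by (simp add: z_def)
  ultimately show thesis using that S sub by blast
qed

section \<open>Empty cells\<close>

text \<open>Both signs occur because r and -r give mirror lines y and w - y of equal capacity. r = 0
  is left out, as it gives a block side.\<close>

definition low_lines :: "int \<Rightarrow> int set" where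
  "low_lines R = (\<lambda>r. r * \<alpha> mod w) ` ({- R..R} - {0})"

lemma inj_on_low_lines:
  assumes "2 * R < w"
  shows "inj_on (\<lambda>r. r * \<alpha> mod w) {- R..R}"
proof (rule inj_onI)
  fix r s assume rs: "r \<in> {- R..R}" "s \<in> {- R..R}" "r * \<alpha> mod w = s * \<alpha> mod w"
  then have "w dvd (r - s) * \<alpha>" by (simp add: mod_eq_dvd_iff left_diff_distrib)
  then have "w dvd \<bar>r - s\<bar>" by (simp only: dvd_alpha_iff dvd_abs_iff)
  moreover have "\<bar>r - s\<bar> < w" using rs(1,2) assms by auto
  ultimately show "r = s" using zdvd_not_zless[of "\<bar>r - s\<bar>" w] by fastforce
qed

lemma low_lines_subset:
  assumes "2 * R < w"
  shows "low_lines R \<subseteq> {0<..<w}"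
proof
  fix y assume "y \<in> low_lines R"
  then obtain r where r: "r \<in> {- R..R}" "r \<noteq> 0" "y = r * \<alpha> mod w" unfolding low_lines_def by blast
  have "y \<noteq> 0"
    using inj_onD[OF inj_on_low_lines[OF assms], of r 0] r by auto
  moreover have "0 \<le> y" "y < w" using r(3) w_pos by auto
  ultimately show "y \<in> {0<..<w}" by simp
qed

text \<open>\<open>T\<close> stands for the number of crossings of a horizontal or of a vertical
  line. The sum of 2|r| over |r| <= R is 2R(R + 1).\<close>

lemma sum_low_lines:
  assumes R: "0 \<le> R" "2 * R < w" and T: "\<And>y r. 2 * \<bar>r\<bar> < w \<Longrightarrow> w dvd y - r * \<alpha> \<Longrightarrow> T y \<le> 2 * nat \<bar>r\<bar>"
  shows "(\<Sum>y\<in>low_lines R. T y) \<le> nat (2 * R * (R + 1))"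
proof -
  have "(\<Sum>y\<in>low_lines R. T y) = (\<Sum>r\<in>{- R..R} - {0}. T (r * \<alpha> mod w))"
    unfolding low_lines_def
    by (rule sum.reindex[unfolded o_def]) (rule inj_on_subset[OF inj_on_low_lines[OF R(2)]], auto)
  also have "\<dots> \<le> (\<Sum>r\<in>{- R..R} - {0}. 2 * nat \<bar>r\<bar>)"
    using R(2) by (intro sum_mono T) (auto simp: mod_eq_dvd_iff[symmetric])
  also have "\<dots> = (\<Sum>r\<in>{- R..R}. 2 * nat \<bar>r\<bar>)"
    by (rule sum.mono_neutral_left) auto
  also have "\<dots> = nat (2 * R * (R + 1))"
    using R(1)
  proof (induction R rule: int_ge_induct)
    case (step i)
    have "{- (i + 1)..i + 1} = insert (i + 1) (insert (- i - 1) {- i..i})" using step.hyps by auto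
    then have "(\<Sum>r\<in>{- (i + 1)..i + 1}. 2 * nat \<bar>r\<bar>) = 2 * nat (i + 1) + 2 * nat (i + 1) + nat (2 * i * (i + 1))"
      using step by simp
    also have "\<dots> = nat (2 * (i + 1) * (i + 1 + 1))"
    proof -
      have "int (2 * nat (i + 1) + 2 * nat (i + 1) + nat (2 * i * (i + 1))) = int (nat (2 * (i + 1) * (i + 1 + 1)))"
        using step.hyps by (simp add: algebra_simps)
      then show ?thesis by (simp only: of_nat_eq_iff)
    qed
    finally show ?case .
  qed simp
  finally show ?thesis .
qed

definition blank_cell :: "int \<Rightarrow> int \<Rightarrow> int \<Rightarrow> int \<Rightarrow> bool" where
  "blank_cell b c d e \<longleftrightarrow>
     (\<forall>m. b \<le> m \<and> m < c \<longrightarrow> \<not> good (HSeg m d) \<and> \<not> good (HSeg m e)) \<and>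
     (\<forall>n. d \<le> n \<and> n < e \<longrightarrow> \<not> good (VSeg b n) \<and> \<not> good (VSeg c n))"

text \<open>The lines of index at most R cut the block into (2R+1)^2 cells and carry at most
  (2R+1)^2 - 1 crossings. Each crossing lies on two cells, and each cell has an even number of
  them, so some cell has none.\<close>

lemma exists_blank_cell:
  assumes R: "0 \<le> R" "2 * R < w"
  obtains b c d e where "b \<in> insert 0 (low_lines R)" "c \<in> insert w (low_lines R)" "b < c"
    "d \<in> insert 0 (low_lines R)" "e \<in> insert w (low_lines R)" "d < e"
    "{b<..<c} \<inter> low_lines R = {}" "{d<..<e} \<inter> low_lines R = {}" "blank_cell b c d e"
proof -
  let ?A = "low_lines R"
  define L where "L = insert 0 (insert w ?A)"
  \<comment> \<open>\<open>X\<close> lists the cuts 0 = X 0 < ... < X M = w, with M = 2R + 1 gaps;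
    the same cuts are used in both directions.\<close>
  define xs where "xs = sorted_list_of_set L"
  define X where "X i = xs ! i" for i
  define M where "M = nat (2 * R + 1)"
  have finA: "finite ?A" by (simp add: low_lines_def)
  have Asub: "?A \<subseteq> {0<..<w}" by (rule low_lines_subset[OF R(2)])
  have "card ?A = card ({- R..R} - {0})" unfolding low_lines_def
    by (rule card_image) (rule inj_on_subset[OF inj_on_low_lines[OF R(2)]], auto)
  also have "\<dots> = nat (2 * R)" using R(1) by simp
  finally have cardA: "card ?A = nat (2 * R)" .
  have finL: "finite L" using finA by (simp add: L_def)
  have "card L = M + 1"
    using Asub finA cardA w_pos R(1) by (auto simp: L_def M_def card_insert_if nat_add_distrib)
  then have len: "length xs = M + 1" by (simp add: xs_def)
  have setL: "set xs = L" using finL by (simp add: xs_def)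
  have strict: "sorted_wrt (<) xs" using finL by (simp add: xs_def)
  have XL: "X i < X j" if "i < j" "j \<le> M" for i j
    unfolding X_def using that len by (intro sorted_wrt_nth_less[OF strict]) auto
  have Xset: "X ` {..M} = L"
    unfolding setL[symmetric] set_conv_nth X_def using len by (auto simp: less_Suc_eq_le)
  have Lb: "0 \<le> y" "y \<le> w" if "y \<in> L" for y using that Asub w_pos by (auto simp: L_def)
  have X0: "X 0 = 0"
  proof -
    obtain i where i: "i \<le> M" "X i = 0" using Xset by (auto simp: L_def image_iff set_eq_iff) (metis atMost_iff)
    have "0 \<le> X 0" using Xset by (intro Lb) auto
    then show ?thesis using XL[of 0 i] i by (cases i) auto
  qed
  have XM: "X M = w"
  proof -
    obtain i where i: "i \<le> M" "X i = w" using Xset by (auto simp: L_def image_iff set_eq_iff) (metis atMost_iff)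
    have "X M \<le> w" using Xset by (intro Lb) auto
    then show ?thesis using XL[of i M] i by (cases "i = M") auto
  qed
  have Xinj: "inj_on X {..M}"
    by (rule linorder_inj_onI) (use XL in force)+
  have Xint: "X ` {1..<M} = ?A"
  proof -
    have M1: "{..M} = insert 0 (insert M {1..<M})" using R(1) by (auto simp: M_def)
    have "X ` {1..<M} = X ` ({..M} - {0, M})" by (intro arg_cong[where f = "image X"]) auto
    also have "\<dots> = X ` {..M} - X ` {0, M}"
      using Xinj by (intro inj_on_image_set_diff[of X "{..M}"]) auto
    also have "\<dots> = ?A" unfolding Xset using X0 XM Asub by (auto simp: L_def)
    finally show ?thesis .
  qed
  define gH gV where "gH m n = (of_bool (good (HSeg m n)) :: nat)" and "gV m n = (of_bool (good (VSeg m n)) :: nat)" for m n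
  define Hc where "Hc i j = (\<Sum>m\<in>{X i..<X (Suc i)}. gH m (X j))" for i j
  define Vc where "Vc i j = (\<Sum>n\<in>{X j..<X (Suc j)}. gV (X i) n)" for i j
  define deg where "deg i j = Hc i j + Hc i (Suc j) + Vc i j + Vc (Suc i) j" for i j
  have evendeg: "even (deg i j)" if "i < M" "j < M" for i j
    unfolding deg_def Hc_def Vc_def
  proof (rule even_boundary_sum)
    show "X i \<le> X (Suc i)" "X j \<le> X (Suc j)" using XL[of i "Suc i"] XL[of j "Suc j"] that by auto
    fix m n assume m: "X i \<le> m" "m < X (Suc i)"
    have "X i \<in> L" "X (Suc i) \<in> L" using Xset that by auto
    then have "0 \<le> m" "m < w" using m Lb by force+
    then show "even (gH m n + gH m (n + 1) + gV m n + gV (m + 1) n)"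
      unfolding gH_def gV_def by (rule good_square_even)
  qed
  have XLe: "\<And>i. i < M \<Longrightarrow> X i \<le> X (Suc i)" using XL by (simp add: less_imp_le)
  define TH where "TH y = (\<Sum>m\<in>{0..<w}. gH m y)" for y
  define TV where "TV y = (\<Sum>n\<in>{0..<w}. gV y n)" for y
  have sumH: "(\<Sum>i<M. Hc i j) = TH (X j)" for j
    unfolding Hc_def TH_def using sum_consecutive_intervals[of M X "\<lambda>m. gH m (X j)", OF XLe] by (simp add: X0 XM)
  have sumV: "(\<Sum>j<M. Vc i j) = TV (X i)" for i
    unfolding Vc_def TV_def using sum_consecutive_intervals[of M X "\<lambda>n. gV (X i) n", OF XLe] by (simp add: X0 XM)
  \<comment> \<open>Each interior line borders two strips of cells and the outer lines carry
    nothing, so every crossing enters twice.\<close>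
  have Tbound: "(\<Sum>j<M. T (X j) + T (X (Suc j))) \<le> 2 * nat (2 * R * (R + 1))"
    if T0: "T 0 = 0" "T w = 0" and T: "\<And>y r. 2 * \<bar>r\<bar> < w \<Longrightarrow> w dvd y - r * \<alpha> \<Longrightarrow> T y \<le> 2 * nat \<bar>r\<bar>" for T :: "int \<Rightarrow> nat"
  proof -
    have M0: "0 < M" using R(1) by (simp add: M_def)
    have s1: "(\<Sum>j<M. T (X j)) = (\<Sum>j\<in>{1..<M}. T (X j))"
      using M0 by (simp add: lessThan_atLeast0 sum.atLeast_Suc_lessThan X0 T0)
    moreover have "(\<Sum>j<M. T (X (Suc j))) = (\<Sum>j\<in>{1..<M}. T (X j))"
    proof -
      have "(\<Sum>j<M. T (X (Suc j))) = (\<Sum>j<Suc M. T (X j))"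
        by (subst sum.lessThan_Suc_shift) (simp add: X0 T0)
      also have "\<dots> = (\<Sum>j<M. T (X j))" by (simp add: XM T0)
      finally show ?thesis using s1 by simp
    qed
    moreover have "(\<Sum>j\<in>{1..<M}. T (X j)) = (\<Sum>y\<in>?A. T y)"
      unfolding Xint[symmetric]
      by (rule sum.reindex[unfolded o_def, symmetric]) (rule inj_on_subset[OF Xinj], auto)
    ultimately show ?thesis using sum_low_lines[of R T, OF R T] by (simp add: sum.distrib)
  qed
  have THb: "(\<Sum>j<M. TH (X j) + TH (X (Suc j))) \<le> 2 * nat (2 * R * (R + 1))"
  proof (rule Tbound)
    show "TH 0 = 0" "TH w = 0" by (simp_all add: TH_def gH_def not_good_if_dvd)
    fix y r assume "2 * \<bar>r\<bar> < w" "w dvd y - r * \<alpha>"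
    then show "TH y \<le> 2 * nat \<bar>r\<bar>"
      using abs_cent_low[of y r] unfolding TH_def gH_def by (intro good_count_H) simp
  qed
  have TVb: "(\<Sum>j<M. TV (X j) + TV (X (Suc j))) \<le> 2 * nat (2 * R * (R + 1))"
  proof (rule Tbound)
    show "TV 0 = 0" "TV w = 0" by (simp_all add: TV_def gV_def not_good_if_dvd)
    fix y r assume "2 * \<bar>r\<bar> < w" "w dvd y - r * \<alpha>"
    then show "TV y \<le> 2 * nat \<bar>r\<bar>"
      using abs_cent_low[of y r] unfolding TV_def gV_def by (intro good_count_V) simp
  qed
  have "(\<Sum>i<M. \<Sum>j<M. deg i j) = (\<Sum>j<M. TH (X j) + TH (X (Suc j))) + (\<Sum>i<M. TV (X i) + TV (X (Suc i)))"
  proof -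
    have "(\<Sum>i<M. \<Sum>j<M. deg i j) = (\<Sum>i<M. \<Sum>j<M. Hc i j + Hc i (Suc j)) + (\<Sum>i<M. \<Sum>j<M. Vc i j + Vc (Suc i) j)"
      by (simp add: deg_def sum.distrib add.assoc)
    also have "(\<Sum>i<M. \<Sum>j<M. Hc i j + Hc i (Suc j)) = (\<Sum>j<M. \<Sum>i<M. Hc i j + Hc i (Suc j))"
      by (rule sum.swap)
    finally show ?thesis by (simp add: sum.distrib sumH sumV)
  qed
  also have "\<dots> \<le> 4 * nat (2 * R * (R + 1))" using THb TVb by linarith
  \<comment> \<open>8R(R + 1) = 2(2R + 1)^2 - 2, whereas even nonzero degrees in all M^2 cells would
    sum to at least 2M^2.\<close>
  also have "\<dots> < 2 * (M * M)"
  proof -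
    have "int (4 * nat (2 * R * (R + 1))) < int (2 * (M * M))"
      using R(1) by (simp add: M_def algebra_simps)
    then show ?thesis by (simp only: of_nat_less_iff)
  qed
  finally have small: "(\<Sum>i<M. \<Sum>j<M. deg i j) < 2 * (M * M)" .
  have "\<exists>i<M. \<exists>j<M. deg i j = 0"
  proof (rule ccontr)
    assume "\<not> ?thesis"
    then have "2 \<le> deg i j" if "i < M" "j < M" for i j
      using that evendeg[OF that] by (auto elim!: evenE simp: not_less_eq_eq) (metis Suc_1 mult_le_mono2 mult_numeral_1_right numeral_1_eq_Suc_0 numerals(1) Suc_leI neq0_conv mult_is_0)
    then have "(\<Sum>i<M. \<Sum>j<M. 2) \<le> (\<Sum>i<M. \<Sum>j<M. deg i j)" by (intro sum_mono) auto
    then show False using small by simp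
  qed
  then obtain i j where ij: "i < M" "j < M" "deg i j = 0" by blast
  have between: "{X i<..<X (Suc i)} \<inter> ?A = {}" if "i < M" for i
  proof -
    have False if "y \<in> ?A" "X i < y" "y < X (Suc i)" for y
    proof -
      have "y \<in> X ` {1..<M}" using that(1) Xint by simp
      then obtain l where "l \<in> {1..<M}" and ly: "y = X l" by blast
      then have l: "l \<le> M" "y = X l" by auto
      have "i < l" using XL[of l i] l that(2) \<open>i < M\<close> by (metis less_asym less_imp_le linorder_neqE_nat less_irrefl)
      moreover have "l < Suc i" using XL[of "Suc i" l] l that(3) by (metis less_asym linorder_neqE_nat less_irrefl)
      ultimately show False by simp
    qed
    then show ?thesis by auto
  qed
  have memb: "X i \<in> insert 0 ?A" "X (Suc i) \<in> insert w ?A" if "i < M" for i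
  proof -
    have "X i \<in> L" "X (Suc i) \<in> L" "X i \<noteq> w" "X (Suc i) \<noteq> 0"
      using Xset that XL[of i M] XL[of 0 "Suc i"] X0 XM by auto
    then show "X i \<in> insert 0 ?A" "X (Suc i) \<in> insert w ?A" by (auto simp: L_def)
  qed
  have "blank_cell (X i) (X (Suc i)) (X j) (X (Suc j))"
    using ij(3) by (auto simp: blank_cell_def deg_def Hc_def Vc_def gH_def gV_def)
  then show thesis
    using that memb[OF ij(1)] memb[OF ij(2)] between[OF ij(1)] between[OF ij(2)]
      XL[of i "Suc i"] XL[of j "Suc j"] ij by simp
qed

end

section \<open>Large and small polygons in a block\<close>

definition block_interior :: "nat \<Rightarrow> nat \<Rightarrow> int \<Rightarrow> int \<Rightarrow> (real \<times> real) set" where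
  "block_interior p q i k =
     {real_of_int i * (real (omega p q))\<^sup>2<..<real_of_int i * (real (omega p q))\<^sup>2 + real (omega p q)} \<times>
     {real_of_int k * real (omega p q)<..<real_of_int k * real (omega p q) + real (omega p q)}"

text \<open>U and V are measured in units of omega from the lower left corner of the block. All
  blocks are quantified at once, so that constants do not depend on the block chosen for each
  parameter.\<close>

definition polygon_near :: "nat \<Rightarrow> nat \<Rightarrow> real \<Rightarrow> real set \<Rightarrow> real set \<Rightarrow> bool" where
  "polygon_near p q \<delta> U V \<longleftrightarrow> (\<forall>i k. \<exists>S\<in>plaid_polygons p q. \<exists>x\<in>U. \<exists>y\<in>V.
     S \<subseteq> block_interior p q i k \<and> \<delta> * real (omega p q) \<le> x_diameter S \<and>
     (real_of_int i * (real (omega p q))\<^sup>2 + real (omega p q) * x, real_of_int k * real (omega p q) + real (omega p q) * y) \<in> S)"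

text \<open>The first multiple of 1/M at or after b is less than 1/M away, which leaves room for the
  grid interval that starts there.\<close>

lemma interval_contains_grid_interval:
  fixes b c :: real and M :: nat
  assumes "0 \<le> b" "c \<le> 1" "0 < M" "2 / M \<le> c - b"
  obtains j :: nat where "j < M" "b \<le> real j / real M" "(real j + 1) / real M \<le> c"
proof -
  define j where "j = nat \<lceil>b * M\<rceil>"
  have j: "real j = of_int \<lceil>b * M\<rceil>" using assms(1) by (simp add: j_def)
  have "b * M \<le> real j" "real j < b * M + 1" unfolding j by linarith+
  moreover have "2 \<le> (c - b) * M" using assms(3,4) by (simp add: field_simps)
  then have "b * M + 2 \<le> c * M" by (simp add: algebra_simps)
  moreover have "c * M \<le> M" using assms(2,3) by simp
  ultimately have "real j < real M" "b * M \<le> real j" "real j + 1 \<le> c * M" by linarith+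
  then show thesis using assms(3) by (intro that[of j]) (simp_all add: field_simps)
qed

section \<open>A single parameter, in coordinates divided by omega\<close>

context even_parameter
begin

abbreviation "W \<equiv> real_of_int w"
definition \<tau> :: real where "\<tau> = \<alpha> / W"
definition \<rho> :: real where "\<rho> = real p / real q"

lemma tune_eq: "tune p q = \<tau>" by (simp add: tune_def \<tau>_def \<alpha>_def real_omega)

lemma rho_pos: "0 < \<rho>" using p_pos p_less by (simp add: \<rho>_def)

lemma P_rho: "P = 2 * \<rho> / (1 + \<rho>)" and Q_rho: "Q = 2 / (1 + \<rho>)"
  using p_pos p_less by (simp_all add: P_eq Q_eq \<rho>_def w_def field_simps)

lemma W_tau: "W * (of_int r * \<tau> + of_int h) = of_int (r * \<alpha> + h * w)"
  using w_pos by (simp add: \<tau>_def field_simps)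

text \<open>A bound on i that does not involve w makes the competitors of a light point a finite
  family of pairs (k, i), as the limit argument requires.\<close>

lemma alpha_offset:
  assumes "w dvd d - k * \<alpha>" "\<bar>k\<bar> < r" "0 \<le> d" "d \<le> 2 * w"
  obtains i where "d = k * \<alpha> + i * w" "\<bar>i\<bar> \<le> r + 3"
proof -
  obtain i where i: "d - k * \<alpha> = w * i" using assms(1) by (rule dvdE)
  have "\<bar>k * \<alpha>\<bar> \<le> r * w" unfolding abs_mult using assms(2) alpha_props w_pos by (intro mult_mono) auto
  then have "w * i \<le> w * (r + 2)" "w * (- r) \<le> w * i" using assms(3,4) i by (auto simp: algebra_simps)
  moreover have "0 < w" using w_pos by simp
  ultimately have "i \<le> r + 2" "- r \<le> i" by (simp_all only: mult_le_cancel_left_pos)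
  then have "\<bar>i\<bar> \<le> r + 3" using assms(2) by linarith
  then show thesis using i by (intro that[of i]) (simp_all add: algebra_simps)
qed

lemma block_interior_eq:
  "block_interior p q i k = {of_int (i * w\<^sup>2)<..<of_int (i * w\<^sup>2 + w)} \<times> {of_int (k * w)<..<of_int (k * w + w)}"
  by (simp add: block_interior_def real_omega)

text \<open>The Q-point with d = k \<alpha> + iw lies at W (k \<tau> + i)(1 + \<rho>) / 2; for
  P-points there is an extra factor 1 / \<rho>. The separation \<delta> is multiplied by W / Q > W /
  2, and 4 <= \<delta> W makes \<delta> W / 2 - 1 at least \<delta> W / 4. The margin 1 / W pays for
  moving from the light point to the edge midpoint.\<close>

lemma polygon_near_isolated:
  fixes r k h i :: int and \<delta> :: real
  assumes r: "0 < r" "2 * r < w" and y: "0 < r * \<tau> + h" "r * \<tau> + h < 1" "r * \<tau> + h \<in> V"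
    and k: "\<bar>k\<bar> < r" "odd (k + r)"
    and x: "0 < (k * \<tau> + i) * (1 + \<rho>) / 2" "(k * \<tau> + i) * (1 + \<rho>) / 2 < 1"
    and xU: "{(k * \<tau> + i) * (1 + \<rho>) / 2 - 1 / W .. (k * \<tau> + i) * (1 + \<rho>) / 2 + 1 / W} \<subseteq> U"
    and isoQ: "\<And>k' i'. \<bar>k'\<bar> < r \<Longrightarrow> \<bar>i'\<bar> \<le> r + 3 \<Longrightarrow> (k', i') \<noteq> (k, i) \<Longrightarrow> \<delta> \<le> \<bar>(of_int k' * \<tau> + of_int i') - (k * \<tau> + i)\<bar>"
    and isoP: "\<And>k' i'. \<bar>k'\<bar> < r \<Longrightarrow> odd (k' + r) \<Longrightarrow> \<bar>i'\<bar> \<le> r + 3 \<Longrightarrow> \<delta> \<le> \<bar>(of_int k' * \<tau> + of_int i') / \<rho> - (k * \<tau> + i)\<bar>"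
    and \<delta>: "4 \<le> \<delta> * W"
  shows "polygon_near p q (\<delta> / 4) U V"
  unfolding polygon_near_def
proof (intro allI)
  fix i0 k0
  define n where "n = r * \<alpha> + h * w"
  define d where "d = k * \<alpha> + i * w"
  have nW: "real_of_int n = W * (r * \<tau> + h)" and dW: "real_of_int d = W * (k * \<tau> + i)"
    unfolding n_def d_def W_tau by simp_all
  have W0: "0 < W" using w_pos by simp
  have "0 < real_of_int n" unfolding nW using y W0 by (intro mult_pos_pos)
  moreover have "real_of_int n < W" unfolding nW using y W0 by (simp add: mult_less_cancel_left2)
  ultimately have n: "0 \<le> n" "n < w" by simp_all
  have Q0: "0 < Q" "Q < 2" using rho_pos by (simp_all add: Q_rho field_simps)
  have dQ: "d / Q = W * ((k * \<tau> + i) * (1 + \<rho>) / 2)" unfolding dW using rho_pos by (simp add: Q_rho field_simps)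
  have "0 < d / Q" unfolding dQ using x W0 by (intro mult_pos_pos)
  then have d0: "0 < d" using Q0 by (simp add: zero_less_divide_iff)
  have "d / Q < W" unfolding dQ using x W0 by (simp add: mult_less_cancel_left2)
  then have "real_of_int d < real_of_int (2 * int q)" using Q0 W0 by (simp add: Q_eq field_simps)
  then have d1: "d < 2 * int q" by (simp only: of_int_less_iff)
  have ltiff: "lit n (n + d') \<longleftrightarrow> (\<exists>k. \<bar>k\<bar> < r \<and> odd (k + r) \<and> w dvd d' - k * \<alpha>)" for d'
    by (rule lit_low_iff) (use r in \<open>simp_all add: n_def\<close>)
  have ltd: "lit n (n + d)" unfolding ltiff using k by (intro exI[of _ k]) (simp add: d_def)
  have far: "\<delta> * W / 2 \<le> \<bar>W / Q * s\<bar>" if "\<delta> \<le> \<bar>s\<bar>" for s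
  proof -
    have "1 / 2 \<le> 1 / Q" using Q0 by (simp add: field_simps)
    then have "W * (1 / 2) \<le> W * (1 / Q)" using W0 by (intro mult_left_mono) auto
    moreover have "0 \<le> \<delta>" using \<delta> W0 by (smt (verit) mult_neg_pos)
    ultimately have "W * (1 / 2) * \<delta> \<le> W * (1 / Q) * \<bar>s\<bar>" using that W0 Q0 by (intro mult_mono) auto
    then show ?thesis using W0 Q0 by (simp add: abs_mult algebra_simps)
  qed
  obtain S z where S: "S \<in> plaid_polygons p q" "z \<in> S"
    "S \<subseteq> {of_int (i0 * w\<^sup>2)<..<of_int (i0 * w\<^sup>2 + w)} \<times> {of_int (k0 * w)<..<of_int (k0 * w + w)}"
    "\<delta> * W / 2 - 1 \<le> x_diameter S" "\<bar>fst z - (of_int (i0 * w\<^sup>2) + d / Q)\<bar> \<le> 1" "snd z = of_int (k0 * w + n)"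
  proof (rule polygon_at_isolated_light[of n d "\<delta> * W / 2" i0 k0])
    show "0 \<le> n" "n < w" "0 \<le> d" "d < 2 * int q" "lit n (n + d)" using n d0 d1 ltd by simp_all
    show "1 < \<delta> * W / 2" using \<delta> by simp
    show "\<delta> * W / 2 \<le> \<bar>d' / Q - d / Q\<bar>" if d': "d' \<noteq> d" "0 \<le> d'" "d' < 2 * int q" "lit n (n + d')" for d'
    proof -
      obtain k' where k': "\<bar>k'\<bar> < r" "odd (k' + r)" "w dvd d' - k' * \<alpha>" using d'(4) ltiff by blast
      have "d' \<le> 2 * w" using d'(3) by (simp add: w_def)
      then obtain i' where i': "d' = k' * \<alpha> + i' * w" "\<bar>i'\<bar> \<le> r + 3" using alpha_offset[OF k'(3,1) d'(2)] by blast
      have "(k', i') \<noteq> (k, i)" using d'(1) i'(1) by (auto simp: d_def)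
      then have "\<delta> \<le> \<bar>(of_int k' * \<tau> + of_int i') - (k * \<tau> + i)\<bar>" using isoQ k'(1) i'(2) by blast
      moreover have "d' / Q - d / Q = W / Q * ((of_int k' * \<tau> + of_int i') - (k * \<tau> + i))"
        unfolding i'(1) dW W_tau[symmetric] by (simp add: field_simps diff_divide_distrib)
      ultimately show ?thesis using far by simp
    qed
    show "\<delta> * W / 2 \<le> \<bar>d' / P - d / Q\<bar>" if d': "0 < d'" "d' \<le> 2 * int p" "lit n (n + d')" for d'
    proof -
      obtain k' where k': "\<bar>k'\<bar> < r" "odd (k' + r)" "w dvd d' - k' * \<alpha>" using d'(3) ltiff by blast
      have "d' \<le> 2 * w" "0 \<le> d'" using d' by (simp_all add: w_def)
      then obtain i' where i': "d' = k' * \<alpha> + i' * w" "\<bar>i'\<bar> \<le> r + 3" using alpha_offset[OF k'(3,1)] by blast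
      have "\<delta> \<le> \<bar>(of_int k' * \<tau> + of_int i') / \<rho> - (k * \<tau> + i)\<bar>" using isoP k' i'(2) by blast
      moreover have "d' / P - d / Q = W / Q * ((of_int k' * \<tau> + of_int i') / \<rho> - (k * \<tau> + i))"
        unfolding i'(1) dW W_tau[symmetric] P_rho Q_rho using rho_pos by (simp add: field_simps)
      ultimately show ?thesis using far by simp
    qed
  qed
  define x' where "x' = (fst z - of_int (i0 * w\<^sup>2)) / W"
  have "\<bar>x' - (k * \<tau> + i) * (1 + \<rho>) / 2\<bar> \<le> 1 / W"
  proof -
    have "x' - (k * \<tau> + i) * (1 + \<rho>) / 2 = (fst z - (of_int (i0 * w\<^sup>2) + d / Q)) / W"
      unfolding dQ x'_def using W0 by (simp add: field_simps)
    then show ?thesis using S(5) W0 by (simp add: abs_divide divide_right_mono)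
  qed
  then have "x' \<in> U" using xU by (auto simp: abs_le_iff)
  moreover have "(real_of_int i0 * (real (omega p q))\<^sup>2 + real (omega p q) * x', real_of_int k0 * real (omega p q) + real (omega p q) * (r * \<tau> + h)) = z"
    using W0 S(6) nW by (simp add: x'_def real_omega prod_eq_iff)
  moreover have "\<delta> / 4 * real (omega p q) \<le> x_diameter S" using S(4) \<delta> by (simp add: real_omega)
  ultimately show "\<exists>S\<in>plaid_polygons p q. \<exists>x\<in>U. \<exists>y\<in>V.
     S \<subseteq> block_interior p q i0 k0 \<and> \<delta> / 4 * real (omega p q) \<le> x_diameter S \<and>
     (real_of_int i0 * (real (omega p q))\<^sup>2 + real (omega p q) * x, real_of_int k0 * real (omega p q) + real (omega p q) * y) \<in> S"
    using S(1-3) y(3) unfolding block_interior_eq by blast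
qed

lemma low_line_form:
  assumes "0 \<le> R" "y \<in> insert 0 (insert w (low_lines R))"
  obtains r h where "y = r * \<alpha> + h * w" "\<bar>r\<bar> \<le> R" "\<bar>h\<bar> \<le> R + 1"
proof -
  have "y = 0 \<or> y = w \<or> (\<exists>r\<in>{- R..R}. y = r * \<alpha> mod w)"
    using assms(2) unfolding low_lines_def by blast
  then consider "y = 0" | "y = w" | r where "r \<in> {- R..R}" "y = r * \<alpha> mod w" by blast
  then show thesis
  proof cases
    case 1
    then show thesis using assms(1) by (intro that[of 0 0]) auto
  next
    case 2
    then show thesis using assms(1) by (intro that[of 0 1]) auto
  next
    case 3
    then have r: "\<bar>r\<bar> \<le> R" by auto
    have m: "r * \<alpha> mod w = r * \<alpha> + (- (r * \<alpha> div w)) * w" by (simp add: minus_mult_div_eq_mod[symmetric])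
    have b: "0 \<le> r * \<alpha> mod w" "r * \<alpha> mod w < w" using w_pos by auto
    have "\<bar>r * \<alpha>\<bar> \<le> R * w" unfolding abs_mult using r alpha_props w_pos by (intro mult_mono) auto
    moreover have "(- R - 1) * w = - (R * w) - w" by (simp add: algebra_simps)
    moreover have "(r * \<alpha> div w) * w = r * \<alpha> - r * \<alpha> mod w" by (simp add: minus_mod_eq_div_mult)
    ultimately have "(r * \<alpha> div w) * w \<le> R * w" "(- R - 1) * w \<le> (r * \<alpha> div w) * w"
      using b by linarith+
    moreover have "0 < w" using w_pos by simp
    ultimately have "r * \<alpha> div w \<le> R" "- R - 1 \<le> r * \<alpha> div w" by (simp_all only: mult_le_cancel_right_pos)
    then have "\<bar>- (r * \<alpha> div w)\<bar> \<le> R + 1" by linarith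
    then show thesis using 3 r m by (intro that[of r "- (r * \<alpha> div w)"]) auto
  qed
qed

text \<open>Cuts are of the form W (r \<tau> + h) with bounded r and h, so two of them differ by at
  least \<epsilon> W. On the other hand every interval of the 1/M grid contains a cut, and a gap
  longer than 2/M would contain such an interval.\<close>

lemma cell_width:
  fixes M :: nat and \<epsilon> :: real
  assumes R: "0 \<le> R" "2 * R < w" and M: "0 < M"
    and dense: "\<And>j. j < M \<Longrightarrow> \<exists>r h. 0 < r \<and> r \<le> R \<and> real j / real M < of_int r * \<tau> + of_int h \<and> of_int r * \<tau> + of_int h < (real j + 1) / M"
    and sep: "\<And>c h. \<bar>c\<bar> \<le> 2 * R \<Longrightarrow> \<bar>h\<bar> \<le> 2 * R + 2 \<Longrightarrow> (c, h) \<noteq> (0, 0) \<Longrightarrow> \<epsilon> \<le> \<bar>of_int c * \<tau> + of_int h\<bar>"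
    and bc: "b \<in> insert 0 (low_lines R)" "c \<in> insert w (low_lines R)" "b < c" "{b<..<c} \<inter> low_lines R = {}"
  shows "\<epsilon> * W \<le> real_of_int (c - b)" "real_of_int (c - b) \<le> 2 / M * W" "0 \<le> b" "c \<le> w"
proof -
  have W0: "0 < W" using w_pos by simp
  show bc0: "0 \<le> b" "c \<le> w" using bc(1,2) low_lines_subset[OF R(2)] w_pos by auto
  obtain r h r' h' where b: "b = r * \<alpha> + h * w" "\<bar>r\<bar> \<le> R" "\<bar>h\<bar> \<le> R + 1"
    and c: "c = r' * \<alpha> + h' * w" "\<bar>r'\<bar> \<le> R" "\<bar>h'\<bar> \<le> R + 1"
    using low_line_form[OF R(1), of b] low_line_form[OF R(1), of c] bc(1,2) by (metis insertCI insertE)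
  have cb: "real_of_int (c - b) = W * (of_int (r' - r) * \<tau> + of_int (h' - h))"
    unfolding W_tau b c by (simp add: algebra_simps)
  have "(r' - r, h' - h) \<noteq> (0, 0)" using bc(3) b(1) c(1) by auto
  then have "\<epsilon> \<le> \<bar>of_int (r' - r) * \<tau> + of_int (h' - h)\<bar>" using b c by (intro sep) auto
  then have "W * \<epsilon> \<le> W * \<bar>of_int (r' - r) * \<tau> + of_int (h' - h)\<bar>" using W0 by (intro mult_left_mono) auto
  also have "\<dots> = \<bar>real_of_int (c - b)\<bar>" unfolding cb abs_mult using W0 by simp
  finally show "\<epsilon> * W \<le> real_of_int (c - b)" using bc(3) by (simp add: mult.commute)
  show "real_of_int (c - b) \<le> 2 / M * W"
  proof (rule ccontr)
    assume "\<not> ?thesis"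
    then have "2 / M * W \<le> real_of_int c - real_of_int b" by simp
    then have "2 / M \<le> c / W - b / W" using W0 unfolding diff_divide_distrib[symmetric] by (simp only: pos_le_divide_eq)
    moreover have "0 \<le> b / W" "c / W \<le> 1" using bc0 W0 by simp_all
    ultimately have p: "0 \<le> b / W" "c / W \<le> 1" "2 / M \<le> c / W - b / W" by blast+
    obtain j where j: "j < M" "b / W \<le> real j / real M" "(real j + 1) / real M \<le> c / W"
      by (rule interval_contains_grid_interval[OF p(1,2) M p(3)])
    obtain s g where s: "0 < s" "s \<le> R" "real j / real M < of_int s * \<tau> + of_int g" "of_int s * \<tau> + of_int g < (real j + 1) / M"
      using dense[OF j(1)] by blast
    have "b / W < of_int s * \<tau> + of_int g" "of_int s * \<tau> + of_int g < c / W" using s j by (auto simp: add.commute)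
    then have "real_of_int b < W * (of_int s * \<tau> + of_int g)" "W * (of_int s * \<tau> + of_int g) < real_of_int c"
      using W0 by (simp_all add: field_simps)
    then have inside: "b < s * \<alpha> + g * w" "s * \<alpha> + g * w < c" unfolding W_tau of_int_less_iff .
    then have "0 \<le> s * \<alpha> + g * w" "s * \<alpha> + g * w < w" using bc0 by auto
    then have "s * \<alpha> + g * w = s * \<alpha> mod w" using mod_pos_pos_trivial by (metis mod_mult_self1)
    then have "s * \<alpha> + g * w \<in> low_lines R" using s(1,2) by (auto simp: low_lines_def)
    then show False using inside bc(4) by auto
  qed
qed

text \<open>A blank cell has sides at least \<epsilon> W >= 2W / M', so it contains a square of the
  finer 1/M' grid. A large polygon meeting that square cannot leave the cell, whose width bounds its
  x-diameter.\<close>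

lemma small_polygon:
  fixes M M' :: nat and \<delta> \<epsilon> :: real
  assumes R: "0 \<le> R" "2 * R < w" and M: "0 < M"
    and dense: "\<And>j. j < M \<Longrightarrow> \<exists>r h. 0 < r \<and> r \<le> R \<and> real j / real M < of_int r * \<tau> + of_int h \<and> of_int r * \<tau> + of_int h < (real j + 1) / M"
    and sep: "\<And>c h. \<bar>c\<bar> \<le> 2 * R \<Longrightarrow> \<bar>h\<bar> \<le> 2 * R + 2 \<Longrightarrow> (c, h) \<noteq> (0, 0) \<Longrightarrow> \<epsilon> \<le> \<bar>of_int c * \<tau> + of_int h\<bar>"
    and M': "0 < M'" "2 / M' \<le> \<epsilon>"
    and near: "\<And>j l. j < M' \<Longrightarrow> l < M' \<Longrightarrow> polygon_near p q \<delta> {real j / real M'<..<(real j + 1) / real M'} {real l / real M'<..<(real l + 1) / real M'}"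
  obtains S where "S \<in> plaid_polygons p q" "S \<subseteq> block_interior p q i k"
    "\<delta> * W \<le> x_diameter S" "x_diameter S \<le> 2 / M * W"
proof -
  have W0: "0 < W" using w_pos by simp
  obtain b c d e where bcde: "b \<in> insert 0 (low_lines R)" "c \<in> insert w (low_lines R)" "b < c"
    "d \<in> insert 0 (low_lines R)" "e \<in> insert w (low_lines R)" "d < e"
    "{b<..<c} \<inter> low_lines R = {}" "{d<..<e} \<inter> low_lines R = {}" "blank_cell b c d e"
    using exists_blank_cell[OF R] by blast
  note bc = cell_width[OF R M dense sep bcde(1,2,3,7)]
  note de = cell_width[OF R M dense sep bcde(4,5,6,8)]
  have grid: "\<exists>j<M'. W * (real j / real M') \<ge> b \<and> W * ((real j + 1) / real M') \<le> c" if h: "\<epsilon> * W \<le> real_of_int (c - b)" "0 \<le> b" "c \<le> w" for b c :: int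
  proof -
    have "2 / M' * W \<le> \<epsilon> * W" using M'(2) W0 by (intro mult_right_mono) auto
    then have "2 / M' * W \<le> real_of_int c - real_of_int b" using h(1) by linarith
    then have "2 / M' \<le> c / W - b / W" using W0 unfolding diff_divide_distrib[symmetric] by (simp only: pos_le_divide_eq)
    moreover have "0 \<le> b / W" "c / W \<le> 1" using h(2,3) W0 by simp_all
    ultimately have p: "0 \<le> b / W" "c / W \<le> 1" "2 / M' \<le> c / W - b / W" by blast+
    obtain j where j: "j < M'" "b / W \<le> real j / real M'" "(real j + 1) / real M' \<le> c / W"
      by (rule interval_contains_grid_interval[OF p(1,2) M'(1) p(3)])
    have "b \<le> real j / real M' * W" using j(2) unfolding pos_divide_le_eq[OF W0] .
    moreover have "(real j + 1) / M' * W \<le> c" using j(3) unfolding pos_le_divide_eq[OF W0] by (simp add: add.commute)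
    ultimately show ?thesis using j(1) by (intro exI[of _ j]) (simp only: mult.commute[of W] simp_thms)
  qed
  obtain j where j: "j < M'" "W * (real j / real M') \<ge> b" "W * ((real j + 1) / real M') \<le> c" using grid[OF bc(1,3,4)] by blast
  obtain l where l: "l < M'" "W * (real l / real M') \<ge> d" "W * ((real l + 1) / real M') \<le> e" using grid[OF de(1,3,4)] by blast
  from near[OF j(1) l(1), unfolded polygon_near_def, rule_format, of i k]
  obtain S x y where S: "S \<in> plaid_polygons p q" "S \<subseteq> block_interior p q i k" "\<delta> * W \<le> x_diameter S"
    "x \<in> {real j / real M'<..<(real j + 1) / real M'}" "y \<in> {real l / real M'<..<(real l + 1) / real M'}"
    "(of_int i * W\<^sup>2 + W * x, of_int k * W + W * y) \<in> S"
    unfolding real_omega by blast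
  have xy: "b \<le> W * x" "W * x \<le> c" "d \<le> W * y" "W * y \<le> e"
  proof -
    have "real j / real M' \<le> x" "x \<le> (real j + 1) / real M'" "real l / real M' \<le> y" "y \<le> (real l + 1) / real M'" using S(4,5) by auto
    then have "W * (real j / real M') \<le> W * x" "W * x \<le> W * ((real j + 1) / real M')" "W * (real l / real M') \<le> W * y" "W * y \<le> W * ((real l + 1) / real M')"
      using W0 by (simp_all only: mult_le_cancel_left_pos)
    then show "b \<le> W * x" "W * x \<le> c" "d \<le> W * y" "W * y \<le> e" using j(2,3) l(2,3) by (blast intro: order_trans)+
  qed
  \<comment> \<open>Blankness is known in the base block; the block lattice carries it to block (i,
    k).\<close>
  have goodH: "good (HSeg m (n + k * w)) \<longleftrightarrow> good (HSeg (m - i * w\<^sup>2) n)" for m n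
    using good_shift[of i k "HSeg (m - i * w\<^sup>2) n"] by simp
  have goodV: "good (VSeg (m + i * w\<^sup>2) n) \<longleftrightarrow> good (VSeg m (n - k * w))" for m n
    using good_shift[of i k "VSeg m (n - k * w)"] by simp
  have "S \<subseteq> {of_int (b + i * w\<^sup>2)<..<of_int (c + i * w\<^sup>2)} \<times> {of_int (d + k * w)<..<of_int (e + k * w)}"
  proof (rule plaid_polygon_in_blank_rectangle[OF S(1) _ _ S(6)])
    show "\<not> good (HSeg m (d + k * w)) \<and> \<not> good (HSeg m (e + k * w))" if "b + i * w\<^sup>2 \<le> m" "m < c + i * w\<^sup>2" for m
      unfolding goodH using bcde(9) that by (auto simp: blank_cell_def)
    show "\<not> good (VSeg (b + i * w\<^sup>2) n) \<and> \<not> good (VSeg (c + i * w\<^sup>2) n)" if "d + k * w \<le> n" "n < e + k * w" for n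
      unfolding goodV using bcde(9) that by (auto simp: blank_cell_def)
  qed (use xy in simp_all)
  then have "x_diameter S \<le> of_int (c + i * w\<^sup>2) - of_int (b + i * w\<^sup>2)"
    by (rule x_diameter_le) (use bcde(3) in simp)
  also have "\<dots> \<le> 2 / M * W" using bc(2) by simp
  finally show thesis using that S(1-3) by blast
qed

end

section \<open>Tuned sequences\<close>

lemma uniform_threshold:
  fixes R :: "'a \<Rightarrow> real \<Rightarrow> nat \<Rightarrow> bool"
  assumes "finite A" "\<And>x. x \<in> A \<Longrightarrow> \<exists>\<delta>>0. \<forall>\<^sub>F n in sequentially. R x \<delta> n"
    and anti: "\<And>x \<delta> \<delta>' n. R x \<delta> n \<Longrightarrow> \<delta>' \<le> \<delta> \<Longrightarrow> R x \<delta>' n"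
  shows "\<exists>\<delta>>0. \<forall>\<^sub>F n in sequentially. \<forall>x\<in>A. R x \<delta> n"
  using assms(1,2)
proof (induction A rule: finite_induct)
  case empty
  show ?case by (intro exI[of _ 1]) simp
next
  case (insert x A)
  then obtain \<delta> \<delta>' where \<delta>: "\<delta> > 0" "\<forall>\<^sub>F n in sequentially. \<forall>x\<in>A. R x \<delta> n"
    and \<delta>': "\<delta>' > 0" "\<forall>\<^sub>F n in sequentially. R x \<delta>' n" by (metis insertCI)
  have "\<forall>\<^sub>F n in sequentially. \<forall>y\<in>insert x A. R y (min \<delta> \<delta>') n"
    using \<delta>(2) \<delta>'(2) by eventually_elim (auto intro: anti)
  then show ?case using \<delta>(1) \<delta>'(1) by (intro exI[of _ "min \<delta> \<delta>'"]) simp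
qed

lemma polygon_near_antimono:
  assumes "polygon_near p q \<delta> U V" "\<delta>' \<le> \<delta>"
  shows "polygon_near p q \<delta>' U V"
proof -
  have "\<delta>' * real (omega p q) \<le> \<delta> * real (omega p q)" using assms(2) by (intro mult_right_mono) auto
  then show ?thesis using assms(1) unfolding polygon_near_def by (meson order_trans)
qed

locale tuned_sequence =
  fixes p q :: "nat \<Rightarrow> nat" and L t :: real
  assumes params: "\<And>n. even_param (p n) (q n)"
    and conv: "(\<lambda>n. real (p n) / real (q n)) \<longlonglongrightarrow> L" and L_irr: "L \<notin> \<rat>"
    and tuned: "(\<lambda>n. tune (p n) (q n)) \<longlonglongrightarrow> t" and t_irr: "t \<notin> \<rat>"
begin

lemma even_parameter: "even_parameter (p n) (q n)"
  using params by (simp add: even_parameter_def)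

text \<open>L < 1 is the limit form of P < Q, the source of the surplus of Q-points. Irrationality
  excludes the ends of the closed interval.\<close>

lemma L_bounds: "0 < L" "L < 1"
proof -
  have b: "0 \<le> real (p n) / real (q n) \<and> real (p n) / real (q n) \<le> 1" for n
    using params[of n] by (simp add: even_param_def)
  have "0 \<le> L" by (rule LIMSEQ_le_const[OF conv]) (use b in blast)
  moreover have "L \<le> 1" by (rule LIMSEQ_le_const2[OF conv]) (use b in blast)
  moreover have "L \<noteq> 0" "L \<noteq> 1" using L_irr by auto
  ultimately show "0 < L" "L < 1" by auto
qed

text \<open>Parameters with bounded omega have tunes in a finite set of rationals, which is closed
  and misses t.\<close>

lemma omega_large: "\<forall>\<^sub>F n in sequentially. K < real (omega (p n) (q n))"
proof -
  define N where "N = nat \<lceil>K\<rceil>"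
  define S where "S = (\<lambda>(a, b). real_of_int a / real b) ` ({0..int N} \<times> {..N})"
  have "finite S" by (simp add: S_def)
  moreover have "t \<notin> S" using t_irr by (auto simp: S_def Rats_divide)
  ultimately have "\<forall>\<^sub>F n in sequentially. tune (p n) (q n) \<in> - S"
    using tuned by (intro topological_tendstoD[OF tuned]) (auto simp: open_Compl finite_imp_closed)
  then show ?thesis
  proof eventually_elim
    case (elim n)
    interpret even_parameter "p n" "q n" by (rule even_parameter)
    show ?case
    proof (rule ccontr)
      assume "\<not> ?thesis"
      then have le: "omega (p n) (q n) \<le> N" unfolding N_def by linarith
      then have "w \<le> int N" using int_omega by simp
      then have "tune_alpha (p n) (q n) \<in> {0..int N}" using alpha_props(1,2) by (simp add: \<alpha>_def)
      then have "tune (p n) (q n) \<in> S" unfolding S_def tune_def using le by force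
      then show False using elim by simp
    qed
  qed
qed

lemma tendsto_tune_affine:
  "(\<lambda>n. of_int c * tune (p n) (q n) + of_int h) \<longlonglongrightarrow> of_int c * t + of_int h"
  by (intro tendsto_intros tuned)

lemma tune_combinations_separated:
  fixes C H :: int
  shows "\<exists>\<epsilon>>0. \<forall>\<^sub>F n in sequentially. \<forall>c h. \<bar>c\<bar> \<le> C \<longrightarrow> \<bar>h\<bar> \<le> H \<longrightarrow> (c, h) \<noteq> (0, 0) \<longrightarrow>
    \<epsilon> \<le> \<bar>of_int c * tune (p n) (q n) + of_int h\<bar>"
proof -
  let ?I = "{- C..C} \<times> {- H..H} - {(0, 0)}"
  have "\<exists>\<epsilon>>0. \<forall>\<^sub>F n in sequentially. \<forall>x\<in>?I. \<epsilon> \<le> \<bar>of_int (fst x) * tune (p n) (q n) + of_int (snd x)\<bar>"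
  proof (rule finite_family_bounded_away[where l = "\<lambda>x. of_int (fst x) * t + of_int (snd x)"])
    show "of_int (fst x) * t + of_int (snd x) \<noteq> 0" if "x \<in> ?I" for x
      using irrational_combination_eq_iff[OF t_irr, of "fst x" "snd x" 0 0] that by (auto simp: prod_eq_iff)
  qed (simp_all add: tendsto_tune_affine)
  then obtain \<epsilon> where \<epsilon>: "\<epsilon> > 0" "\<forall>\<^sub>F n in sequentially. \<forall>x\<in>?I. \<epsilon> \<le> \<bar>of_int (fst x) * tune (p n) (q n) + of_int (snd x)\<bar>"
    by blast
  from \<epsilon>(2) have "\<forall>\<^sub>F n in sequentially. \<forall>c h. \<bar>c\<bar> \<le> C \<longrightarrow> \<bar>h\<bar> \<le> H \<longrightarrow> (c, h) \<noteq> (0, 0) \<longrightarrow>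
    \<epsilon> \<le> \<bar>of_int c * tune (p n) (q n) + of_int h\<bar>"
  proof eventually_elim
    case (elim n)
    show ?case
    proof (intro allI impI)
      fix c h :: int assume "\<bar>c\<bar> \<le> C" "\<bar>h\<bar> \<le> H" "(c, h) \<noteq> (0, 0)"
      then have "(c, h) \<in> ?I" by auto
      from bspec[OF elim this] show "\<epsilon> \<le> \<bar>of_int c * tune (p n) (q n) + of_int h\<bar>" by simp
    qed
  qed
  then show ?thesis using \<epsilon>(1) by blast
qed

lemma large_polygons_dense:
  assumes uv: "0 \<le> u" "u < v" "v \<le> 1" and y: "0 \<le> y1" "y1 < y2" "y2 \<le> 1"
  shows "\<exists>\<delta>>0. \<forall>\<^sub>F n in sequentially. polygon_near (p n) (q n) \<delta> {u<..<v} {y1<..<y2}"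
proof -
  \<comment> \<open>The middle third leaves a margin for the error 1/omega and makes b - a at most
    2/3. Division by (1 + L) / 2 in the next line passes from abscissas to values of kt + i.\<close>
  define u' v' where "u' = u + (v - u) / 3" and "v' = v - (v - u) / 3"
  define a b where "a = u' * (2 / (1 + L))" and "b = v' * (2 / (1 + L))"
  have uv': "0 < u'" "u' < v'" "v' < 1" "v' - u' \<le> 1 / 3" using uv by (simp_all add: u'_def v'_def field_simps)
  have L1: "0 < 1 + L" using L_bounds by simp
  have ab: "a < b" using uv' L1 by (simp add: a_def b_def divide_strict_right_mono)
  have "b - a = (v' - u') * (2 / (1 + L))" by (simp only: a_def b_def left_diff_distrib)
  also have "\<dots> \<le> 1 / 3 * 2" using uv' L_bounds by (intro mult_mono) (auto simp: field_simps)
  finally have ab1: "b - a \<le> 1" by simp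
  obtain r0 where r0: "\<And>r. r \<ge> r0 \<Longrightarrow> \<exists>k i. \<bar>k\<bar> < r \<and> odd (k + r) \<and> a < of_int k * t + of_int i \<and> of_int k * t + of_int i < b \<and>
     (\<forall>k' i'. \<bar>k'\<bar> < r \<and> odd (k' + r) \<longrightarrow> of_int k' * t + of_int i' \<noteq> L * (of_int k * t + of_int i))"
    using unmatched_lattice_point[OF t_irr L_bounds ab ab1] by blast
  \<comment> \<open>The line has height in (y1, y2) and an index large enough to carry an unmatched
    Q-point over the middle third.\<close>
  obtain r h :: int where r: "max 1 r0 \<le> r" and rh: "y1 < r * t + h" "r * t + h < y2"
    using dense_multiples[OF t_irr y(2), of "max 1 r0" 0] by blast
  obtain k i :: int where k: "\<bar>k\<bar> < r" "odd (k + r)" and ki: "a < k * t + i" "k * t + i < b"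
    and un: "\<And>k' i'. \<bar>k'\<bar> < r \<Longrightarrow> odd (k' + r) \<Longrightarrow> of_int k' * t + of_int i' \<noteq> L * (k * t + i)"
    using r0[of r] r by auto
  have margin: "{X - e..X + e} \<subseteq> {u<..<v}" if "u + g < X" "X < v - g" "e < g" for X e g :: real
    using that by auto
  let ?\<tau> = "\<lambda>n. tune (p n) (q n)" and ?\<rho> = "\<lambda>n. real (p n) / real (q n)"
  let ?x = "\<lambda>n. (k * ?\<tau> n + i) * (1 + ?\<rho> n) / 2"
  \<comment> \<open>The P-competitors have distances with nonzero limits because (k, i) is
    unmatched; for the Q-competitors in \<open>?IQ\<close> this follows from irrationality of
    t.\<close>
  let ?IP = "{- r..r} \<times> {- r - 3..r + 3} \<inter> {x. \<bar>fst x\<bar> < r \<and> odd (fst x + r)}"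
  let ?IQ = "{- r..r} \<times> {- r - 3..r + 3} - {(k, i)}"
  have "\<exists>\<delta>>0. \<forall>\<^sub>F n in sequentially. \<forall>x\<in>?IP. \<delta> \<le> \<bar>(of_int (fst x) * ?\<tau> n + of_int (snd x)) / ?\<rho> n - (k * ?\<tau> n + i)\<bar>"
  proof (rule finite_family_bounded_away[where l = "\<lambda>x. (of_int (fst x) * t + of_int (snd x)) / L - (k * t + i)"])
    show "(\<lambda>n. (of_int (fst x) * ?\<tau> n + of_int (snd x)) / ?\<rho> n - (k * ?\<tau> n + i))
      \<longlonglongrightarrow> (of_int (fst x) * t + of_int (snd x)) / L - (k * t + i)" for x
      using L_bounds by (intro tendsto_diff tendsto_divide tendsto_tune_affine conv) simp
    show "(of_int (fst x) * t + of_int (snd x)) / L - (k * t + i) \<noteq> 0" if "x \<in> ?IP" for x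
      using un[of "fst x" "snd x"] that L_bounds by (auto simp: field_simps)
  qed simp
  then obtain \<delta>P where \<delta>P: "\<delta>P > 0" "\<forall>\<^sub>F n in sequentially. \<forall>x\<in>?IP. \<delta>P \<le> \<bar>(of_int (fst x) * ?\<tau> n + of_int (snd x)) / ?\<rho> n - (k * ?\<tau> n + i)\<bar>"
    by blast
  have "\<exists>\<delta>>0. \<forall>\<^sub>F n in sequentially. \<forall>x\<in>?IQ. \<delta> \<le> \<bar>(of_int (fst x) * ?\<tau> n + of_int (snd x)) - (k * ?\<tau> n + i)\<bar>"
  proof (rule finite_family_bounded_away[where l = "\<lambda>x. (of_int (fst x) * t + of_int (snd x)) - (k * t + i)"])
    show "(\<lambda>n. (of_int (fst x) * ?\<tau> n + of_int (snd x)) - (k * ?\<tau> n + i))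
      \<longlonglongrightarrow> (of_int (fst x) * t + of_int (snd x)) - (k * t + i)" for x
      by (intro tendsto_diff tendsto_tune_affine)
    show "(of_int (fst x) * t + of_int (snd x)) - (k * t + i) \<noteq> 0" if "x \<in> ?IQ" for x
      using irrational_combination_eq_iff[OF t_irr, of "fst x" "snd x" k i] that by (auto simp: prod_eq_iff)
  qed simp
  then obtain \<delta>Q where \<delta>Q: "\<delta>Q > 0" "\<forall>\<^sub>F n in sequentially. \<forall>x\<in>?IQ. \<delta>Q \<le> \<bar>(of_int (fst x) * ?\<tau> n + of_int (snd x)) - (k * ?\<tau> n + i)\<bar>"
    by blast
  define \<delta> where "\<delta> = min \<delta>P \<delta>Q"
  have \<delta>: "\<delta> > 0" using \<delta>P \<delta>Q by (simp add: \<delta>_def)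
  have xlim: "?x \<longlonglongrightarrow> (k * t + i) * (1 + L) / 2"
    by (intro tendsto_intros tendsto_tune_affine conv) auto
  have "u' < (k * t + i) * (1 + L) / 2" "(k * t + i) * (1 + L) / 2 < v'"
    using ki L1 by (simp_all add: a_def b_def field_simps)
  then have ex: "\<forall>\<^sub>F n in sequentially. u' < ?x n" "\<forall>\<^sub>F n in sequentially. ?x n < v'"
    using order_tendstoD[OF xlim] by auto
  have ey: "\<forall>\<^sub>F n in sequentially. y1 < r * ?\<tau> n + h" "\<forall>\<^sub>F n in sequentially. r * ?\<tau> n + h < y2"
    using order_tendstoD[OF tendsto_tune_affine[of r h]] rh by auto
  have "\<forall>\<^sub>F n in sequentially. polygon_near (p n) (q n) (\<delta> / 4) {u<..<v} {y1<..<y2}"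
    using ex ey \<delta>P(2) \<delta>Q(2) omega_large[of "2 * r"] omega_large[of "4 / \<delta>"] omega_large[of "3 / (v - u)"]
  proof eventually_elim
    case (elim n)
    interpret even_parameter "p n" "q n" by (rule even_parameter)
    note el = elim[unfolded tune_eq real_omega \<rho>_def[symmetric]]
    have W0: "0 < real_of_int w" using w_pos by simp
    have W3: "1 / real_of_int w < (v - u) / 3" using el(9) uv W0 by (simp add: field_simps)
    show ?case
    proof (rule polygon_near_isolated[of r h _ k i])
      show "0 < r" "2 * r < w" using r el(7) by auto
      show "0 < r * \<tau> + h" "r * \<tau> + h < 1" "r * \<tau> + h \<in> {y1<..<y2}" using el(3,4) y by auto
      show "\<bar>k\<bar> < r" "odd (k + r)" by fact+
      show "0 < (k * \<tau> + i) * (1 + \<rho>) / 2" "(k * \<tau> + i) * (1 + \<rho>) / 2 < 1" using el(1,2) uv' by linarith+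
      have "u + (v - u) / 3 < (k * \<tau> + i) * (1 + \<rho>) / 2" "(k * \<tau> + i) * (1 + \<rho>) / 2 < v - (v - u) / 3"
        using el(1,2) unfolding u'_def v'_def .
      then show "{(k * \<tau> + i) * (1 + \<rho>) / 2 - 1 / real_of_int w..(k * \<tau> + i) * (1 + \<rho>) / 2 + 1 / real_of_int w} \<subseteq> {u<..<v}"
        using W3 by (rule margin)
      show "\<delta> \<le> \<bar>(of_int k' * \<tau> + of_int i') - (k * \<tau> + i)\<bar>" if "\<bar>k'\<bar> < r" "\<bar>i'\<bar> \<le> r + 3" "(k', i') \<noteq> (k, i)" for k' i'
      proof -
        have "(k', i') \<in> ?IQ" using that by auto
        from bspec[OF el(6) this] show ?thesis unfolding \<delta>_def by simp
      qed
      show "\<delta> \<le> \<bar>(of_int k' * \<tau> + of_int i') / \<rho> - (k * \<tau> + i)\<bar>" if "\<bar>k'\<bar> < r" "odd (k' + r)" "\<bar>i'\<bar> \<le> r + 3" for k' i'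
      proof -
        have "(k', i') \<in> ?IP" using that by auto
        from bspec[OF el(5) this] show ?thesis unfolding \<delta>_def by simp
      qed
      show "4 \<le> \<delta> * real_of_int w" using el(8) \<delta> by (simp add: field_simps)
    qed
  qed
  then show ?thesis using \<delta> by (intro exI[of _ "\<delta> / 4"]) simp
qed

lemma large_polygons_in_grid:
  fixes M :: nat
  shows "\<exists>\<delta>>0. \<forall>\<^sub>F n in sequentially. \<forall>j<M. \<forall>l<M.
    polygon_near (p n) (q n) \<delta> {real j / real M<..<(real j + 1) / real M} {real l / real M<..<(real l + 1) / real M}"
proof -
  have "\<exists>\<delta>>0. \<forall>\<^sub>F n in sequentially. \<forall>x\<in>{..<M} \<times> {..<M}.
    polygon_near (p n) (q n) \<delta> {real (fst x) / real M<..<(real (fst x) + 1) / real M}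
       {real (snd x) / real M<..<(real (snd x) + 1) / real M}"
  proof (rule uniform_threshold)
    fix x assume "x \<in> {..<M} \<times> {..<M}"
    then have "0 < M" "real (fst x) + 1 \<le> M" "real (snd x) + 1 \<le> M" by auto
    then show "\<exists>\<delta>>0. \<forall>\<^sub>F n in sequentially. polygon_near (p n) (q n) \<delta>
      {real (fst x) / real M<..<(real (fst x) + 1) / real M} {real (snd x) / real M<..<(real (snd x) + 1) / real M}"
      by (intro large_polygons_dense) (simp_all add: divide_strict_right_mono)
  qed (auto intro: polygon_near_antimono)
  then obtain \<delta> where \<delta>: "\<delta> > 0" and ev: "\<forall>\<^sub>F n in sequentially. \<forall>x\<in>{..<M} \<times> {..<M}.
    polygon_near (p n) (q n) \<delta> {real (fst x) / real M<..<(real (fst x) + 1) / real M}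
       {real (snd x) / real M<..<(real (snd x) + 1) / real M}" by blast
  from ev have "\<forall>\<^sub>F n in sequentially. \<forall>j<M. \<forall>l<M.
    polygon_near (p n) (q n) \<delta> {real j / real M<..<(real j + 1) / real M} {real l / real M<..<(real l + 1) / real M}"
    by eventually_elim auto
  then show ?thesis using \<delta> by blast
qed

text \<open>Order of choice: \<delta>0 fixes the cell size 2/M, density then fixes the index bound
  R, separation of the cuts fixes \<epsilon>, this fixes the finer mesh 1/M', and density of large
  polygons at that mesh fixes \<delta>. All of this precedes n.\<close>

lemma polygons_at_small_scale:
  assumes "0 < \<delta>0"
  shows "\<exists>\<delta>>0. \<forall>\<^sub>F n in sequentially. \<forall>i k. \<exists>S\<in>plaid_polygons (p n) (q n). S \<subseteq> block_interior (p n) (q n) i k \<and>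
    \<delta> * real (omega (p n) (q n)) \<le> x_diameter S \<and> x_diameter S < \<delta>0 * real (omega (p n) (q n))"
proof -
  obtain M :: nat where M: "0 < M" "2 / M < \<delta>0"
  proof -
    obtain M :: nat where "2 / \<delta>0 < M" using reals_Archimedean2 by blast
    moreover from this have "0 < real M" using assms by (metis divide_pos_pos less_trans zero_less_numeral)
    ultimately show thesis using assms by (intro that[of M]) (simp_all add: field_simps)
  qed
  have "\<exists>(r :: int) (h :: int). (1 :: int) \<le> r \<and> real j / M < r * t + h \<and> r * t + h < (real j + 1) / M" for j :: nat
  proof -
    have "real j / M < (real j + 1) / M" using M by (simp add: divide_strict_right_mono)
    then obtain r h :: int where "1 \<le> r" "real j / M < r * t + h" "r * t + h < (real j + 1) / M"
      using dense_multiples[OF t_irr, of "real j / M" "(real j + 1) / M" 1 0] by blast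
    then show ?thesis by (intro exI[of _ r] exI[of _ h]) simp
  qed
  then obtain rr hh :: "nat \<Rightarrow> int" where rh: "\<And>j. (1 :: int) \<le> rr j" "\<And>j. real j / M < rr j * t + hh j" "\<And>j. rr j * t + hh j < (real j + 1) / M"
    by metis
  \<comment> \<open>The sum is a common bound for the indices \<open>rr j\<close>, since all
    summands are positive.\<close>
  define R where "R = (\<Sum>j<M. rr j)"
  have rr0: "0 \<le> rr j" for j using rh(1)[of j] by linarith
  have R0: "0 \<le> R" unfolding R_def by (intro sum_nonneg rr0)
  have rR: "rr j \<le> R" if "j < M" for j
    unfolding R_def using that rr0 by (intro member_le_sum) auto
  obtain \<epsilon> where \<epsilon>: "\<epsilon> > 0" and sep: "\<forall>\<^sub>F n in sequentially. \<forall>c h. \<bar>c\<bar> \<le> 2 * R \<longrightarrow> \<bar>h\<bar> \<le> 2 * R + 2 \<longrightarrow> (c, h) \<noteq> (0, 0) \<longrightarrow>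
    \<epsilon> \<le> \<bar>of_int c * tune (p n) (q n) + of_int h\<bar>"
    using tune_combinations_separated by blast
  obtain M' :: nat where M': "0 < M'" "2 / M' \<le> \<epsilon>"
  proof -
    obtain M :: nat where "2 / \<epsilon> < M" using reals_Archimedean2 by blast
    moreover from this have "0 < real M" using \<epsilon> by (metis divide_pos_pos less_trans zero_less_numeral)
    ultimately show thesis using \<epsilon> by (intro that[of M]) (simp_all add: field_simps)
  qed
  obtain \<delta> where \<delta>: "\<delta> > 0" and near: "\<forall>\<^sub>F n in sequentially. \<forall>j<M'. \<forall>l<M'.
    polygon_near (p n) (q n) \<delta> {real j / real M'<..<(real j + 1) / real M'} {real l / real M'<..<(real l + 1) / real M'}"
    using large_polygons_in_grid by blast
  have "\<forall>\<^sub>F n in sequentially. \<forall>j\<in>{..<M}. real j / M < rr j * tune (p n) (q n) + hh j \<and> rr j * tune (p n) (q n) + hh j < (real j + 1) / M"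
  proof (rule eventually_ball_finite)
    show "\<forall>j\<in>{..<M}. \<forall>\<^sub>F n in sequentially. real j / M < rr j * tune (p n) (q n) + hh j \<and> rr j * tune (p n) (q n) + hh j < (real j + 1) / M"
      using order_tendstoD[OF tendsto_tune_affine] rh by (auto intro: eventually_conj)
  qed simp
  then have "\<forall>\<^sub>F n in sequentially. \<forall>i k. \<exists>S\<in>plaid_polygons (p n) (q n). S \<subseteq> block_interior (p n) (q n) i k \<and>
    \<delta> * real (omega (p n) (q n)) \<le> x_diameter S \<and> x_diameter S < \<delta>0 * real (omega (p n) (q n))"
    using sep near omega_large[of "2 * R"]
  proof eventually_elim
    case (elim n)
    interpret even_parameter "p n" "q n" by (rule even_parameter)
    note el = elim[unfolded tune_eq real_omega]
    have W0: "0 < real_of_int w" using w_pos by simp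
    show ?case
    proof (intro allI)
      fix i k
      obtain S where S: "S \<in> plaid_polygons (p n) (q n)" "S \<subseteq> block_interior (p n) (q n) i k"
        "\<delta> * real_of_int w \<le> x_diameter S" "x_diameter S \<le> 2 / M * real_of_int w"
      proof (rule small_polygon[of R M \<epsilon> M' \<delta> i k])
        show "0 \<le> R" "0 < M" "0 < M'" "2 / M' \<le> \<epsilon>" by fact+
        show "2 * R < w" using el(4) by linarith
        show "\<exists>r h. 0 < r \<and> r \<le> R \<and> real j / M < of_int r * \<tau> + of_int h \<and> of_int r * \<tau> + of_int h < (real j + 1) / M" if "j < M" for j
          using el(1) that rR[OF that] rh(1)[of j] by (intro exI[of _ "rr j"] exI[of _ "hh j"]) auto
        show "\<epsilon> \<le> \<bar>of_int c * \<tau> + of_int h\<bar>" if "\<bar>c\<bar> \<le> 2 * R" "\<bar>h\<bar> \<le> 2 * R + 2" "(c, h) \<noteq> (0, 0)" for c h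
          using el(2) that by blast
        show "polygon_near (p n) (q n) \<delta> {real j / real M'<..<(real j + 1) / real M'} {real l / real M'<..<(real l + 1) / real M'}"
          if "j < M'" "l < M'" for j l using el(3) that by blast
      qed
      have "2 / M * real_of_int w < \<delta>0 * real_of_int w" using M(2) W0 by (rule mult_strict_right_mono)
      then show "\<exists>S\<in>plaid_polygons (p n) (q n). S \<subseteq> block_interior (p n) (q n) i k \<and>
        \<delta> * real (omega (p n) (q n)) \<le> x_diameter S \<and> x_diameter S < \<delta>0 * real (omega (p n) (q n))"
        using S unfolding real_omega by (intro bexI[of _ S]) auto
    qed
  qed
  then show ?thesis using \<delta> by blast
qed

text \<open>The next polygon has x-diameter below \<delta> times omega, a lower bound for all
  earlier ones, so it is none of them.\<close>

lemma many_polygons: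
  "\<exists>\<delta>>0. \<forall>\<^sub>F n in sequentially. \<forall>i k. \<exists>F. finite F \<and> card F = N \<and>
    F \<subseteq> {S \<in> plaid_polygons (p n) (q n). S \<subseteq> block_interior (p n) (q n) i k \<and> \<delta> * real (omega (p n) (q n)) \<le> x_diameter S}"
proof (induction N)
  case 0
  have "\<exists>F. finite F \<and> card F = 0 \<and> F \<subseteq> X" for X :: "(real \<times> real) set set" by (intro exI[of _ "{}"]) simp
  then show ?case by (intro exI[of _ "1 :: real"] conjI zero_less_one always_eventually allI)
next
  case (Suc N)
  then obtain \<delta> where \<delta>: "\<delta> > 0" "\<forall>\<^sub>F n in sequentially. \<forall>i k. \<exists>F. finite F \<and> card F = N \<and>
    F \<subseteq> {S \<in> plaid_polygons (p n) (q n). S \<subseteq> block_interior (p n) (q n) i k \<and> \<delta> * real (omega (p n) (q n)) \<le> x_diameter S}"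
    by blast
  obtain \<delta>' where \<delta>': "\<delta>' > 0" "\<forall>\<^sub>F n in sequentially. \<forall>i k. \<exists>S\<in>plaid_polygons (p n) (q n). S \<subseteq> block_interior (p n) (q n) i k \<and>
    \<delta>' * real (omega (p n) (q n)) \<le> x_diameter S \<and> x_diameter S < \<delta> * real (omega (p n) (q n))"
    using polygons_at_small_scale[OF \<delta>(1)] by blast
  have "\<forall>\<^sub>F n in sequentially. \<forall>i k. \<exists>F. finite F \<and> card F = Suc N \<and>
    F \<subseteq> {S \<in> plaid_polygons (p n) (q n). S \<subseteq> block_interior (p n) (q n) i k \<and> min \<delta> \<delta>' * real (omega (p n) (q n)) \<le> x_diameter S}"
    using \<delta>(2) \<delta>'(2)
  proof eventually_elim
    case (elim n)
    show ?case
    proof (intro allI)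
      fix i k
      obtain F where F: "finite F" "card F = N"
        "F \<subseteq> {S \<in> plaid_polygons (p n) (q n). S \<subseteq> block_interior (p n) (q n) i k \<and> \<delta> * real (omega (p n) (q n)) \<le> x_diameter S}"
        using elim(1) by blast
      obtain S where S: "S \<in> plaid_polygons (p n) (q n)" "S \<subseteq> block_interior (p n) (q n) i k"
        "\<delta>' * real (omega (p n) (q n)) \<le> x_diameter S" "x_diameter S < \<delta> * real (omega (p n) (q n))"
        using elim(2) by blast
      have le: "min \<delta> \<delta>' * real (omega (p n) (q n)) \<le> \<delta> * real (omega (p n) (q n))"
        "min \<delta> \<delta>' * real (omega (p n) (q n)) \<le> \<delta>' * real (omega (p n) (q n))"
        by (intro mult_right_mono; simp)+
      have "S \<notin> F" using F(3) S(4) by force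
      then have "card (insert S F) = Suc N" using F(1,2) by simp
      moreover have "insert S F \<subseteq> {S \<in> plaid_polygons (p n) (q n). S \<subseteq> block_interior (p n) (q n) i k \<and>
         min \<delta> \<delta>' * real (omega (p n) (q n)) \<le> x_diameter S}"
        using F(3) S(1-3) le by (auto intro: order_trans)
      ultimately show "\<exists>F. finite F \<and> card F = Suc N \<and>
        F \<subseteq> {S \<in> plaid_polygons (p n) (q n). S \<subseteq> block_interior (p n) (q n) i k \<and> min \<delta> \<delta>' * real (omega (p n) (q n)) \<le> x_diameter S}"
        using F(1) by blast
    qed
  qed
  then show ?case using \<delta>(1) \<delta>'(1) by (intro exI[of _ "min \<delta> \<delta>'"]) simp
qed

end

lemma grid_index:
  fixes x :: real and M :: nat
  assumes "0 \<le> x" "x \<le> 1" "0 < M"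
  obtains j where "j < M" "real j / real M \<le> x" "x \<le> (real j + 1) / real M"
proof (cases "x = 1")
  case True
  then show thesis using assms by (intro that[of "M - 1"]) (simp_all add: of_nat_diff)
next
  case False
  define j where "j = nat \<lfloor>x * M\<rfloor>"
  have "real j = of_int \<lfloor>x * M\<rfloor>" using assms(1) by (simp add: j_def)
  then have "real j \<le> x * M" "x * M < real j + 1" by linarith+
  moreover have "x * M < M" using False assms by simp
  ultimately have "real j < real M" by linarith
  then show thesis using \<open>real j \<le> x * M\<close> \<open>x * M < real j + 1\<close> assms(3) by (intro that[of j]) (simp_all add: field_simps)
qed

theorem theorem4p2:
  fixes p q :: "nat \<Rightarrow> nat" and B :: "nat \<Rightarrow> (real \<times> real) set" and N :: nat
    and L t :: real
  assumes params: "\<And>k. even_param (p k) (q k)"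
    and conv: "(\<lambda>k. real (p k) / real (q k)) \<longlonglongrightarrow> L" and L_irr: "L \<notin> \<rat>"
    and tuned: "(\<lambda>k. tune (p k) (q k)) \<longlonglongrightarrow> t" and t_irr: "t \<notin> \<rat>"
    and blocks: "\<And>k. is_block (p k) (q k) (B k)"
    and N_pos: "0 < N"
  shows "\<exists>\<delta>>0. \<forall>\<^sub>F k in sequentially.
     (\<exists>F. finite F \<and> card F = N \<and>
        F \<subseteq> {S \<in> plaid_polygons (p k) (q k). S \<subseteq> B k \<and>
                 x_diameter S \<ge> \<delta> * real (omega (p k) (q k))}) \<and>
     (\<forall>z\<in>B k. \<exists>S\<in>plaid_polygons (p k) (q k).
        x_diameter S \<ge> \<delta> * real (omega (p k) (q k)) \<and>
        (\<exists>w\<in>S. dist z w \<le> real (omega (p k) (q k)) / real N))"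
proof -
  interpret tuned_sequence p q L t by unfold_locales (fact params conv L_irr tuned t_irr)+
  \<comment> \<open>Each coordinate is matched up to omega / (2N), and the two errors add up to
    omega / N.\<close>
  define M where "M = 2 * N"
  have M: "0 < M" using N_pos by (simp add: M_def)
  obtain \<delta>1 where \<delta>1: "\<delta>1 > 0" "\<forall>\<^sub>F n in sequentially. \<forall>i k. \<exists>F. finite F \<and> card F = N \<and>
    F \<subseteq> {S \<in> plaid_polygons (p n) (q n). S \<subseteq> block_interior (p n) (q n) i k \<and> \<delta>1 * real (omega (p n) (q n)) \<le> x_diameter S}"
    using many_polygons by blast
  obtain \<delta>2 where \<delta>2: "\<delta>2 > 0" "\<forall>\<^sub>F n in sequentially. \<forall>j<M. \<forall>l<M.
    polygon_near (p n) (q n) \<delta>2 {real j / real M<..<(real j + 1) / real M} {real l / real M<..<(real l + 1) / real M}"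
    using large_polygons_in_grid by blast
  define \<delta> where "\<delta> = min \<delta>1 \<delta>2"
  have "\<forall>\<^sub>F k in sequentially.
     (\<exists>F. finite F \<and> card F = N \<and>
        F \<subseteq> {S \<in> plaid_polygons (p k) (q k). S \<subseteq> B k \<and>
                 x_diameter S \<ge> \<delta> * real (omega (p k) (q k))}) \<and>
     (\<forall>z\<in>B k. \<exists>S\<in>plaid_polygons (p k) (q k).
        x_diameter S \<ge> \<delta> * real (omega (p k) (q k)) \<and>
        (\<exists>w\<in>S. dist z w \<le> real (omega (p k) (q k)) / real N))"
    using \<delta>1(2) \<delta>2(2)
  proof eventually_elim
    case (elim n)
    define W where "W = real (omega (p n) (q n))"
    have W0: "0 < W" using params[of n] by (simp add: W_def omega_def even_param_def)
    have le: "\<delta> * W \<le> \<delta>1 * W" "\<delta> * W \<le> \<delta>2 * W" using W0 by (auto simp: \<delta>_def intro!: mult_right_mono)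
    obtain i k :: int where B: "B n = {(x, y). i * W\<^sup>2 \<le> x \<and> x \<le> i * W\<^sup>2 + W \<and> k * W \<le> y \<and> y \<le> k * W + W}"
      using blocks[of n] unfolding is_block_def W_def by blast
    have sub: "block_interior (p n) (q n) i k \<subseteq> B n"
      unfolding B block_interior_def W_def[symmetric] by auto
    obtain F where F: "finite F" "card F = N"
      "F \<subseteq> {S \<in> plaid_polygons (p n) (q n). S \<subseteq> block_interior (p n) (q n) i k \<and> \<delta>1 * W \<le> x_diameter S}"
      using elim(1) unfolding W_def by blast
    have "F \<subseteq> {S \<in> plaid_polygons (p n) (q n). S \<subseteq> B n \<and> \<delta> * W \<le> x_diameter S}"
      using F(3) sub le(1) by (auto intro: order_trans)
    moreover have "\<exists>S\<in>plaid_polygons (p n) (q n). \<delta> * W \<le> x_diameter S \<and> (\<exists>w\<in>S. dist z w \<le> W / real N)" if "z \<in> B n" for z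
    proof -
      define x y where "x = (fst z - i * W\<^sup>2) / W" and "y = (snd z - k * W) / W"
      have z: "z = (i * W\<^sup>2 + W * x, k * W + W * y)" using W0 by (simp add: x_def y_def prod_eq_iff)
      have xy: "0 \<le> x" "x \<le> 1" "0 \<le> y" "y \<le> 1" using that W0 unfolding B by (auto simp: x_def y_def field_simps)
      obtain j where j: "j < M" "real j / real M \<le> x" "x \<le> (real j + 1) / real M" using grid_index[OF xy(1,2) M] by blast
      obtain l where l: "l < M" "real l / real M \<le> y" "y \<le> (real l + 1) / real M" using grid_index[OF xy(3,4) M] by blast
      have "polygon_near (p n) (q n) \<delta>2 {real j / real M<..<(real j + 1) / real M} {real l / real M<..<(real l + 1) / real M}"
        using elim(2) j(1) l(1) by blast
      then obtain S x' y' where S: "S \<in> plaid_polygons (p n) (q n)" "\<delta>2 * W \<le> x_diameter S"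
        "x' \<in> {real j / real M<..<(real j + 1) / real M}" "y' \<in> {real l / real M<..<(real l + 1) / real M}"
        "(i * W\<^sup>2 + W * x', k * W + W * y') \<in> S"
        unfolding polygon_near_def W_def by blast
      have "\<bar>x - x'\<bar> \<le> 1 / M" "\<bar>y - y'\<bar> \<le> 1 / M"
        using S(3,4) j(2,3) l(2,3) by (auto simp: add_divide_distrib abs_le_iff)
      then have "W * \<bar>x - x'\<bar> \<le> W * (1 / M)" "W * \<bar>y - y'\<bar> \<le> W * (1 / M)"
        using W0 by (simp_all only: mult_le_cancel_left_pos)
      moreover have "dist z (i * W\<^sup>2 + W * x', k * W + W * y') \<le> \<bar>W * x - W * x'\<bar> + \<bar>W * y - W * y'\<bar>"
        unfolding z dist_Pair_Pair dist_real_def by (rule order_trans[OF sqrt_sum_squares_le_sum_abs]) simp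
      moreover have "\<bar>W * x - W * x'\<bar> = W * \<bar>x - x'\<bar>" "\<bar>W * y - W * y'\<bar> = W * \<bar>y - y'\<bar>"
        using W0 by (simp_all add: abs_mult flip: right_diff_distrib)
      moreover have "W * (1 / M) + W * (1 / M) = W / N" using N_pos by (simp add: M_def)
      ultimately have "dist z (i * W\<^sup>2 + W * x', k * W + W * y') \<le> W / N" by linarith
      then show ?thesis using S(1,2,5) le(2) by (intro bexI[of _ S] conjI bexI[of _ "(i * W\<^sup>2 + W * x', k * W + W * y')"]) auto
    qed
    ultimately show ?case using F(1,2) unfolding W_def by blast
  qed
  moreover have "\<delta> > 0" using \<delta>1(1) \<delta>2(1) by (simp add: \<delta>_def)
  ultimately show ?thesis by blast
qed

end
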